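(* Let $2\le p<\infty$ and let $f\in L^p$ be a first-order Haar chaos, $f=\sum_{k\ge0}c_kh_{2^k}$. The following conditions are equivalent: (i) the system of dilations and translations $\{f_n\}_{n\ge1}$ of $f$ is a basis of $L^p_0$ equivalent to the Haar system $\{h_n\}_{n\ge1}$; (ii) for every $d=1,2,\dots$ the subsystem $\{f_n\}_{n\in N_d}$ is a basis of the subspace $\mathcal H^d_{ch}\cap L^p$ equivalent to the Haar subsystem $\{h_n\}_{n\in N_d}$; (iii) the subsystem $\{f_{2^k}\}_{k\ge0}$ is a basis of the subspace $\mathcal H^1_{ch}\cap L^p$ equivalent to the Haar subsystem $\{h_{2^k}\}_{k\ge0}$; (iv) the functions $\hat f(z)$ and $1/\hat f(z)$ both belong to $M_p^+(\mathbb D_{2^{-1/p}})$.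
   Context: All functions are complex-valued on $I=(0,1]$ with Lebesgue measure; $L^p_0$ denotes the closed subspace of mean-zero functions in $L^p(0,1)$. Let $h=\chi_{(0,1/2]}-\chi_{(1/2,1]}$. For $n=2^k+j$ with $k\ge0$, $0\le j\le 2^k-1$, the Haar function $h_n$ equals $h(2^kt-j)$ for $t\in(j2^{-k},(j+1)2^{-k}]$ and $0$ otherwise. For a mean-zero $f\in L^1$, its system of dilations and translations $\{f_n\}_{n\ge1}$ is defined by $f_n(t)=f(2^kt-j)$ for $t\in(j2^{-k},(j+1)2^{-k}]$ and $f_n(t)=0$ otherwise, with the same $n=2^k+j$. A first-order Haar chaos is a function $f=\sum_{k\ge0}c_kh_{2^k}$, $c_k\in\mathbb C$ (the sum is finite at each point of $I$); its symbol is the power series $\hat f(z)=\sum_{k\ge0}c_kz^k$. For $d\ge1$, $N_d$ is the set of positive integers with exactly $d$ ones in their binary expansion; $\mathcal H^d_{ch}$ is the set of functions $\sum_{n\in N_d}\xi_nh_n$ (Haar chaoses of order $d$), and for $1<p<\infty$, $\mathcal H^d_{ch}\cap L^p$ equals the closed linear span of $\{h_n\}_{n\in N_d}$ in $L^p$. For $1\le p\le\infty$, $R>0$, $A_p^+(\mathbb D_R)$ is the Banach space of analytic $u(z)=\sum_k a_kz^k$ in $\mathbb D_R=\{|z|<R\}$ with $\|u\|=\|(a_kR^k)_k\|_{\ell^p}<\infty$; $M_p^+(\mathbb D_R)$ is the Banach algebra of those $u\in A_p^+(\mathbb D_R)$ with $uv\in A_p^+(\mathbb D_R)$ for all $v\in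 A_p^+(\mathbb D_R)$, normed by the multiplication operator norm. A sequence $\{f_n\}_{n\in N}$ is a basis of a closed subspace $Y$ equivalent to $\{h_n\}_{n\in N}$ if there is a linear isomorphism (bounded with bounded inverse) of the closed span $[h_n:n\in N]$ onto $Y$ mapping $h_n$ to $f_n$ for all $n\in N$. *)

theory Defs
  imports "HOL-Analysis.Analysis" "HOL-Library.Discrete_Functions"
begin

definition unitI :: "real set" where "unitI = {0<..1}"

text \<open>L^p membership and the L^p (semi)norm on I (functions are representatives of a.e.-classes).\<close>
definition memLp :: "real \<Rightarrow> (real \<Rightarrow> complex) \<Rightarrow> bool" where
  "memLp p g \<longleftrightarrow> g \<in> borel_measurable (lebesgue_on unitI) \<and>
     (\<integral>\<^sup>+ x. ennreal (cmod (g x) powr p) \<partial>(lebesgue_on unitI)) < \<infinity>"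

definition Lp_norm :: "real \<Rightarrow> (real \<Rightarrow> complex) \<Rightarrow> real" where
  "Lp_norm p g = enn2real (\<integral>\<^sup>+ x. ennreal (cmod (g x) powr p) \<partial>(lebesgue_on unitI)) powr (1 / p)"

definition Lp0 :: "real \<Rightarrow> (real \<Rightarrow> complex) set" where
  "Lp0 p = {g. memLp p g \<and> (\<integral>x. g x \<partial>(lebesgue_on unitI)) = 0}"

definition haar0 :: "real \<Rightarrow> complex" where
  "haar0 t = (if 0 < t \<and> t \<le> 1/2 then 1 else if 1/2 < t \<and> t \<le> 1 then -1 else 0)"

definition dil :: "(real \<Rightarrow> complex) \<Rightarrow> nat \<Rightarrow> real \<Rightarrow> complex" where
  "dil f n t = (let k = floor_log n; j = n - 2 ^ k in
     if real j / 2 ^ k < t \<and> t \<le> (real j + 1) / 2 ^ k then f (2 ^ k * t - real j) else 0)"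

definition haar :: "nat \<Rightarrow> real \<Rightarrow> complex" where
  "haar n = dil haar0 n"

text \<open>First-order Haar chaos with coefficients c: sum of c_k h_{2^k} (finite at each point).\<close>
definition chaos1 :: "(nat \<Rightarrow> complex) \<Rightarrow> real \<Rightarrow> complex" where
  "chaos1 c t = (\<Sum>k. c k * haar (2 ^ k) t)"

definition symbol :: "(nat \<Rightarrow> complex) \<Rightarrow> complex \<Rightarrow> complex" where
  "symbol c z = (\<Sum>k. c k * z ^ k)"

definition Nd :: "nat \<Rightarrow> nat set" where
  "Nd d = {n. 0 < n \<and> card {i. bit n i} = d}"

definition cspan :: "real \<Rightarrow> (nat \<Rightarrow> real \<Rightarrow> complex) \<Rightarrow> nat set \<Rightarrow> (real \<Rightarrow> complex) set" where
  "cspan p u N = {g. memLp p g \<and> (\<forall>\<epsilon>>0. \<exists>F a. finite F \<and> F \<subseteq> N \<and>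
       Lp_norm p (\<lambda>t. g t - (\<Sum>n\<in>F. a n * u n t)) < \<epsilon>)}"

text \<open>{u_n}_{n\<in>N} is a basis of the closed subspace Y equivalent to {h_n}_{n\<in>N}:
  there is a linear isomorphism T (bounded with bounded inverse) of [h_n : n \<in> N] onto Y
  with T h_n = u_n. Everything is modulo a.e. equality (i.e. zero L^p seminorm).\<close>
definition equiv_haar_basis :: "real \<Rightarrow> (nat \<Rightarrow> real \<Rightarrow> complex) \<Rightarrow> nat set \<Rightarrow> (real \<Rightarrow> complex) set \<Rightarrow> bool" where
  "equiv_haar_basis p u N Y \<longleftrightarrow>
     (\<exists>T C. C > 0 \<and>
        (\<forall>x\<in>cspan p haar N. T x \<in> Y \<and>
            Lp_norm p (T x) \<le> C * Lp_norm p x \<and> Lp_norm p x \<le> C * Lp_norm p (T x)) \<and>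
        (\<forall>x\<in>cspan p haar N. \<forall>y\<in>cspan p haar N. \<forall>a b.
            Lp_norm p (\<lambda>t. T (\<lambda>s. a * x s + b * y s) t - (a * T x t + b * T y t)) = 0) \<and>
        (\<forall>y\<in>Y. \<exists>x\<in>cspan p haar N. Lp_norm p (\<lambda>t. T x t - y t) = 0) \<and>
        (\<forall>n\<in>N. Lp_norm p (\<lambda>t. T (haar n) t - u n t) = 0))"

definition Ap_plus :: "real \<Rightarrow> real \<Rightarrow> (complex \<Rightarrow> complex) set" where
  "Ap_plus p R = {u. \<exists>a. (\<forall>z\<in>ball 0 R. (\<lambda>k. a k * z ^ k) sums u z) \<and>
                        summable (\<lambda>k. (cmod (a k) * R ^ k) powr p)}"

definition Mp_plus :: "real \<Rightarrow> real \<Rightarrow> (complex \<Rightarrow> complex) set" where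
  "Mp_plus p R = {u. u \<in> Ap_plus p R \<and> (\<forall>v\<in>Ap_plus p R. (\<lambda>z. u z * v z) \<in> Ap_plus p R)}"

end

theory Submission
  imports Defs
begin

text \<open>
  Index Haar functions by the nodes \<open>n \<ge> 1\<close> of the binary tree.  For a first-order chaos with
  coefficients \<open>c\<close> the operator \<open>h\<^sub>n \<mapsto> f\<^sub>n\<close> is \<open>\<Sum>\<^sub>k c\<^sub>k S\<^sup>k\<close> with \<open>S h\<^sub>n = h\<^sub>2\<^sub>n\<close>; it acts separately on
  every chain \<open>m, 2m, 4m, \<dots>\<close> with \<open>m\<close> odd, as convolution with \<open>c\<close>, and on one chain the \<open>L\<^sup>p\<close> norm
  is equivalent to the weighted norm \<open>(\<Sum>\<^sub>k |b\<^sub>k|\<^sup>p 2\<^sup>-\<^sup>k)\<^sup>1\<^sup>/\<^sup>p\<close>.  This gives the equivalence of (iii) with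
  (iv).  The point is that boundedness on one chain implies boundedness on all of \<open>L\<^sup>p\<close>: grouping the
  Haar expansion by chains turns it into a martingale whose differences are first-order chaoses, and by
  a Burkholder--Rosenthal inequality for \<open>p \<ge> 2\<close> its norm is controlled by the conditional square
  function and by the \<open>\<ell>\<^sup>p\<close> norm of the differences.  Both are controlled chain by chain, the first one
  by an \<open>\<ell>\<^sup>2\<close> bound that follows from the \<open>\<ell>\<^sup>p\<close> bound because \<open>2\<^sup>-\<^sup>1\<^sup>/\<^sup>2 \<le> 2\<^sup>-\<^sup>1\<^sup>/\<^sup>p\<close>.
\<close>

section \<open>Inequalities for powers of the modulus\<close>

text \<open>The obstacle is a mismatch of weights. The upper two-point bound for |G|^p produces
  terms (|G| + |\<eta>|)^(p-2) |\<eta>|^2, whose weight varies along a chain, whereas the hypothesis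
  on c compares \<eta> with \<xi> only through sums over whole chains. The weight is therefore
  frozen at the odd root of each chain. The error is the partial sum of the current chain alone; it
  costs only p-th powers of the differences, because half of the mass leaves a chain at every step.
  What remains is a mixed term |G|^(p-2) |\<xi>|^2, estimated through the conditional square
  function of \<xi>. There E |G|^p reappears with an arbitrarily small coefficient and is absorbed
  on the left; everything happens on finite trees, so absorption is legitimate. Passage to functions
  goes through cell averages only: a function in L^p is determined by them, and a bounded family of
  them is realised by a function.\<close>

lemma powr_tangent:
  fixes a b r :: real
  assumes "0 \<le> a" "0 \<le> b" "1 \<le> r"
  shows "a powr r + r * a powr (r - 1) * (b - a) \<le> b powr r"
proof (cases "a = 0")
  case False
  hence a: "a > 0" using assms by simp
  show ?thesis
  \<comment> \<open>The tangent lemma wants both points in the open half-line, so b = 0 is computed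
    by hand. At a = 0 all terms on the left vanish, since \<open>0 powr x\<close> is 0 for every
    exponent.\<close>
  proof (cases "b = 0")
    case True
    have e: "a powr (r - 1) * a = a powr r" using a by (simp add: powr_diff)
    have "a powr r + r * a powr (r - 1) * (b - a) = a powr r - r * (a powr (r - 1) * a)"
      using True by simp
    also have "\<dots> = (1 - r) * a powr r" unfolding e by (simp add: left_diff_distrib)
    also have "\<dots> \<le> 0" using assms by (simp add: mult_nonpos_nonneg)
    finally show ?thesis using True by simp
  next
    case False
    hence b: "b > 0" using assms by simp
    have "r * a powr (r - 1) * (b - a) \<le> b powr r - a powr r"
    proof (rule convex_on_imp_above_tangent)
      show "convex_on {0<..} (\<lambda>x::real. x powr r)"
        using assms by (intro powr_convex) auto
      show "((\<lambda>x. x powr r) has_field_derivative r * a powr (r - 1)) (at a within {0<..})"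
        by (rule DERIV_subset[OF has_real_derivative_powr]) (use a in auto)
    qed (use a b in \<open>auto simp: interior_open connected_Ioi\<close>)
    thus ?thesis by simp
  qed
qed (use assms in auto)

text \<open>Passing to moduli loses in the right direction by Cauchy-Schwarz in the plane, which
  leaves the real tangent inequality. The vector p |y|^(p-2) y is the gradient; the inequality
  serves as Jensen's inequality for cell averages and as one half of the second-order estimate
  below.\<close>

lemma cmod_powr_tangent:
  fixes x y :: complex and p :: real
  assumes p: "2 \<le> p"
  shows "cmod y powr p + p * cmod y powr (p - 2) * Re (cnj y * (x - y)) \<le> cmod x powr p"
proof (cases "y = 0")
  case False
  have r: "Re (cnj y * (x - y)) \<le> cmod y * (cmod x - cmod y)"
  proof -
    have "Re (cnj y * x) \<le> cmod y * cmod x"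
      using complex_Re_le_cmod[of "cnj y * x"] by (simp only: norm_mult complex_mod_cnj)
    moreover have "Re (cnj y * y) = cmod y * cmod y"
      unfolding power2_eq_square[symmetric] cmod_power2 by (simp add: power2_eq_square)
    moreover have "Re (cnj y * (x - y)) = Re (cnj y * x) - Re (cnj y * y)"
      by (simp only: right_diff_distrib minus_complex.sel)
    ultimately show ?thesis by (simp only: right_diff_distrib)
  qed
  have "p - 2 + 1 = p - 1" by simp
  hence e: "cmod y powr (p - 1) = cmod y powr (p - 2) * cmod y"
    using False powr_add[of "cmod y" "p - 2" 1] by (simp only: powr_one norm_ge_zero)
  have "cmod y powr p + p * (cmod y powr (p - 2) * cmod y) * (cmod x - cmod y) \<le> cmod x powr p"
    unfolding e[symmetric] by (rule powr_tangent) (use p in auto)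
  moreover have "p * cmod y powr (p - 2) * Re (cnj y * (x - y))
      \<le> p * cmod y powr (p - 2) * (cmod y * (cmod x - cmod y))"
    using p by (intro mult_left_mono r) auto
  moreover have "p * cmod y powr (p - 2) * (cmod y * (cmod x - cmod y))
    = p * (cmod y powr (p - 2) * cmod y) * (cmod x - cmod y)" by (simp only: mult.assoc)
  ultimately show ?thesis by linarith
qed (use p in auto)

lemma powr_superadd:
  fixes a b r :: real
  assumes "0 \<le> a" "0 \<le> b" "1 \<le> r"
  shows "a powr r + b powr r \<le> (a + b) powr r"
proof (cases "a + b = 0")
  case False
  have e: "x powr r = x * x powr (r - 1)" if "0 \<le> x" for x :: real
    using that powr_add[of x 1 "r - 1"] by (cases "x = 0") auto
  have "a * a powr (r - 1) + b * b powr (r - 1) \<le> a * (a + b) powr (r - 1) + b * (a + b) powr (r - 1)"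
    using assms by (intro add_mono mult_left_mono powr_mono2) auto
  also have "\<dots> = (a + b) powr r" using assms e[of "a+b"] by (simp add: distrib_right)
  finally show ?thesis using e[OF assms(1)] e[OF assms(2)] by linarith
next
  case True
  hence "a = 0" "b = 0" using assms by auto
  thus ?thesis by simp
qed

text \<open>Add the tangent at the midpoint evaluated at both ends: the linear parts cancel.\<close>

lemma powr_midpoint:
  fixes a b r :: real
  assumes "0 \<le> a" "0 \<le> b" "1 \<le> r"
  shows "((a + b) / 2) powr r \<le> (a powr r + b powr r) / 2"
proof -
  let ?m = "(a + b) / 2"
  have "?m powr r + r * ?m powr (r - 1) * (a - ?m) \<le> a powr r"
       "?m powr r + r * ?m powr (r - 1) * (b - ?m) \<le> b powr r"
    using assms by (auto intro!: powr_tangent)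
  hence "2 * ?m powr r + (r * ?m powr (r - 1) * (a - ?m) + r * ?m powr (r - 1) * (b - ?m)) \<le> a powr r + b powr r"
    by linarith
  moreover have "r * ?m powr (r - 1) * (a - ?m) + r * ?m powr (r - 1) * (b - ?m)
      = r * ?m powr (r - 1) * ((a - ?m) + (b - ?m))" by (simp only: distrib_left)
  moreover have "(a - ?m) + (b - ?m) = 0" by (simp add: field_simps)
  ultimately show ?thesis by simp
qed

lemma powr_midpoint_cmod:
  assumes "1 \<le> r"
  shows "cmod x powr r \<le> (cmod (x + d) powr r + cmod (x - d) powr r) / 2"
proof -
  have "2 * cmod x = cmod ((x + d) + (x - d))" by (simp flip: mult_2 add: norm_mult)
  also have "\<dots> \<le> cmod (x + d) + cmod (x - d)" by (rule norm_triangle_ineq)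
  finally have "cmod x powr r \<le> ((cmod (x + d) + cmod (x - d)) / 2) powr r"
    using assms by (intro powr_mono2) auto
  also have "\<dots> \<le> (cmod (x + d) powr r + cmod (x - d) powr r) / 2"
    using assms by (intro powr_midpoint) auto
  finally show ?thesis .
qed

lemma parallelogram_cmod: "(cmod (x + d))^2 + (cmod (x - d))^2 = 2 * ((cmod x)^2 + (cmod d)^2)"
  unfolding cmod_power2 by (simp add: power2_eq_square algebra_simps)

lemma sq_powr_half: "0 \<le> a \<Longrightarrow> (a^2) powr (p / 2) = a powr p" for a p :: real
  using powr_powr[of a 2 "p/2"] by (simp add: powr_numeral)

text \<open>The parallelogram law, with t^(p/2) superadditive on one side of it and midpoint convex
  on the other; both use p/2 >= 1.\<close>

lemma clarkson_cmod:
  fixes x d :: complex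
  assumes "2 \<le> p"
  shows "cmod x powr p + cmod d powr p \<le> (cmod (x + d) powr p + cmod (x - d) powr p) / 2"
proof -
  have "cmod x powr p + cmod d powr p = ((cmod x)^2) powr (p/2) + ((cmod d)^2) powr (p/2)"
    by (simp add: sq_powr_half)
  also have "\<dots> \<le> ((cmod x)^2 + (cmod d)^2) powr (p/2)"
    using assms by (intro powr_superadd) auto
  also have "\<dots> = (((cmod (x+d))^2 + (cmod (x-d))^2) / 2) powr (p/2)"
    unfolding parallelogram_cmod by (subst nonzero_mult_div_cancel_left) auto
  also have "\<dots> \<le> (((cmod (x+d))^2) powr (p/2) + ((cmod (x-d))^2) powr (p/2)) / 2"
    using assms by (intro powr_midpoint) auto
  finally show ?thesis by (simp add: sq_powr_half)
qed

text \<open>Lipschitz estimate for the gradient map of |z|^p. Moving the point under a fixed weight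
  costs the constant 1, moving the weight costs p - 1 by the tangent of t^(p-1); together p.\<close>

lemma cmod_powr_lipschitz:
  fixes a b :: complex
  assumes p: "2 \<le> p" and ab: "cmod b \<le> cmod a"
  shows "cmod (of_real (cmod a powr (p - 2)) * a - of_real (cmod b powr (p - 2)) * b)
           \<le> p * cmod a powr (p - 2) * cmod (a - b)"
proof -
  let ?A = "cmod a powr (p - 2)" and ?B = "cmod b powr (p - 2)"
  have e: "cmod z powr (p - 2) * cmod z = cmod z powr (p - 1)" for z
    using powr_add[of "cmod z" "p - 2" 1] by (cases "z = 0") auto
  have AB: "?B \<le> ?A" using p ab by (intro powr_mono2) auto
  have "cmod (of_real ?A * a - of_real ?B * b) = cmod (of_real ?A * (a - b) + of_real (?A - ?B) * b)"
    by (simp add: algebra_simps)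
  also have "\<dots> \<le> ?A * cmod (a - b) + (?A - ?B) * cmod b"
    using AB by (intro order_trans[OF norm_triangle_ineq]) (simp add: norm_mult flip: of_real_diff)
  also have "(?A - ?B) * cmod b \<le> (p - 1) * ?A * (cmod a - cmod b)"
  proof -
    have "cmod a powr (p - 1) + (p - 1) * cmod a powr (p - 1 - 1) * (cmod b - cmod a) \<le> cmod b powr (p - 1)"
      using p by (intro powr_tangent) auto
    moreover have "?A * cmod b \<le> cmod a powr (p - 1)" 
      using ab e[of a] by (metis mult_left_mono powr_ge_zero)
    ultimately show ?thesis using e[of b] by (simp add: algebra_simps)
  qed
  also have "\<dots> \<le> (p - 1) * ?A * cmod (a - b)"
    using p by (intro mult_left_mono norm_triangle_ineq2) auto
  finally show ?thesis by (simp add: algebra_simps)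
qed

text \<open>Replaces a second-order Taylor expansion: the tangents at x + d and x - d, evaluated at
  x, leave the difference of the two gradients paired with d, and the Lipschitz estimate supplies
  the second factor |d|.\<close>

lemma cmod_powr_two_point_upper:
  fixes x d :: complex
  assumes p: "2 \<le> p"
  shows "(cmod (x + d) powr p + cmod (x - d) powr p) / 2
           \<le> cmod x powr p + p^2 * (cmod x + cmod d) powr (p - 2) * (cmod d)^2"
proof -
  define y z where "y = x + d" and "z = x - d"
  let ?Y = "of_real (cmod y powr (p - 2)) * y" and ?Z = "of_real (cmod z powr (p - 2)) * z"
  have "cmod (?Y - ?Z) \<le> p * (cmod x + cmod d) powr (p - 2) * cmod (y - z)"
  proof (cases "cmod z \<le> cmod y")
    case True
    have "cmod (?Y - ?Z) \<le> p * cmod y powr (p - 2) * cmod (y - z)"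
      by (rule cmod_powr_lipschitz[OF p True])
    also have "\<dots> \<le> p * (cmod x + cmod d) powr (p - 2) * cmod (y - z)"
      using p by (intro mult_right_mono mult_left_mono powr_mono2) (auto simp: y_def norm_triangle_ineq)
    finally show ?thesis .
  next
    case False
    have "cmod (?Z - ?Y) \<le> p * cmod z powr (p - 2) * cmod (z - y)"
      by (rule cmod_powr_lipschitz[OF p]) (use False in auto)
    also have "\<dots> \<le> p * (cmod x + cmod d) powr (p - 2) * cmod (z - y)"
      using p by (intro mult_right_mono mult_left_mono powr_mono2) (auto simp: z_def norm_triangle_ineq4)
    finally show ?thesis by (simp add: norm_minus_commute)
  qed
  also have "cmod (y - z) = 2 * cmod d"
    by (simp add: y_def z_def norm_mult flip: mult_2)
  finally have L: "cmod (?Y - ?Z) \<le> 2 * p * (cmod x + cmod d) powr (p - 2) * cmod d" by simp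
  have "cmod y powr p + p * cmod y powr (p - 2) * Re (cnj y * (x - y)) \<le> cmod x powr p"
       "cmod z powr p + p * cmod z powr (p - 2) * Re (cnj z * (x - z)) \<le> cmod x powr p"
    by (rule cmod_powr_tangent[OF p])+
  moreover have "x - y = - d" "x - z = d" by (auto simp: y_def z_def)
  ultimately have "cmod y powr p + cmod z powr p
      \<le> 2 * cmod x powr p + p * Re (cnj (?Y - ?Z) * d)"
    by (simp add: algebra_simps)
  also have "Re (cnj (?Y - ?Z) * d) \<le> cmod (?Y - ?Z) * cmod d"
    using complex_Re_le_cmod[of "cnj (?Y - ?Z) * d"] by (simp only: norm_mult complex_mod_cnj)
  also have "\<dots> \<le> (2 * p * (cmod x + cmod d) powr (p - 2) * cmod d) * cmod d"
    using L by (intro mult_right_mono) auto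
  finally show ?thesis using p by (simp add: y_def z_def power2_eq_square algebra_simps)
qed

lemma powr_add_le:
  fixes a b q :: real
  assumes "0 \<le> a" "0 \<le> b" "0 \<le> q"
  shows "(a + b) powr q \<le> 2 powr q * (a powr q + b powr q)"
proof -
  have "(a + b) powr q \<le> (2 * max a b) powr q" using assms by (intro powr_mono2) auto
  also have "\<dots> = 2 powr q * max a b powr q" using assms by (simp add: powr_mult)
  also have "\<dots> \<le> 2 powr q * (a powr q + b powr q)"
    by (intro mult_left_mono) (auto simp: max_def)
  finally show ?thesis .
qed

lemma powr_mult_sq:
  fixes a p :: real
  assumes "0 \<le> a"
  shows "a powr (p - 2) * a^2 = a powr p"
  using assms powr_add[of a "p - 2" 2] by (cases "a = 0") (auto simp: powr_numeral)

lemma powr_sq_le: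
  fixes a b p :: real
  assumes "0 \<le> a" "0 \<le> b" "2 \<le> p"
  shows "a powr (p - 2) * b^2 \<le> a powr p + b powr p"
proof (cases "a \<le> b")
  case True
  have "a powr (p - 2) * b^2 \<le> b powr (p - 2) * b^2"
    using assms True by (intro mult_right_mono powr_mono2) auto
  thus ?thesis using assms powr_mult_sq[of b p] by (simp add: add_increasing)
next
  case False
  have "a powr (p - 2) * b^2 \<le> a powr (p - 2) * a^2"
    using assms False by (intro mult_left_mono power_mono) auto
  thus ?thesis using assms powr_mult_sq[of a p] by (simp add: add_increasing2)
qed

section \<open>The dyadic tree\<close>

lemma powr_pred: "0 \<le> a \<Longrightarrow> a powr (p - 1) * a = a powr p" for a p :: real
  using powr_add[of a "p - 1" 1] by (cases "a = 0") auto

text \<open>Either b^2 is at most e a^2, or a is at most b / sqrt e and the power of a can be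
  exchanged for one of b.\<close>

lemma young_sq:
  fixes p e :: real
  assumes "2 \<le> p" "0 < e"
  shows "\<exists>C\<ge>0. \<forall>a\<ge>0. \<forall>b\<ge>0. a powr (p - 2) * b^2 \<le> e * a powr p + C * b powr p"
proof (intro exI[of _ "(1 / sqrt e) powr (p - 2)"] conjI allI impI)
  fix a b :: real assume ab: "0 \<le> a" "0 \<le> b"
  show "a powr (p - 2) * b^2 \<le> e * a powr p + (1 / sqrt e) powr (p - 2) * b powr p"
  proof (cases "b^2 \<le> e * a^2")
    case True
    have "a powr (p - 2) * b^2 \<le> a powr (p - 2) * (e * a^2)"
      using True by (intro mult_left_mono) auto
    also have "\<dots> = e * a powr p" using powr_mult_sq[of a p] ab by (simp add: mult.left_commute)
    finally show ?thesis by (simp add: add_increasing2)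
  next
    case False
    hence "(sqrt e * a)^2 \<le> b^2" using assms by (simp add: power_mult_distrib)
    hence "sqrt e * a \<le> b" by (rule power2_le_imp_le) (use ab in auto)
    hence "a \<le> 1 / sqrt e * b" using assms by (simp add: field_simps)
    hence "a powr (p - 2) \<le> (1 / sqrt e * b) powr (p - 2)" using assms ab by (intro powr_mono2) auto
    also have "\<dots> = (1 / sqrt e) powr (p - 2) * b powr (p - 2)" by (rule powr_mult)
    finally have "a powr (p - 2) * b^2 \<le> ((1 / sqrt e) powr (p - 2) * b powr (p - 2)) * b^2"
      by (rule mult_right_mono) auto
    also have "\<dots> = (1 / sqrt e) powr (p - 2) * b powr p"
      using powr_mult_sq[of b p] ab by (simp only: mult.assoc)
    finally show ?thesis using assms by (simp add: add_increasing)
  qed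
qed simp

lemma young_lin:
  fixes p e :: real
  assumes "2 \<le> p" "0 < e"
  shows "\<exists>C\<ge>0. \<forall>a\<ge>0. \<forall>b\<ge>0. a powr (p - 1) * b \<le> e * a powr p + C * b powr p"
proof (intro exI[of _ "(1 / e) powr (p - 1)"] conjI allI impI)
  fix a b :: real assume ab: "0 \<le> a" "0 \<le> b"
  show "a powr (p - 1) * b \<le> e * a powr p + (1 / e) powr (p - 1) * b powr p"
  proof (cases "b \<le> e * a")
    case True
    have "a powr (p - 1) * b \<le> a powr (p - 1) * (e * a)"
      using True by (intro mult_left_mono) auto
    also have "\<dots> = e * a powr p" using powr_pred[of a p] ab by (simp add: mult.left_commute)
    finally show ?thesis by (simp add: add_increasing2)
  next
    case False
    hence "a \<le> 1 / e * b" using assms by (simp add: field_simps)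
    hence "a powr (p - 1) \<le> (1 / e * b) powr (p - 1)" using assms ab by (intro powr_mono2) auto
    also have "\<dots> = (1 / e) powr (p - 1) * b powr (p - 1)" by (rule powr_mult)
    finally have "a powr (p - 1) * b \<le> ((1 / e) powr (p - 1) * b powr (p - 1)) * b"
      by (rule mult_right_mono) (use ab in auto)
    also have "\<dots> = (1 / e) powr (p - 1) * b powr p"
      using powr_pred[of b p] ab by (simp only: mult.assoc)
    finally show ?thesis using assms by (simp add: add_increasing)
  qed
qed simp

text \<open>A coefficient close to 1 in front of |x|^p is what makes one step of the Hardy
  inequality below a strict contraction. The number \<open>d\<close> solves (1 + d)^p = 1 + e, and
  |x| is dominated by |y| unless |y| <= d |x|.\<close>

lemma cmod_add_powr_le:
  fixes p e :: real
  assumes "2 \<le> p" "0 < e"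
  shows "\<exists>C\<ge>0. \<forall>x y. cmod (x + y) powr p \<le> (1 + e) * cmod x powr p + C * cmod y powr p"
proof -
  define d where "d = (1 + e) powr (1 / p) - 1"
  have d: "d > 0" using assms by (simp add: d_def)
  have dp: "(1 + d) powr p = 1 + e" using assms by (simp add: d_def powr_powr)
  show ?thesis
  proof (intro exI[of _ "(1 + 1 / d) powr p"] conjI allI)
    fix x y :: complex
    show "cmod (x + y) powr p \<le> (1 + e) * cmod x powr p + (1 + 1 / d) powr p * cmod y powr p"
    proof (cases "cmod y \<le> d * cmod x")
      case True
      hence "cmod (x + y) \<le> (1 + d) * cmod x" using norm_triangle_ineq[of x y] by (simp add: algebra_simps)
      hence "cmod (x + y) powr p \<le> ((1 + d) * cmod x) powr p" using assms by (intro powr_mono2) auto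
      also have "\<dots> = (1 + e) * cmod x powr p" using d by (subst powr_mult) (auto simp: dp)
      finally show ?thesis by (simp add: add_increasing2)
    next
      case False
      hence "cmod x \<le> 1 / d * cmod y" using d by (simp add: field_simps)
      hence "cmod (x + y) \<le> (1 + 1 / d) * cmod y" using norm_triangle_ineq[of x y] by (simp add: algebra_simps)
      hence "cmod (x + y) powr p \<le> ((1 + 1 / d) * cmod y) powr p" using assms by (intro powr_mono2) auto
      also have "\<dots> = (1 + 1 / d) powr p * cmod y powr p" using d by (subst powr_mult) auto
      finally show ?thesis using assms by (simp add: add_increasing)
    qed
  qed simp
qed

text \<open>The martingale with Haar coefficients \<xi>, evaluated on the cell of node n: the even
  child is the left half, where the Haar function is 1, the odd child the right half. The root 1
  carries the mean, here 0.\<close>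

fun val :: "(nat \<Rightarrow> complex) \<Rightarrow> nat \<Rightarrow> complex" where
  "val \<xi> n = (if n \<le> 1 then 0
     else val \<xi> (n div 2) + (if even n then \<xi> (n div 2) else - \<xi> (n div 2)))"

declare val.simps [simp del]

lemma val_1 [simp]: "val \<xi> (Suc 0) = 0" by (simp add: val.simps)

lemma val_double [simp]: "1 \<le> n \<Longrightarrow> val \<xi> (2 * n) = val \<xi> n + \<xi> n"
  by (subst val.simps) auto

lemma val_double_1 [simp]: "1 \<le> n \<Longrightarrow> val \<xi> (Suc (2 * n)) = val \<xi> n - \<xi> n"
  by (subst val.simps) auto

lemma val_cong:
  assumes "\<And>i. 1 \<le> i \<Longrightarrow> 2 * i \<le> n \<Longrightarrow> \<xi> i = \<zeta> i"
  shows "val \<xi> n = val \<zeta> n"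
  using assms
proof (induction n rule: less_induct)
  case (less n)
  show ?case
  proof (cases "n \<le> 1")
    case True thus ?thesis by (simp add: val.simps)
  next
    case False
    have "val \<xi> (n div 2) = val \<zeta> (n div 2)"
      by (rule less.IH) (use False in \<open>auto intro!: less.prems\<close>)
    moreover have "\<xi> (n div 2) = \<zeta> (n div 2)"
      using False by (intro less.prems) auto
    ultimately show ?thesis by (simp add: val.simps[of _ n])
  qed
qed

lemma sum_double:
  fixes F :: "nat \<Rightarrow> real"
  assumes "a \<le> b"
  shows "(\<Sum>n=2*a..<2*b. F n) = (\<Sum>n=a..<b. F (2 * n) + F (Suc (2 * n)))"
  using assms
proof (induction b rule: dec_induct)
  case (step b)
  have "(\<Sum>n=2*a..<2 * Suc b. F n) = (\<Sum>n=2*a..<2*b. F n) + F (2 * b) + F (Suc (2 * b))"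
    using step by (simp add: sum.atLeastLessThan_Suc)
  thus ?case using step by (simp add: sum.atLeastLessThan_Suc)
qed simp

section \<open>Expectations over levels and telescoping\<close>

definition avg :: "nat \<Rightarrow> (nat \<Rightarrow> real) \<Rightarrow> real" where
  "avg K F = (\<Sum>n=2^K..<2^Suc K. F n) / 2^K"

text \<open>Each node below level K is weighted by the length of its cell: the expectation of a sum
  along the random path.\<close>

definition tsum :: "nat \<Rightarrow> (nat \<Rightarrow> real) \<Rightarrow> real" where
  "tsum K F = (\<Sum>k<K. avg k F)"

lemma avg_0 [simp]: "avg 0 F = F (Suc 0)"
proof -
  have "{Suc 0..<2} = {Suc 0}" by auto
  thus ?thesis by (simp add: avg_def)
qed

lemma avg_Suc: "avg (Suc K) F = avg K (\<lambda>n. (F (2 * n) + F (Suc (2 * n))) / 2)"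
  using sum_double[of "2^K" "2^Suc K" F]
  by (simp add: avg_def sum_divide_distrib field_simps)

lemma avg_mono: "(\<And>n. 2^K \<le> n \<Longrightarrow> n < 2^Suc K \<Longrightarrow> F n \<le> G n) \<Longrightarrow> avg K F \<le> avg K G"
  unfolding avg_def by (intro divide_right_mono sum_mono) auto

lemma avg_cong: "(\<And>n. 2^K \<le> n \<Longrightarrow> n < 2^Suc K \<Longrightarrow> F n = G n) \<Longrightarrow> avg K F = avg K G"
  unfolding avg_def by (intro arg_cong2[of _ _ _ _ "(/)"] sum.cong) auto

lemma avg_add: "avg K (\<lambda>n. F n + G n) = avg K F + avg K G"
  by (simp add: avg_def sum.distrib add_divide_distrib)

lemma avg_diff: "avg K (\<lambda>n. F n - G n) = avg K F - avg K G"
  by (simp add: avg_def sum_subtractf diff_divide_distrib)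

lemma avg_cmult: "avg K (\<lambda>n. c * F n) = c * avg K F"
  by (simp add: avg_def sum_distrib_left)

lemma avg_nonneg: "(\<And>n. 0 \<le> F n) \<Longrightarrow> 0 \<le> avg K F"
  by (simp add: avg_def sum_nonneg)

lemma tsum_Suc: "tsum (Suc K) F = tsum K F + avg K F"
  by (simp add: tsum_def)

lemma tsum_0 [simp]: "tsum 0 F = 0"
  by (simp add: tsum_def)

lemma tsum_add: "tsum K (\<lambda>n. F n + G n) = tsum K F + tsum K G"
  by (simp add: tsum_def avg_add sum.distrib)

lemma tsum_diff: "tsum K (\<lambda>n. F n - G n) = tsum K F - tsum K G"
  by (simp add: tsum_def avg_diff sum_subtractf)

lemma tsum_cmult: "tsum K (\<lambda>n. c * F n) = c * tsum K F"
  by (simp add: tsum_def avg_cmult sum_distrib_left)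

lemma tsum_mono:
  assumes "\<And>n. 1 \<le> n \<Longrightarrow> n < 2^K \<Longrightarrow> F n \<le> G n"
  shows "tsum K F \<le> tsum K G"
  unfolding tsum_def
proof (intro sum_mono avg_mono assms)
  fix k n assume "k \<in> {..<K}" "2^k \<le> n" "n < (2::nat)^Suc k"
  moreover from this have "(2::nat)^Suc k \<le> 2^K" by (intro power_increasing) auto
  moreover have "(1::nat) \<le> 2^k" by simp
  ultimately show "1 \<le> n" "n < 2^K" by linarith+
qed

text \<open>Telescoping over the levels. Every martingale estimate below is reduced by it, or by its
  reverse, to an inequality between a node and its two children.\<close>

lemma avg_ge_tsum:
  assumes "\<And>n. 1 \<le> n \<Longrightarrow> n < 2^K \<Longrightarrow> F n + H n \<le> (F (2 * n) + F (Suc (2 * n))) / 2"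
  shows "F (Suc 0) + tsum K H \<le> avg K F"
  using assms
proof (induction K)
  case (Suc K)
  have "F (Suc 0) + tsum K H \<le> avg K F"
    by (intro Suc.IH Suc.prems) auto
  moreover have "avg K F + avg K H \<le> avg (Suc K) F"
    unfolding avg_Suc avg_add[symmetric]
  proof (intro avg_mono Suc.prems)
    fix n :: nat assume "2^K \<le> n"
    moreover have "(1::nat) \<le> 2^K" by simp
    ultimately show "1 \<le> n" by linarith
  qed auto
  ultimately show ?case by (simp add: tsum_Suc)
qed simp

lemma avg_le_tsum:
  assumes "\<And>n. 1 \<le> n \<Longrightarrow> n < 2^K \<Longrightarrow> (F (2 * n) + F (Suc (2 * n))) / 2 \<le> F n + H n"
  shows "avg K F \<le> F (Suc 0) + tsum K H"
proof -
  have neg: "avg K (\<lambda>n. - F n) = - avg K F" "tsum K (\<lambda>n. - H n) = - tsum K H"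
    using avg_cmult[of K "-1" F] tsum_cmult[of K "-1" H] by auto
  have "- F (Suc 0) + tsum K (\<lambda>n. - H n) \<le> avg K (\<lambda>n. - F n)"
    by (rule avg_ge_tsum) (use assms in \<open>force simp: field_simps\<close>)
  thus ?thesis by (simp add: neg)
qed

section \<open>Summation along chains\<close>

definition chain_sum :: "nat \<Rightarrow> (nat \<Rightarrow> real) \<Rightarrow> nat \<Rightarrow> real" where
  "chain_sum K F n = (\<Sum>k<K. F (n * 2^k) / 2^k)"

text \<open>The cell of 2n is half the cell of n, hence the factor 1/2. As F vanishes from level K
  on, appending one more term to the truncated sum changes nothing, and the sum can be
  shifted.\<close>

lemma chain_sum_step:
  assumes "\<And>n. 2^K \<le> n \<Longrightarrow> F n = 0" "1 \<le> n"
  shows "chain_sum K F n = F n + chain_sum K F (2 * n) / 2"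
proof -
  have "n * 2^K \<ge> 2^K" using assms(2) by simp
  hence "F (n * 2^K) = 0" by (rule assms)
  hence "chain_sum K F n = (\<Sum>k<Suc K. F (n * 2^k) / 2^k)" by (simp add: chain_sum_def)
  also have "\<dots> = F n + (\<Sum>k<K. F (n * 2^Suc k) / 2^Suc k)"
    by (subst sum.lessThan_Suc_shift) simp
  also have "(\<Sum>k<K. F (n * 2^Suc k) / 2^Suc k) = chain_sum K F (2 * n) / 2"
    by (simp add: chain_sum_def sum_divide_distrib mult_ac)
  finally show ?thesis .
qed

lemma chain_sum_nonneg: "(\<And>n. 0 \<le> F n) \<Longrightarrow> 0 \<le> chain_sum K F n"
  by (simp add: chain_sum_def sum_nonneg)

lemma chain_sum_zero:
  assumes "\<And>n. 2^K \<le> n \<Longrightarrow> F n = 0" "2^K \<le> n"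
  shows "chain_sum K F n = 0"
  unfolding chain_sum_def
proof (intro sum.neutral ballI)
  fix k
  have "n * 1 \<le> n * 2^k" by (intro mult_le_mono) auto
  hence "F (n * 2^k) = 0" using assms by (intro assms(1)) linarith
  thus "F (n * 2^k) / 2^k = 0" by simp
qed

text \<open>The odd indices are the roots of the chains \<open>m, 2m, 4m, \<dots>\<close> and a weight \<open>u\<close> with
  \<open>u (2 * n) = u n\<close> is constant along each of them.\<close>

lemma tsum_chains:
  assumes F: "\<And>n. 2^K \<le> n \<Longrightarrow> F n = 0" and u: "\<And>n. 1 \<le> n \<Longrightarrow> u (2 * n) = u n"
  shows "tsum K (\<lambda>n. u n * F n) = u (Suc 0) * chain_sum K F (Suc 0)
    + tsum K (\<lambda>n. u (Suc (2 * n)) * chain_sum K F (Suc (2 * n))) / 2"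
proof -
  define R where "R = chain_sum K F"
  \<comment> \<open>The gain of \<open>u n * R n\<close> on passing from a node to the mean of its
    children: the even child continues the chain with F n removed, the odd child opens a new
    chain.\<close>
  define H where "H = (\<lambda>n. u (Suc (2 * n)) * R (Suc (2 * n)) / 2 - u n * F n)"
  have R: "u n * R (2 * n) = 2 * (u n * R n) - 2 * (u n * F n)" if "1 \<le> n" for n
    using chain_sum_step[OF F that] by (simp add: R_def algebra_simps)
  have step: "(u (2 * n) * R (2 * n) + u (Suc (2 * n)) * R (Suc (2 * n))) / 2
      = u n * R n + H n" if "1 \<le> n" for n
    using R[OF that] u[OF that] by (simp add: H_def field_simps)
  have "u (Suc 0) * R (Suc 0) + tsum K H \<le> avg K (\<lambda>n. u n * R n)"
    by (rule avg_ge_tsum) (use step in auto)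
  moreover have "avg K (\<lambda>n. u n * R n) \<le> u (Suc 0) * R (Suc 0) + tsum K H"
    by (rule avg_le_tsum) (use step in auto)
  \<comment> \<open>Level K lies beyond the support of F, so the telescoped identity ends at
    0.\<close>
  moreover have "avg K (\<lambda>n. u n * R n) = avg K (\<lambda>n. 0)"
    by (rule avg_cong) (auto simp: R_def chain_sum_zero[OF F])
  hence "avg K (\<lambda>n. u n * R n) = 0" by (simp add: avg_def)
  moreover have "tsum K H = tsum K (\<lambda>n. u (Suc (2 * n)) * R (Suc (2 * n))) / 2 - tsum K (\<lambda>n. u n * F n)"
    using tsum_cmult[of K "1/2" "\<lambda>n. u (Suc (2 * n)) * R (Suc (2 * n))"]
    by (simp add: H_def tsum_diff)
  ultimately show ?thesis unfolding R_def by linarith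
qed

lemma tsum_chains_mono:
  assumes F: "\<And>n. 2^K \<le> n \<Longrightarrow> F n = 0" and G: "\<And>n. 2^K \<le> n \<Longrightarrow> G n = 0"
    and u: "\<And>n. 1 \<le> n \<Longrightarrow> u (2 * n) = u n" "\<And>n. 0 \<le> u n"
    and le: "\<And>m. odd m \<Longrightarrow> chain_sum K F m \<le> A * chain_sum K G m"
  shows "tsum K (\<lambda>n. u n * F n) \<le> A * tsum K (\<lambda>n. u n * G n)"
proof -
  have "tsum K (\<lambda>n. u (Suc (2 * n)) * chain_sum K F (Suc (2 * n)))
     \<le> tsum K (\<lambda>n. A * (u (Suc (2 * n)) * chain_sum K G (Suc (2 * n))))"
    by (intro tsum_mono, subst mult.left_commute[of A], intro mult_left_mono le u) simp
  moreover have "u (Suc 0) * chain_sum K F (Suc 0) \<le> u (Suc 0) * (A * chain_sum K G (Suc 0))"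
    by (intro mult_left_mono le u) simp
  ultimately show ?thesis
    using tsum_chains[where F=F and u=u, OF F u(1)] tsum_chains[where F=G and u=u, OF G u(1)]
    by (simp add: tsum_cmult algebra_simps)
qed

section \<open>Conditional square functions\<close>

text \<open>Clarkson's inequality at every node, telescoped.\<close>

lemma tsum_powr_le_avg_val:
  assumes "2 \<le> p"
  shows "tsum K (\<lambda>n. cmod (\<xi> n) powr p) \<le> avg K (\<lambda>n. cmod (val \<xi> n) powr p)"
proof -
  have "cmod (val \<xi> (Suc 0)) powr p + tsum K (\<lambda>n. cmod (\<xi> n) powr p) \<le> avg K (\<lambda>n. cmod (val \<xi> n) powr p)"
    by (rule avg_ge_tsum) (use clarkson_cmod[OF assms] in simp)
  thus ?thesis by simp
qed

lemma avg_val_le_tsum: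
  assumes "2 \<le> p"
  shows "avg K (\<lambda>n. cmod (val \<eta> n) powr p)
    \<le> tsum K (\<lambda>n. p^2 * (cmod (val \<eta> n) + cmod (\<eta> n)) powr (p - 2) * (cmod (\<eta> n))^2)"
proof -
  have "avg K (\<lambda>n. cmod (val \<eta> n) powr p) \<le> cmod (val \<eta> (Suc 0)) powr p
    + tsum K (\<lambda>n. p^2 * (cmod (val \<eta> n) + cmod (\<eta> n)) powr (p - 2) * (cmod (\<eta> n))^2)"
    by (rule avg_le_tsum) (use cmod_powr_two_point_upper[OF assms] in simp)
  thus ?thesis by simp
qed

text \<open>Freezes F at the odd start of the chain through n. Since 0 is its own half, the
  recursion has to stop there as well.\<close>

fun at_root :: "(nat \<Rightarrow> 'a) \<Rightarrow> nat \<Rightarrow> 'a" where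
  "at_root F n = (if n = 0 \<or> odd n then F n else at_root F (n div 2))"

declare at_root.simps [simp del]

lemma at_root_double [simp]: "at_root F (2 * n) = at_root F n"
  by (subst at_root.simps) (auto simp: at_root.simps[of F 0])

lemma at_root_odd [simp]: "odd n \<Longrightarrow> at_root F n = F n"
  by (simp add: at_root.simps)

text \<open>A Hardy inequality for sums along chains: \<beta> is 0 at the odd child, so one level
  halves the mass, while adding \<eta> costs only the factor 3/2. The resulting ratio 3/4 is below
  1.\<close>

lemma tsum_hardy:
  assumes "2 \<le> p"
  shows "\<exists>C\<ge>0. \<forall>K (\<beta> :: nat \<Rightarrow> complex) \<eta>. (\<forall>n. odd n \<longrightarrow> \<beta> n = 0)
    \<longrightarrow> (\<forall>n\<ge>1. \<beta> (2 * n) = \<beta> n + \<eta> n)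
    \<longrightarrow> tsum K (\<lambda>n. cmod (\<beta> n) powr p) \<le> C * tsum K (\<lambda>n. cmod (\<eta> n) powr p)"
proof -
  obtain C where C: "C \<ge> 0" and add: "\<And>x y. cmod (x + y) powr p \<le> (1 + 1/2) * cmod x powr p + C * cmod y powr p"
    using cmod_add_powr_le[OF assms, of "1/2"] by auto
  show ?thesis
  proof (intro exI[of _ "2 * C"] conjI allI impI)
    fix K and \<beta> \<eta> :: "nat \<Rightarrow> complex"
    assume odd: "\<forall>n. odd n \<longrightarrow> \<beta> n = 0" and even: "\<forall>n\<ge>1. \<beta> (2 * n) = \<beta> n + \<eta> n"
    define B E where "B = (\<lambda>n. cmod (\<beta> n) powr p)" and "E = (\<lambda>n. cmod (\<eta> n) powr p)"
    have step: "avg (Suc k) B \<le> 3/4 * avg k B + C/2 * avg k E" for k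
    proof -
      have "avg (Suc k) B \<le> avg k (\<lambda>n. 3/4 * B n + C/2 * E n)"
        unfolding avg_Suc
      proof (rule avg_mono)
        fix n :: nat assume "2^k \<le> n"
        moreover have "(1::nat) \<le> 2^k" by simp
        ultimately have "1 \<le> n" by linarith
        thus "(B (2 * n) + B (Suc (2 * n))) / 2 \<le> 3/4 * B n + C/2 * E n"
          using add[of "\<beta> n" "\<eta> n"] odd even by (simp add: B_def E_def field_simps)
      qed
      thus ?thesis by (simp only: avg_add avg_cmult)
    qed
    \<comment> \<open>The term 4 \<open>avg K B\<close> carries the geometric series through the
      induction: 1 + 4 * (3/4) = 4... that is, \<open>avg K B\<close> plus three quarters of the new
      potential is the old potential.\<close>
    have "tsum K B + 4 * avg K B \<le> 2 * C * tsum K E"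
    proof (induction K)
      case 0
      have "B (Suc 0) = 0" using odd by (simp add: B_def)
      thus ?case by simp
    next
      case (Suc K)
      show ?case using Suc.IH step[of K] by (simp add: tsum_Suc algebra_simps)
    qed
    moreover have "0 \<le> avg K B" by (rule avg_nonneg) (simp add: B_def)
    ultimately show "tsum K (\<lambda>n. cmod (\<beta> n) powr p) \<le> 2 * C * tsum K (\<lambda>n. cmod (\<eta> n) powr p)"
      unfolding B_def E_def by linarith
  qed (use C in simp)
qed

text \<open>R is collected once for every chain that the path enters, at the moment of entry; later
  moves along the chain leave the sum unchanged, which makes it predictable for the martingale
  grouped by chains.\<close>

fun path_sum :: "(nat \<Rightarrow> real) \<Rightarrow> nat \<Rightarrow> real" where
  "path_sum R n = (if n \<le> 1 then R n else if even n then path_sum R (n div 2)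
     else path_sum R (n div 2) + R n)"

declare path_sum.simps [simp del]

lemma path_sum_1 [simp]: "path_sum R (Suc 0) = R (Suc 0)"
  by (simp add: path_sum.simps)

lemma path_sum_double [simp]: "1 \<le> n \<Longrightarrow> path_sum R (2 * n) = path_sum R n"
  by (subst path_sum.simps) auto

lemma path_sum_double_1 [simp]: "1 \<le> n \<Longrightarrow> path_sum R (Suc (2 * n)) = path_sum R n + R (Suc (2 * n))"
  by (subst path_sum.simps) auto

lemma path_sum_nonneg:
  assumes "\<And>n. 0 \<le> R n"
  shows "0 \<le> path_sum R n"
proof (induction n rule: less_induct)
  case (less n)
  show ?case using less[of "n div 2"] assms by (subst path_sum.simps) auto
qed

lemma diff_sq_div_le:
  fixes a b :: real
  assumes "0 \<le> a" "a \<le> b"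
  shows "(b^2 - a^2) / b \<le> 2 * (b - a)"
proof (cases "b = 0")
  case False
  hence "b > 0" using assms by simp
  have "b^2 - a^2 = (b - a) * (b + a)" by (simp add: power2_eq_square algebra_simps)
  also have "\<dots> \<le> (b - a) * (2 * b)" using assms by (intro mult_left_mono) auto
  finally show ?thesis using \<open>b > 0\<close> by (simp add: field_simps)
qed (use assms in auto)

text \<open>The power |G|^(p-2) of a martingale need not be a submartingale when p < 3, but
  |G|^(p-1) always is. The exponent is raised at the price of 1/s; where G <= s the second term
  takes over.\<close>

lemma powr_weight_split:
  fixes p G s :: real
  assumes "2 \<le> p" "0 \<le> G" "0 < s"
  shows "G powr (p - 2) \<le> G powr (p - 1) / s + s powr (p - 2)"
proof (cases "G \<le> s")
  case True
  hence "G powr (p - 2) \<le> s powr (p - 2)" using assms by (intro powr_mono2) auto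
  thus ?thesis using assms by (simp add: add_increasing)
next
  case False
  have "G powr (p - 2) * s \<le> G powr (p - 2) * G" using False by (intro mult_left_mono) auto
  also have "\<dots> = G powr (p - 1)" using powr_pred[of G "p - 1"] assms by simp
  finally have "G powr (p - 2) \<le> G powr (p - 1) / s" using assms by (simp add: field_simps)
  thus ?thesis by (simp add: add_increasing2)
qed

text \<open>For a first-order block the conditional variance given the past is \<open>chain_sum K (|\<xi>|\<^sup>2)\<close> at the
  root of the block, so \<open>path_sum\<close> of it is the square of the conditional square function.\<close>

locale finite_haar =
  fixes p :: real and K :: nat and \<xi> :: "nat \<Rightarrow> complex"
  assumes p: "2 \<le> p" and supp: "\<And>n. 2^K \<le> n \<Longrightarrow> \<xi> n = 0"
begin

definition R :: "nat \<Rightarrow> real" where "R = chain_sum K (\<lambda>n. (cmod (\<xi> n))^2)"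

definition s :: "nat \<Rightarrow> real" where "s n = sqrt (path_sum R n)"

lemma R_nonneg: "0 \<le> R n"
  unfolding R_def by (rule chain_sum_nonneg) simp

lemma R_step: "1 \<le> n \<Longrightarrow> R n = (cmod (\<xi> n))^2 + R (2 * n) / 2"
  unfolding R_def by (rule chain_sum_step) (auto simp: supp)

lemma s_nonneg: "0 \<le> s n" and s_sq: "(s n)^2 = path_sum R n"
  using path_sum_nonneg[of R n] R_nonneg by (auto simp: s_def)

lemma s_double: "1 \<le> n \<Longrightarrow> s (2 * n) = s n"
  by (simp add: s_def)

lemma s_double_1: "1 \<le> n \<Longrightarrow> (s (Suc (2 * n)))^2 = (s n)^2 + R (Suc (2 * n))"
  by (simp add: s_sq)

lemma s_le: "1 \<le> n \<Longrightarrow> s n \<le> s (Suc (2 * n))"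
  using R_nonneg by (simp add: s_def)

text \<open>Makes divisions by s harmless below. The sum \<open>path_sum R n\<close> contains R at
  the root of the chain of n, and by \<open>R_step\<close> this dominates a positive multiple of
  every squared coefficient further along the chain.\<close>

lemma s_zero_imp: "1 \<le> n \<Longrightarrow> s n = 0 \<Longrightarrow> \<xi> n = 0"
proof -
  have "1 \<le> n \<Longrightarrow> path_sum R n = 0 \<Longrightarrow> R n = 0" for n
  proof (induction n rule: less_induct)
    case (less n)
    let ?m = "n div 2"
    consider "n = 1" | "n \<ge> 2" "n = 2 * ?m" | "n \<ge> 2" "n = Suc (2 * ?m)" using less.prems by fastforce
    thus ?case
    proof cases
      case 1
      thus ?thesis using less by simp
    next
      case 2
      have "path_sum R ?m = 0" using less.prems 2 path_sum_double[of ?m R] by simp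
      hence "R ?m = 0" using 2 by (intro less.IH) auto
      moreover have "R ?m = (cmod (\<xi> ?m))^2 + R n / 2" using R_step[of ?m] 2 by simp
      ultimately show ?thesis using R_nonneg[of n] zero_le_power2[of "cmod (\<xi> ?m)"] by linarith
    next
      case 3
      have "path_sum R n = path_sum R ?m + R n" using 3 path_sum_double_1[of ?m R] by simp
      thus ?thesis using less.prems R_nonneg[of n] path_sum_nonneg[of R ?m, OF R_nonneg] by linarith
    qed
  qed
  moreover assume "1 \<le> n" "s n = 0"
  ultimately have "R n = 0" using s_sq[of n] by simp
  show "\<xi> n = 0"
  proof -
    have "(cmod (\<xi> n))^2 \<le> 0" using \<open>R n = 0\<close> R_step[OF \<open>1 \<le> n\<close>] R_nonneg[of "2 * n"] by linarith
    thus ?thesis by simp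
  qed
qed

text \<open>By the parallelogram law |val|^2 gains |\<xi>|^2 on average in each step; the weight is
  unchanged at even children and can only grow at odd ones.\<close>

lemma tsum_s_le_avg: "tsum K (\<lambda>n. s n powr (p - 2) * (cmod (\<xi> n))^2)
    \<le> avg K (\<lambda>n. s n powr (p - 2) * (cmod (val \<xi> n))^2)"
proof -
  let ?F = "\<lambda>n. s n powr (p - 2) * (cmod (val \<xi> n))^2"
  have "?F (Suc 0) + tsum K (\<lambda>n. s n powr (p - 2) * (cmod (\<xi> n))^2) \<le> avg K ?F"
  proof (rule avg_ge_tsum)
    fix n :: nat assume n: "1 \<le> n"
    have "s n powr (p - 2) * (cmod (val \<xi> n - \<xi> n))^2 \<le> s (Suc (2 * n)) powr (p - 2) * (cmod (val \<xi> n - \<xi> n))^2"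
      using p s_nonneg s_le[OF n] by (intro mult_right_mono powr_mono2) auto
    moreover have "s n powr (p - 2) * (cmod (val \<xi> n + \<xi> n))^2 + s n powr (p - 2) * (cmod (val \<xi> n - \<xi> n))^2
        = 2 * (?F n + s n powr (p - 2) * (cmod (\<xi> n))^2)"
      unfolding distrib_left[symmetric] parallelogram_cmod by simp
    ultimately show "?F n + s n powr (p - 2) * (cmod (\<xi> n))^2 \<le> (?F (2 * n) + ?F (Suc (2 * n))) / 2"
      using n by (simp add: s_double)
  qed
  thus ?thesis by simp
qed

text \<open>Only odd steps change s, and there s^2 grows by R, so the tangent of t^(p/2) at the new
  value bounds the growth of s^p. The weight s^(p-2) is constant on chains, which allows
  \<open>tsum_chains\<close> to spread each R back over its chain.\<close>

lemma avg_s_le_tsum: "avg K (\<lambda>n. s n powr p) \<le> p / 2 * tsum K (\<lambda>n. s n powr (p - 2) * (cmod (\<xi> n))^2)"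
proof -
  have inc: "b powr p \<le> a powr p + p / 2 * (b powr (p - 2) * (b^2 - a^2))" if "0 \<le> a" "0 \<le> b" for a b :: real
  proof -
    have "(b^2) powr (p / 2) + p / 2 * (b^2) powr (p / 2 - 1) * (a^2 - b^2) \<le> (a^2) powr (p / 2)"
      using p by (intro powr_tangent) auto
    moreover have "(b^2) powr (p / 2 - 1) = b powr (p - 2)"
      using sq_powr_half[of b "p - 2"] that by (simp add: diff_divide_distrib)
    moreover have "p / 2 * b powr (p - 2) * (a^2 - b^2) = - (p / 2 * (b powr (p - 2) * (b^2 - a^2)))"
      by (simp only: mult.assoc minus_diff_eq flip: mult_minus_right)
    ultimately show ?thesis using that by (simp add: sq_powr_half)
  qed
  let ?H = "\<lambda>n. p / 4 * (s (Suc (2 * n)) powr (p - 2) * R (Suc (2 * n)))"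
  have "avg K (\<lambda>n. s n powr p) \<le> s (Suc 0) powr p + tsum K ?H"
  proof (rule avg_le_tsum)
    fix n :: nat assume n: "1 \<le> n"
    have "R (Suc (2 * n)) = (s (Suc (2 * n)))^2 - (s n)^2" using s_double_1[OF n] by simp
    hence "s (Suc (2 * n)) powr p \<le> s n powr p + 2 * ?H n"
      using inc[of "s n" "s (Suc (2 * n))"] s_nonneg by simp
    thus "(s (2 * n) powr p + s (Suc (2 * n)) powr p) / 2 \<le> s n powr p + ?H n"
      using s_double[OF n] by simp
  qed
  also have "s (Suc 0) powr p = s (Suc 0) powr (p - 2) * R (Suc 0)"
    using powr_mult_sq[OF s_nonneg, of "Suc 0" p] by (simp add: s_sq)
  \<comment> \<open>Since 1 <= p/2, the chain starting at 1 may be given the same factor as all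
    others.\<close>
  also have "\<dots> \<le> p / 2 * (s (Suc 0) powr (p - 2) * R (Suc 0))"
    using p R_nonneg mult_right_mono[of 1 "p/2" "s (Suc 0) powr (p - 2) * R (Suc 0)"] by simp
  also have "p / 2 * (s (Suc 0) powr (p - 2) * R (Suc 0)) + tsum K ?H
      = p / 2 * tsum K (\<lambda>n. s n powr (p - 2) * (cmod (\<xi> n))^2)"
  proof -
    have "tsum K (\<lambda>n. s n powr (p - 2) * (cmod (\<xi> n))^2) = s (Suc 0) powr (p - 2) * R (Suc 0)
       + tsum K (\<lambda>n. s (Suc (2 * n)) powr (p - 2) * R (Suc (2 * n))) / 2"
      unfolding R_def by (rule tsum_chains) (auto simp: supp s_double)
    thus ?thesis unfolding tsum_cmult by (simp add: algebra_simps)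
  qed
  finally show ?thesis by simp
qed

text \<open>After the weight is split, its first part turns into a sum over roots of |G|^(p-1) R /
  s. As R is the increment of s^2, the quotient R / s is at most twice the increment of s, and
  summation by parts against the submartingale |G|^(p-1) moves everything to level K.\<close>

lemma tsum_weight_le_avg:
  assumes G: "G (Suc 0) = 0"
    and mid: "\<And>n. 1 \<le> n \<Longrightarrow> cmod (G n) powr (p - 1) \<le> (cmod (G (2 * n)) powr (p - 1) + cmod (G (Suc (2 * n))) powr (p - 1)) / 2"
  shows "tsum K (\<lambda>n. cmod (at_root G n) powr (p - 2) * (cmod (\<xi> n))^2)
    \<le> 2 * avg K (\<lambda>n. cmod (G n) powr (p - 1) * s n) + tsum K (\<lambda>n. s n powr (p - 2) * (cmod (\<xi> n))^2)"
proof -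
  let ?u = "\<lambda>n. cmod (at_root G n) powr (p - 1) / s n"
  let ?H = "\<lambda>n. cmod (G (Suc (2 * n))) powr (p - 1) * (s (Suc (2 * n)) - s n) / 2"
  have "tsum K (\<lambda>n. cmod (at_root G n) powr (p - 2) * (cmod (\<xi> n))^2)
    \<le> tsum K (\<lambda>n. ?u n * (cmod (\<xi> n))^2 + s n powr (p - 2) * (cmod (\<xi> n))^2)"
  proof (rule tsum_mono)
    fix n :: nat assume n: "1 \<le> n"
    show "cmod (at_root G n) powr (p - 2) * (cmod (\<xi> n))^2 \<le> ?u n * (cmod (\<xi> n))^2 + s n powr (p - 2) * (cmod (\<xi> n))^2"
    proof (cases "s n = 0")
      case True thus ?thesis using s_zero_imp[OF n] by simp
    next
      case False
      hence "s n > 0" using s_nonneg[of n] by simp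
      thus ?thesis unfolding distrib_right[symmetric]
        using p by (intro mult_right_mono powr_weight_split) auto
    qed
  qed
  also have "\<dots> = tsum K (\<lambda>n. ?u n * (cmod (\<xi> n))^2) + tsum K (\<lambda>n. s n powr (p - 2) * (cmod (\<xi> n))^2)"
    by (rule tsum_add)
  also have "tsum K (\<lambda>n. ?u n * (cmod (\<xi> n))^2) = ?u (Suc 0) * R (Suc 0) + tsum K (\<lambda>n. ?u (Suc (2 * n)) * R (Suc (2 * n))) / 2"
    unfolding R_def by (rule tsum_chains) (auto simp: supp s_double)
  also have "tsum K (\<lambda>n. ?u (Suc (2 * n)) * R (Suc (2 * n))) \<le> tsum K (\<lambda>n. 4 * ?H n)"
  proof (rule tsum_mono)
    fix n :: nat assume n: "1 \<le> n"
    have "R (Suc (2 * n)) / s (Suc (2 * n)) \<le> 2 * (s (Suc (2 * n)) - s n)"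
      using diff_sq_div_le[OF s_nonneg s_le[OF n]] s_double_1[OF n] by simp
    hence "cmod (G (Suc (2 * n))) powr (p - 1) * (R (Suc (2 * n)) / s (Suc (2 * n)))
       \<le> cmod (G (Suc (2 * n))) powr (p - 1) * (2 * (s (Suc (2 * n)) - s n))"
      by (intro mult_left_mono) auto
    thus "?u (Suc (2 * n)) * R (Suc (2 * n)) \<le> 4 * ?H n" by (simp add: algebra_simps)
  qed
  also have "tsum K (\<lambda>n. 4 * ?H n) = 4 * tsum K ?H" by (rule tsum_cmult)
  also have "tsum K ?H \<le> avg K (\<lambda>n. cmod (G n) powr (p - 1) * s n)"
  \<comment> \<open>The summation by parts: the product |G|^(p-1) s gains at least ?H in every step,
    the first factor being a submartingale and the second growing only at odd children.\<close>
  proof -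
    let ?F = "\<lambda>n. cmod (G n) powr (p - 1) * s n"
    have "?F (Suc 0) + tsum K ?H \<le> avg K ?F"
    proof (rule avg_ge_tsum)
      fix n :: nat assume n: "1 \<le> n"
      have "cmod (G n) powr (p - 1) * s n
        \<le> (cmod (G (2 * n)) powr (p - 1) + cmod (G (Suc (2 * n))) powr (p - 1)) / 2 * s n"
        by (intro mult_right_mono mid n s_nonneg)
      thus "?F n + ?H n \<le> (?F (2 * n) + ?F (Suc (2 * n))) / 2"
        using s_double[OF n] by (simp add: field_simps)
    qed
    thus ?thesis using G by simp
  qed
  finally show ?thesis using G by simp
qed

end

text \<open>The two estimates of the locale combined with Young's inequality bound E s^p by half of
  itself plus a multiple of E |val|^p.\<close>

lemma avg_s_le_avg_val:
  assumes "2 \<le> p"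
  shows "\<exists>C\<ge>0. \<forall>K \<xi>. (\<forall>n\<ge>2^K. \<xi> n = 0) \<longrightarrow>
    avg K (\<lambda>n. finite_haar.s K \<xi> n powr p) \<le> C * avg K (\<lambda>n. cmod (val \<xi> n) powr p)
   \<and> tsum K (\<lambda>n. finite_haar.s K \<xi> n powr (p - 2) * (cmod (\<xi> n))^2) \<le> C * avg K (\<lambda>n. cmod (val \<xi> n) powr p)"
proof -
  \<comment> \<open>The coefficient 1/p meets the factor p/2 of \<open>avg_s_le_tsum\<close> and
    leaves 1/2, which can be absorbed.\<close>
  obtain C where C: "C \<ge> 0" and young: "\<And>a b. 0 \<le> a \<Longrightarrow> 0 \<le> b \<Longrightarrow> a powr (p - 2) * b^2 \<le> (1 / p) * a powr p + C * b powr p"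
    using young_sq[OF assms, of "1 / p"] assms by auto
  show ?thesis
  proof (intro exI[of _ "(p + 2) * C"] conjI impI allI)
    fix K \<xi> assume "\<forall>n\<ge>2^K. (\<xi> :: nat \<Rightarrow> complex) n = 0"
    then interpret finite_haar p K \<xi> using assms by unfold_locales auto
    let ?S = "avg K (\<lambda>n. s n powr p)" and ?g = "avg K (\<lambda>n. cmod (val \<xi> n) powr p)"
    let ?T = "tsum K (\<lambda>n. s n powr (p - 2) * (cmod (\<xi> n))^2)"
    have "?T \<le> avg K (\<lambda>n. s n powr (p - 2) * (cmod (val \<xi> n))^2)" by (rule tsum_s_le_avg)
    also have "\<dots> \<le> avg K (\<lambda>n. (1 / p) * s n powr p + C * cmod (val \<xi> n) powr p)"
      by (intro avg_mono young s_nonneg) auto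
    finally have T: "?T \<le> (1 / p) * ?S + C * ?g" by (simp only: avg_add avg_cmult)
    have "?S \<le> p / 2 * ?T" by (rule avg_s_le_tsum)
    also have "\<dots> \<le> p / 2 * ((1 / p) * ?S + C * ?g)" using p T by (intro mult_left_mono) auto
    also have "\<dots> = ?S / 2 + p / 2 * C * ?g" using p by (simp add: field_simps)
    finally have S: "?S \<le> p * C * ?g" by linarith
    have g: "0 \<le> ?g" by (rule avg_nonneg) simp
    show "?S \<le> (p + 2) * C * ?g" using S mult_nonneg_nonneg[OF C g] by (simp add: distrib_right mult.assoc)
    have "(1 / p) * ?S \<le> (1 / p) * (p * C * ?g)" using p S by (intro mult_left_mono) auto
    also have "\<dots> = C * ?g" using p by simp
    finally have "?T \<le> 2 * C * ?g" using T by linarith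
    also have "\<dots> \<le> (p + 2) * C * ?g" using p C g by (intro mult_right_mono) auto
    finally show "?T \<le> (p + 2) * C * ?g" .
  qed (use C assms in auto)
qed

section \<open>Convolution along the chains of the tree\<close>

lemma avg_val_transform_le:
  assumes p: "2 \<le> p" and A: "0 \<le> A" and B: "0 \<le> B"
  shows "\<exists>C\<ge>0. \<forall>K \<xi> \<eta>. (\<forall>n\<ge>2^K. \<xi> n = 0 \<and> \<eta> n = 0)
    \<longrightarrow> (\<forall>m. odd m \<longrightarrow> chain_sum K (\<lambda>n. cmod (\<eta> n) powr p) m \<le> A * chain_sum K (\<lambda>n. cmod (\<xi> n) powr p) m)
    \<longrightarrow> (\<forall>m. odd m \<longrightarrow> chain_sum K (\<lambda>n. (cmod (\<eta> n))^2) m \<le> B * chain_sum K (\<lambda>n. (cmod (\<xi> n))^2) m)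
    \<longrightarrow> avg K (\<lambda>n. cmod (val \<eta> n) powr p) \<le> C * avg K (\<lambda>n. cmod (val \<xi> n) powr p)"
proof -
  obtain Ch where Ch: "Ch \<ge> 0" and hardy: "\<forall>K (\<beta> :: nat \<Rightarrow> complex) \<eta>. (\<forall>n. odd n \<longrightarrow> \<beta> n = 0)
    \<longrightarrow> (\<forall>n\<ge>1. \<beta> (2 * n) = \<beta> n + \<eta> n)
    \<longrightarrow> tsum K (\<lambda>n. cmod (\<beta> n) powr p) \<le> Ch * tsum K (\<lambda>n. cmod (\<eta> n) powr p)"
    using tsum_hardy[OF p] by blast
  obtain Cs where Cs: "Cs \<ge> 0" and sq: "\<forall>K \<xi>. (\<forall>n\<ge>2^K. \<xi> n = 0) \<longrightarrow>
    avg K (\<lambda>n. finite_haar.s K \<xi> n powr p) \<le> Cs * avg K (\<lambda>n. cmod (val \<xi> n) powr p)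
   \<and> tsum K (\<lambda>n. finite_haar.s K \<xi> n powr (p - 2) * (cmod (\<xi> n))^2) \<le> Cs * avg K (\<lambda>n. cmod (val \<xi> n) powr p)"
    using avg_s_le_avg_val[OF p] by blast
  define q where "q = 2 powr (p - 2)"
  have q: "q > 0" by (simp add: q_def)
  \<comment> \<open>E |G|^p will return with coefficient 2 p^2 q B e, which this choice keeps below
    1/2; B + 1 covers B = 0.\<close>
  define e where "e = 1 / (4 * (p^2 * q * (B + 1)))"
  have e: "e > 0" using p q B by (simp add: e_def)
  obtain Cy where Cy: "Cy \<ge> 0" and young: "\<forall>a\<ge>0. \<forall>b\<ge>0. a powr (p - 1) * b \<le> e * a powr p + Cy * b powr p"
    using young_lin[OF p e] by blast
  define C1 where "C1 = q * (2 powr p * (Ch + 1) + 1)"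
  define C where "C = 2 * (p^2 * (C1 * A + q * B * (2 * Cy * Cs + Cs)))"
  have C1: "C1 \<ge> 0" using q Ch by (simp add: C1_def)
  have "C \<ge> 0" using A B C1 q Cy Cs by (simp add: C_def)
  moreover have "avg K (\<lambda>n. cmod (val \<eta> n) powr p) \<le> C * avg K (\<lambda>n. cmod (val \<xi> n) powr p)"
    if supp: "\<forall>n\<ge>2^K. \<xi> n = 0 \<and> \<eta> n = 0"
      and cp: "\<And>m. odd m \<Longrightarrow> chain_sum K (\<lambda>n. cmod (\<eta> n) powr p) m \<le> A * chain_sum K (\<lambda>n. cmod (\<xi> n) powr p) m"
      and c2: "\<And>m. odd m \<Longrightarrow> chain_sum K (\<lambda>n. (cmod (\<eta> n))^2) m \<le> B * chain_sum K (\<lambda>n. (cmod (\<xi> n))^2) m"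
    for K \<xi> \<eta>
  proof -
    have supp': "\<eta> n = 0" "\<xi> n = 0" if "2^K \<le> n" for n using supp that by auto
    interpret finite_haar p K \<xi> using supp p by unfold_locales auto
    define G where "G = val \<eta>"
    \<comment> \<open>The contribution of the current chain alone, counted from its root: it
      vanishes at odd nodes and grows by \<eta> along the chain, as the Hardy inequality
      requires.\<close>
    define \<beta> where "\<beta> = (\<lambda>n. G n - at_root G n)"
    let ?X = "avg K (\<lambda>n. cmod (G n) powr p)" and ?Z = "avg K (\<lambda>n. cmod (val \<xi> n) powr p)"
    let ?U = "tsum K (\<lambda>n. cmod (at_root G n) powr (p - 2) * (cmod (\<eta> n))^2)"
    let ?N = "tsum K (\<lambda>n. cmod (\<eta> n) powr p)"
    have G_mid: "cmod (G n) powr (p - 1) \<le> (cmod (G (2 * n)) powr (p - 1) + cmod (G (Suc (2 * n))) powr (p - 1)) / 2"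
      if "1 \<le> n" for n
      using that p powr_midpoint_cmod[of "p - 1" "val \<eta> n" "\<eta> n"] by (simp add: G_def)
    have G1: "G (Suc 0) = 0" by (simp add: G_def)
    have pt: "(cmod (G n) + cmod (\<eta> n)) powr (p - 2) * (cmod (\<eta> n))^2
      \<le> q * (cmod (at_root G n) powr (p - 2) * (cmod (\<eta> n))^2)
        + (q * 2 powr p * cmod (\<beta> n) powr p + q * (2 powr p + 1) * cmod (\<eta> n) powr p)" for n
    proof -
      let ?o = "cmod (at_root G n)" and ?b = "cmod (\<beta> n)" and ?h = "cmod (\<eta> n)"
      have "cmod (G n) \<le> ?o + ?b"
        using norm_triangle_ineq[of "at_root G n" "\<beta> n"] by (simp add: \<beta>_def)
      hence "(cmod (G n) + ?h) powr (p - 2) \<le> (?o + (?b + ?h)) powr (p - 2)"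
        using p by (intro powr_mono2) auto
      also have "\<dots> \<le> q * (?o powr (p - 2) + (?b + ?h) powr (p - 2))"
        unfolding q_def using p by (intro powr_add_le) auto
      finally have "(cmod (G n) + ?h) powr (p - 2) * ?h^2 \<le> q * (?o powr (p - 2) + (?b + ?h) powr (p - 2)) * ?h^2"
        by (intro mult_right_mono) auto
      also have "\<dots> = q * (?o powr (p - 2) * ?h^2) + q * ((?b + ?h) powr (p - 2) * ?h^2)"
        by (simp add: algebra_simps)
      also have "(?b + ?h) powr (p - 2) * ?h^2 \<le> (?b + ?h) powr p + ?h powr p"
        using p by (intro powr_sq_le) auto
      also have "(?b + ?h) powr p \<le> 2 powr p * (?b powr p + ?h powr p)"
        using p by (intro powr_add_le) auto
      finally show ?thesis using q by (simp add: algebra_simps)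
    qed
    have X1: "?X \<le> p^2 * (q * ?U + (q * 2 powr p * tsum K (\<lambda>n. cmod (\<beta> n) powr p) + q * (2 powr p + 1) * ?N))"
    proof -
      have "?X \<le> tsum K (\<lambda>n. p^2 * (cmod (G n) + cmod (\<eta> n)) powr (p - 2) * (cmod (\<eta> n))^2)"
        unfolding G_def by (rule avg_val_le_tsum[OF p])
      also have "\<dots> \<le> tsum K (\<lambda>n. p^2 * (q * (cmod (at_root G n) powr (p - 2) * (cmod (\<eta> n))^2)
        + (q * 2 powr p * cmod (\<beta> n) powr p + q * (2 powr p + 1) * cmod (\<eta> n) powr p)))"
        by (intro tsum_mono) (simp only: mult.assoc, intro mult_left_mono, use pt in \<open>simp_all add: mult.assoc\<close>)
      also have "\<dots> = p^2 * (q * ?U + (q * 2 powr p * tsum K (\<lambda>n. cmod (\<beta> n) powr p) + q * (2 powr p + 1) * ?N))"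
        by (simp only: tsum_cmult tsum_add)
      finally show ?thesis .
    qed
    have "tsum K (\<lambda>n. cmod (\<beta> n) powr p) \<le> Ch * ?N"
      by (rule hardy[rule_format]) (auto simp: \<beta>_def G_def)
    hence "q * 2 powr p * tsum K (\<lambda>n. cmod (\<beta> n) powr p) \<le> q * 2 powr p * (Ch * ?N)"
      using q by (intro mult_left_mono) auto
    hence X2: "q * ?U + (q * 2 powr p * tsum K (\<lambda>n. cmod (\<beta> n) powr p) + q * (2 powr p + 1) * ?N) \<le> q * ?U + C1 * ?N"
      by (simp add: C1_def algebra_simps)
    have "tsum K (\<lambda>n. 1 * cmod (\<eta> n) powr p) \<le> A * tsum K (\<lambda>n. 1 * cmod (\<xi> n) powr p)"
      by (rule tsum_chains_mono) (use supp' cp p in auto)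
    hence "?N \<le> A * tsum K (\<lambda>n. cmod (\<xi> n) powr p)" by simp
    also have "\<dots> \<le> A * ?Z" using A tsum_powr_le_avg_val[OF p] by (intro mult_left_mono) auto
    finally have N: "C1 * ?N \<le> C1 * (A * ?Z)" using C1 by (intro mult_left_mono) auto
    have comb: "u \<le> 2 * (x + y) + z" if "a \<le> x + c" "c \<le> y" "t \<le> z" "u \<le> 2 * a + t"
      for u a t x c y z :: real using that by argo
    have "avg K (\<lambda>n. cmod (G n) powr (p - 1) * s n) \<le> avg K (\<lambda>n. e * cmod (G n) powr p + Cy * s n powr p)"
      by (intro avg_mono young[rule_format] s_nonneg) auto
    hence "avg K (\<lambda>n. cmod (G n) powr (p - 1) * s n) \<le> e * ?X + Cy * avg K (\<lambda>n. s n powr p)"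
      by (simp only: avg_add avg_cmult)
    moreover have "Cy * avg K (\<lambda>n. s n powr p) \<le> Cy * (Cs * ?Z)"
      using sq[rule_format, of K \<xi>] supp Cy by (intro mult_left_mono) auto
    moreover have "tsum K (\<lambda>n. s n powr (p - 2) * (cmod (\<xi> n))^2) \<le> Cs * ?Z"
      using sq[rule_format, of K \<xi>] supp by auto
    moreover have "tsum K (\<lambda>n. cmod (at_root G n) powr (p - 2) * (cmod (\<xi> n))^2)
      \<le> 2 * avg K (\<lambda>n. cmod (G n) powr (p - 1) * s n) + tsum K (\<lambda>n. s n powr (p - 2) * (cmod (\<xi> n))^2)"
      by (rule tsum_weight_le_avg[OF G1 G_mid])
    ultimately have "tsum K (\<lambda>n. cmod (at_root G n) powr (p - 2) * (cmod (\<xi> n))^2)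
      \<le> 2 * (e * ?X + Cy * (Cs * ?Z)) + Cs * ?Z" by (rule comb)
    hence "B * tsum K (\<lambda>n. cmod (at_root G n) powr (p - 2) * (cmod (\<xi> n))^2)
      \<le> B * (2 * (e * ?X + Cy * (Cs * ?Z)) + Cs * ?Z)" by (rule mult_left_mono) (rule B)
    moreover have "?U \<le> B * tsum K (\<lambda>n. cmod (at_root G n) powr (p - 2) * (cmod (\<xi> n))^2)"
      by (rule tsum_chains_mono) (use supp' c2 in auto)
    ultimately have U: "?U \<le> B * (2 * (e * ?X + Cy * (Cs * ?Z)) + Cs * ?Z)" by linarith
    have Xn: "0 \<le> ?X" by (rule avg_nonneg) simp
    have QU: "q * ?U \<le> q * (B * (2 * (e * ?X + Cy * (Cs * ?Z)) + Cs * ?Z))"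
      using q U by (intro mult_left_mono) auto
    have "p^2 * (q * ?U + C1 * ?N) \<le> p^2 * (q * (B * (2 * (e * ?X + Cy * (Cs * ?Z)) + Cs * ?Z)) + C1 * (A * ?Z))"
      by (rule mult_left_mono[OF add_mono[OF QU N]]) simp
    moreover have "p^2 * (q * ?U + (q * 2 powr p * tsum K (\<lambda>n. cmod (\<beta> n) powr p) + q * (2 powr p + 1) * ?N)) \<le> p^2 * (q * ?U + C1 * ?N)"
      using X2 by (intro mult_left_mono) auto
    moreover have "p^2 * (q * (B * (2 * (e * ?X + Cy * (Cs * ?Z)) + Cs * ?Z)) + C1 * (A * ?Z))
      = (p^2 * q * B * 2 * e) * ?X + C / 2 * ?Z"
      by (simp add: C_def algebra_simps)
    moreover have "(p^2 * q * B * 2 * e) * ?X \<le> 1 / 2 * ?X"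
    proof (rule mult_right_mono[OF _ Xn])
      have "p^2 * q > 0" using p q by simp
      moreover have "(w * B * 2) / (4 * (w * (B + 1))) \<le> 1 / 2" if "w > 0" for w :: real
        using that B by (subst pos_divide_le_eq) (auto simp: distrib_left add_nonneg_pos)
      ultimately have "(p^2 * q * B * 2) / (4 * (p^2 * q * (B + 1))) \<le> 1 / 2" by blast
      thus "p^2 * q * B * 2 * e \<le> 1 / 2" by (simp only: e_def times_divide_eq_right mult_1_right)
    qed
    ultimately have "?X \<le> 1 / 2 * ?X + C / 2 * ?Z" using X1 by linarith
    thus ?thesis by (simp add: G_def)
  qed
  ultimately show ?thesis by blast
qed

section \<open>Convolution by c on sequences and on the tree\<close>

definition conv :: "(nat \<Rightarrow> complex) \<Rightarrow> (nat \<Rightarrow> complex) \<Rightarrow> nat \<Rightarrow> complex" where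
  "conv c b k = (\<Sum>i\<le>k. c i * b (k - i))"

text \<open>Both sides are cut at the same L: convolution is causal, so the bound makes sense for
  every sequence b and fits the initial segments of chains that occur in a finite tree.\<close>

definition bounded_conv :: "real \<Rightarrow> (nat \<Rightarrow> complex) \<Rightarrow> bool" where
  "bounded_conv p c \<longleftrightarrow> (\<exists>C\<ge>0. \<forall>b L. (\<Sum>k<L. cmod (conv c b k) powr p / 2^k) \<le> C * (\<Sum>k<L. cmod (b k) powr p / 2^k))"

text \<open>The exponent of 2 in n is the position of n in its chain, so the sum runs back exactly
  to the odd root. This is the action of h_n -> f_n on Haar coefficients.\<close>

definition tconv :: "(nat \<Rightarrow> complex) \<Rightarrow> (nat \<Rightarrow> complex) \<Rightarrow> nat \<Rightarrow> complex" where
  "tconv c \<xi> n = (\<Sum>i\<le>multiplicity 2 n. c i * \<xi> (n div 2^i))"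

lemma multiplicity_odd_times: "odd m \<Longrightarrow> multiplicity 2 (m * 2^k) = k" for m :: nat
proof (rule multiplicity_eqI)
  assume "odd m"
  hence "\<not> 2^k * 2 dvd 2^k * m" by (subst dvd_times_left_cancel_iff) auto
  thus "\<not> 2^Suc k dvd m * 2^k" by (simp add: mult.commute)
qed simp

lemma tconv_chain:
  assumes "odd m"
  shows "tconv c \<xi> (m * 2^k) = conv c (\<lambda>j. \<xi> (m * 2^j)) k"
  unfolding tconv_def conv_def multiplicity_odd_times[OF assms]
proof (rule sum.cong)
  fix i assume "i \<in> {..k}"
  hence "m * 2^k = m * 2^(k - i) * 2^i" by (simp flip: power_add)
  hence "m * 2^k div 2^i = m * 2^(k - i)" by (metis nonzero_mult_div_cancel_right power_not_zero zero_neq_numeral)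
  thus "c i * \<xi> (m * 2^k div 2^i) = c i * \<xi> (m * 2^(k - i))" by simp
qed simp

text \<open>Young's inequality for an absolutely summable and a square summable sequence:
  Cauchy-Schwarz with g split into two square roots, then the triangle of indices is enlarged to a
  square.\<close>

lemma young_conv_sq:
  fixes g y :: "nat \<Rightarrow> real"
  assumes g: "\<And>i. 0 \<le> g i" and y: "\<And>i. 0 \<le> y i"
  shows "(\<Sum>k<L. (\<Sum>i\<le>k. g i * y (k - i))^2) \<le> (\<Sum>i<L. g i)^2 * (\<Sum>i<L. (y i)^2)"
proof -
  let ?G = "\<Sum>i<L. g i"
  have cs: "(\<Sum>i\<le>k. g i * y (k - i))^2 \<le> ?G * (\<Sum>i\<le>k. g i * (y (k - i))^2)" if "k < L" for k
  proof -
    have "(\<Sum>i\<le>k. g i * y (k - i))^2 = (\<Sum>i\<le>k. sqrt (g i) * (sqrt (g i) * y (k - i)))^2"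
      by (simp add: g flip: mult.assoc)
    also have "\<dots> \<le> (\<Sum>i\<le>k. (sqrt (g i))^2) * (\<Sum>i\<le>k. (sqrt (g i) * y (k - i))^2)"
      by (rule Cauchy_Schwarz_ineq_sum)
    also have "\<dots> = (\<Sum>i\<le>k. g i) * (\<Sum>i\<le>k. g i * (y (k - i))^2)"
      by (simp add: g power_mult_distrib)
    also have "\<dots> \<le> ?G * (\<Sum>i\<le>k. g i * (y (k - i))^2)"
      using that by (intro mult_right_mono sum_mono2 sum_nonneg mult_nonneg_nonneg g) auto
    finally show ?thesis .
  qed
  have "(\<Sum>k<L. (\<Sum>i\<le>k. g i * y (k - i))^2) \<le> (\<Sum>k<L. ?G * (\<Sum>i\<le>k. g i * (y (k - i))^2))"
    by (intro sum_mono cs) auto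
  also have "\<dots> = ?G * (\<Sum>(i, j)\<in>{(i, j). i + j < L}. g i * (y j)^2)"
    by (simp add: sum.triangle_reindex sum_distrib_left)
  also have "\<dots> \<le> ?G * (\<Sum>(i, j)\<in>{..<L} \<times> {..<L}. g i * (y j)^2)"
    by (intro mult_left_mono sum_mono2 sum_nonneg) (auto intro: g mult_nonneg_nonneg)
  also have "(\<Sum>(i, j)\<in>{..<L} \<times> {..<L}. g i * (y j)^2) = ?G * (\<Sum>i<L. (y i)^2)"
    by (simp add: sum_product sum.cartesian_product)
  finally show ?thesis by (simp add: power2_eq_square mult.assoc)
qed

lemma bounded_conv_coeff:
  assumes "bounded_conv p c" and p: "2 \<le> p"
  shows "\<exists>C\<ge>0. \<forall>k. cmod (c k) powr p / 2^k \<le> C"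
proof -
  obtain C where C: "C \<ge> 0" "\<And>b L. (\<Sum>k<L. cmod (conv c b k) powr p / 2^k) \<le> C * (\<Sum>k<L. cmod (b k) powr p / 2^k)"
    using assms by (auto simp: bounded_conv_def)
  define b :: "nat \<Rightarrow> complex" where "b = (\<lambda>k. if k = 0 then 1 else 0)"
  have conv: "conv c b k = c k" for k
  proof -
    have "conv c b k = (\<Sum>i\<le>k. if i = k then c i else 0)"
      unfolding conv_def b_def by (intro sum.cong) auto
    thus ?thesis by simp
  qed
  have "cmod (c k) powr p / 2^k \<le> C" for k
  proof -
    have "cmod (c k) powr p / 2^k \<le> (\<Sum>k<Suc k. cmod (conv c b k) powr p / 2^k)"
      unfolding conv by (rule member_le_sum) auto
    also have "\<dots> \<le> C * (\<Sum>k<Suc k. cmod (b k) powr p / 2^k)" by (rule C)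
    also have "(\<Sum>k<Suc k. cmod (b k) powr p / 2^k) = (\<Sum>k<Suc k. if k = 0 then 1 else 0)"
      using p by (intro sum.cong) (auto simp: b_def)
    finally show ?thesis by (simp only: sum.delta finite_lessThan) auto
  qed
  thus ?thesis using C by blast
qed

text \<open>For \<open>p > 2\<close> the coefficients of a multiplier are absolutely summable against the smaller radius
  \<open>2\<^sup>-\<^sup>1\<^sup>/\<^sup>2\<close>, so the \<open>L\<^sup>2\<close> bound needs no interpolation.\<close>

lemma bounded_conv_sq:
  assumes bc: "bounded_conv p c" and p: "2 \<le> p"
  shows "\<exists>C\<ge>0. \<forall>b L. (\<Sum>k<L. (cmod (conv c b k))^2 / 2^k) \<le> C * (\<Sum>k<L. (cmod (b k))^2 / 2^k)"
proof (cases "p = 2")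
  case True
  thus ?thesis using bc by (auto simp: bounded_conv_def powr_numeral)
next
  case False
  hence p2: "p > 2" using p by simp
  obtain C where C: "C \<ge> 0" "\<And>k. cmod (c k) powr p / 2^k \<le> C" using bounded_conv_coeff[OF bc p] by auto
  \<comment> \<open>The quotient of the radii 2^(-1/2) and 2^(-1/p); it is below 1 because p > 2,
    and the coefficient bound becomes geometric.\<close>
  define r :: real where "r = 2 powr (1 / p - 1 / 2)"
  have r: "0 < r" "r < 1" using p2 by (auto simp: r_def powr_less_one field_simps)
  define g where "g = (\<lambda>k. cmod (c k) / sqrt 2 ^ k)"
  have g_le: "g k \<le> C powr (1 / p) * r ^ k" for k
  proof -
    have "cmod (c k) powr p \<le> C * 2^k" using C(2)[of k] by (simp add: field_simps)
    hence "(cmod (c k) powr p) powr (1 / p) \<le> (C * 2^k) powr (1 / p)" using p by (intro powr_mono2) auto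
    hence "cmod (c k) \<le> C powr (1 / p) * (2^k) powr (1 / p)" using p C by (simp add: powr_powr powr_mult)
    hence "g k \<le> C powr (1 / p) * ((2^k) powr (1 / p) / sqrt 2 ^ k)" by (simp add: g_def divide_right_mono)
    also have "(2^k) powr (1 / p) / sqrt 2 ^ k = r ^ k"
    proof -
      have "(2^k) powr (1 / p) = (2 powr (1 / p)) ^ k"
        by (simp add: powr_powr mult.commute flip: powr_realpow)
      moreover have "sqrt 2 = 2 powr (1 / 2)" by (simp add: powr_half_sqrt)
      ultimately show ?thesis by (simp add: r_def powr_diff power_divide)
    qed
    finally show ?thesis .
  qed
  have sum_g: "(\<Sum>i<L. g i) \<le> C powr (1 / p) / (1 - r)" for L
  proof -
    have "(\<Sum>i<L. g i) \<le> (\<Sum>i<L. C powr (1 / p) * r ^ i)" by (intro sum_mono g_le)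
    also have "\<dots> = C powr (1 / p) * ((1 - r ^ L) / (1 - r))"
      using r by (simp add: sum_gp_strict flip: sum_distrib_left)
    also have "\<dots> \<le> C powr (1 / p) * (1 / (1 - r))"
      using r by (intro mult_left_mono divide_right_mono) auto
    finally show ?thesis by simp
  qed
  show ?thesis
  proof (intro exI[of _ "(C powr (1 / p) / (1 - r))^2"] conjI allI)
    fix b :: "nat \<Rightarrow> complex" and L
    define y where "y = (\<lambda>k. cmod (b k) / sqrt 2 ^ k)"
    have sq: "(x / sqrt 2 ^ k)^2 = x^2 / 2^k" for x :: real and k
      by (simp add: power_divide flip: power_mult, simp add: power_mult mult.commute[of k])
    have "(\<Sum>k<L. (cmod (conv c b k))^2 / 2^k) \<le> (\<Sum>k<L. (\<Sum>i\<le>k. g i * y (k - i))^2)"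
    proof (rule sum_mono)
      fix k
      have "cmod (conv c b k) / sqrt 2 ^ k \<le> (\<Sum>i\<le>k. cmod (c i * b (k - i))) / sqrt 2 ^ k"
        unfolding conv_def by (intro divide_right_mono norm_sum) auto
      also have "\<dots> = (\<Sum>i\<le>k. g i * y (k - i))"
        unfolding sum_divide_distrib
      proof (rule sum.cong)
        fix i assume "i \<in> {..k}"
        hence "sqrt 2 ^ k = sqrt 2 ^ i * sqrt 2 ^ (k - i)" by (simp flip: power_add)
        thus "cmod (c i * b (k - i)) / sqrt 2 ^ k = g i * y (k - i)"
          by (simp add: g_def y_def norm_mult)
      qed simp
      finally have "(cmod (conv c b k) / sqrt 2 ^ k)^2 \<le> (\<Sum>i\<le>k. g i * y (k - i))^2"
        by (intro power_mono) auto
      thus "(cmod (conv c b k))^2 / 2^k \<le> (\<Sum>i\<le>k. g i * y (k - i))^2" by (simp add: sq)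
    qed
    also have "\<dots> \<le> (\<Sum>i<L. g i)^2 * (\<Sum>i<L. (y i)^2)"
      by (rule young_conv_sq) (auto simp: g_def y_def)
    also have "\<dots> \<le> (C powr (1 / p) / (1 - r))^2 * (\<Sum>i<L. (y i)^2)"
      by (intro mult_right_mono power_mono sum_g sum_nonneg) (auto simp: g_def)
    finally show "(\<Sum>k<L. (cmod (conv c b k))^2 / 2^k) \<le> (C powr (1 / p) / (1 - r))^2 * (\<Sum>k<L. (cmod (b k))^2 / 2^k)"
      by (simp add: y_def sq)
  qed simp
qed

text \<open>The nodes m * 2^k increase with k, so a chain meets the tree below level K in an initial
  segment, where \<open>bounded_conv\<close> applies.\<close>

lemma chain_truncation:
  fixes m :: nat
  assumes "odd m"
  shows "\<exists>L. (\<forall>k<L. m * 2^k < 2^K) \<and> (\<forall>F. (\<forall>n\<ge>2^K. F n = 0) \<longrightarrow> chain_sum K F m = (\<Sum>k<L. F (m * 2^k) / 2^k))"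
proof -
  have m: "m \<ge> 1" using assms by (cases m) auto
  define L where "L = (LEAST k. 2^K \<le> m * 2^k)"
  have "2^K \<le> m * 2^K" using m by simp
  hence L: "2^K \<le> m * 2^L" "L \<le> K" unfolding L_def by (blast intro: LeastI[of "\<lambda>k. 2^K \<le> m * 2^k"] Least_le[of "\<lambda>k. 2^K \<le> m * 2^k"])+
  have less: "m * 2^k < 2^K" if "k < L" for k
    using not_less_Least[OF that[unfolded L_def]] by simp
  have "chain_sum K F m = (\<Sum>k<L. F (m * 2^k) / 2^k)" if "\<forall>n\<ge>2^K. F n = 0" for F
    unfolding chain_sum_def
  proof (rule sum.mono_neutral_right)
    show "\<forall>k\<in>{..<K} - {..<L}. F (m * 2^k) / 2^k = 0"
    proof
      fix k assume "k \<in> {..<K} - {..<L}"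
      hence "m * 2^L \<le> m * 2^k" by simp
      hence "2^K \<le> m * 2^k" using L by linarith
      thus "F (m * 2^k) / 2^k = 0" using that by simp
    qed
  qed (use L in auto)
  thus ?thesis using less by blast
qed

theorem avg_val_tconv_le:
  assumes p: "2 \<le> p" and c: "bounded_conv p c"
  shows "\<exists>C\<ge>0. \<forall>\<xi> K. avg K (\<lambda>n. cmod (val (tconv c \<xi>) n) powr p) \<le> C * avg K (\<lambda>n. cmod (val \<xi> n) powr p)"
proof -
  obtain A where A: "A \<ge> 0" and cp: "\<And>b L. (\<Sum>k<L. cmod (conv c b k) powr p / 2^k) \<le> A * (\<Sum>k<L. cmod (b k) powr p / 2^k)"
    using c by (auto simp: bounded_conv_def)
  obtain B where B: "B \<ge> 0" and c2: "\<And>b L. (\<Sum>k<L. (cmod (conv c b k))^2 / 2^k) \<le> B * (\<Sum>k<L. (cmod (b k))^2 / 2^k)"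
    using bounded_conv_sq[OF c p] by auto
  obtain C where C: "C \<ge> 0" and main: "\<forall>K \<xi> \<eta>. (\<forall>n\<ge>2^K. \<xi> n = 0 \<and> \<eta> n = 0)
    \<longrightarrow> (\<forall>m. odd m \<longrightarrow> chain_sum K (\<lambda>n. cmod (\<eta> n) powr p) m \<le> A * chain_sum K (\<lambda>n. cmod (\<xi> n) powr p) m)
    \<longrightarrow> (\<forall>m. odd m \<longrightarrow> chain_sum K (\<lambda>n. (cmod (\<eta> n))^2) m \<le> B * chain_sum K (\<lambda>n. (cmod (\<xi> n))^2) m)
    \<longrightarrow> avg K (\<lambda>n. cmod (val \<eta> n) powr p) \<le> C * avg K (\<lambda>n. cmod (val \<xi> n) powr p)"
    using avg_val_transform_le[OF p A B] by blast
  have "avg K (\<lambda>n. cmod (val (tconv c \<xi>) n) powr p) \<le> C * avg K (\<lambda>n. cmod (val \<xi> n) powr p)" for \<xi> K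
  proof -
    \<comment> \<open>The level-K average sees only coefficients with index below 2^K, so both
      sequences may be cut there to meet the support hypothesis. On each chain the cut is an initial
      segment, and by causality the cut image depends only on the cut input.\<close>
    define cut where "cut = (\<lambda>(\<zeta> :: nat \<Rightarrow> complex) n. if n < 2^K then \<zeta> n else 0)"
    have val_cut: "avg K (\<lambda>n. cmod (val (cut \<zeta>) n) powr p) = avg K (\<lambda>n. cmod (val \<zeta> n) powr p)" for \<zeta>
    proof (rule avg_cong)
      fix n :: nat assume "n < 2^Suc K"
      hence "val (cut \<zeta>) n = val \<zeta> n" by (intro val_cong) (auto simp: cut_def)
      thus "cmod (val (cut \<zeta>) n) powr p = cmod (val \<zeta> n) powr p" by simp
    qed
    have chain: "chain_sum K (\<lambda>n. \<phi> (cut (tconv c \<xi>) n)) m \<le> D * chain_sum K (\<lambda>n. \<phi> (cut \<xi> n)) m"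
      if "odd m" "\<phi> 0 = 0" and b: "\<And>b L. (\<Sum>k<L. \<phi> (conv c b k) / 2^k) \<le> D * (\<Sum>k<L. \<phi> (b k) / 2^k)"
      for \<phi> :: "complex \<Rightarrow> real" and D m
    proof -
      obtain L where L: "\<And>k. k < L \<Longrightarrow> m * 2^k < 2^K"
        and ch: "\<And>F. (\<forall>n\<ge>2^K. F n = 0) \<Longrightarrow> chain_sum K F m = (\<Sum>k<L. F (m * 2^k) / 2^k)"
        using chain_truncation[OF \<open>odd m\<close>, of K] by blast
      have "chain_sum K (\<lambda>n. \<phi> (cut \<zeta> n)) m = (\<Sum>k<L. \<phi> (\<zeta> (m * 2^k)) / 2^k)" for \<zeta>
        using L that(2) by (subst ch) (auto simp: cut_def)
      thus ?thesis using b[where L=L and b="\<lambda>j. \<xi> (m * 2^j)"]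
        by (simp add: tconv_chain[OF \<open>odd m\<close>])
    qed
    have "avg K (\<lambda>n. cmod (val (cut (tconv c \<xi>)) n) powr p) \<le> C * avg K (\<lambda>n. cmod (val (cut \<xi>) n) powr p)"
    proof (rule main[rule_format])
      fix n :: nat assume "2^K \<le> n"
      thus "cut \<xi> n = 0 \<and> cut (tconv c \<xi>) n = 0" by (simp add: cut_def)
    qed (use p chain[of _ "\<lambda>z. cmod z powr p", OF _ _ cp] chain[of _ "\<lambda>z. (cmod z)^2", OF _ _ c2] in auto)
    thus ?thesis by (simp only: val_cut)
  qed
  thus ?thesis using C by blast
qed

section \<open>Multipliers of the weighted sequence space\<close>

text \<open>The summand of the p-th power of the norm of A_p^+ at radius 2^(-1/p). The factor 2^-k
  is at the same time the relative length of the k-th cell in a chain; this is where the radius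
  comes from.\<close>

definition wt :: "real \<Rightarrow> (nat \<Rightarrow> complex) \<Rightarrow> nat \<Rightarrow> real" where
  "wt p b k = cmod (b k) powr p / 2^k"

text \<open>Multiplication by z^N in terms of coefficients; the factor 2^(N/p) compensates for the
  smaller weights.\<close>

definition scaled_shift :: "real \<Rightarrow> nat \<Rightarrow> (nat \<Rightarrow> complex) \<Rightarrow> nat \<Rightarrow> complex" where
  "scaled_shift p N b k = (if k < N then 0 else of_real (2 powr (N / p)) * b (k - N))"

lemma wt_nonneg [simp]: "0 \<le> wt p b k"
  by (simp add: wt_def)

lemma wt_add_le: "0 \<le> p \<Longrightarrow> wt p (\<lambda>k. a k + b k) n \<le> 2 powr p * (wt p a n + wt p b n)"
proof -
  assume p: "0 \<le> p"
  have "cmod (a n + b n) powr p \<le> (cmod (a n) + cmod (b n)) powr p"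
    using p by (intro powr_mono2 norm_triangle_ineq) auto
  also have "\<dots> \<le> 2 powr p * (cmod (a n) powr p + cmod (b n) powr p)"
    using p by (intro powr_add_le) auto
  finally show ?thesis by (simp add: wt_def divide_right_mono add_divide_distrib[symmetric])
qed

lemma wt_cmult: "wt p (\<lambda>k. x * b k) n = cmod x powr p * wt p b n"
  by (simp add: wt_def norm_mult powr_mult)

lemma wt_scaled_shift:
  assumes "p > 0"
  shows "wt p (scaled_shift p N b) (k + N) = wt p b k"
proof -
  have "cmod (of_real (2 powr (N / p)) * b k) powr p = (2 powr (N / p)) powr p * cmod (b k) powr p"
    by (simp add: norm_mult powr_mult)
  also have "(2 powr (N / p)) powr p = 2 ^ N" using assms by (simp add: powr_powr powr_realpow)
  finally show ?thesis by (simp add: wt_def scaled_shift_def power_add)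
qed

lemma conv_scaled_shift:
  "conv c (scaled_shift p N b) (k + N) = of_real (2 powr (N / p)) * conv c b k"
proof -
  have "conv c (scaled_shift p N b) (k + N) = (\<Sum>i\<le>k. c i * scaled_shift p N b (k + N - i))"
    unfolding conv_def by (rule sum.mono_neutral_right) (auto simp: scaled_shift_def)
  also have "\<dots> = (\<Sum>i\<le>k. of_real (2 powr (N / p)) * (c i * b (k - i)))"
    by (intro sum.cong) (auto simp: scaled_shift_def)
  finally show ?thesis by (simp add: conv_def sum_distrib_left)
qed

lemma conv_add: "conv c (\<lambda>k. a k + b k) n = conv c a n + conv c b n"
  by (simp add: conv_def distrib_left sum.distrib)

lemma conv_cmult: "conv c (\<lambda>k. x * b k) n = x * conv c b n"
  by (simp add: conv_def sum_distrib_left mult_ac)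

lemma conv_cong: "(\<And>j. j \<le> n \<Longrightarrow> a j = b j) \<Longrightarrow> conv c a n = conv c b n"
  by (simp add: conv_def)

section \<open>From the mapping property of a multiplier to a norm bound\<close>

definition lp_mult :: "real \<Rightarrow> (nat \<Rightarrow> complex) \<Rightarrow> bool" where
  "lp_mult p c \<longleftrightarrow> (\<forall>b. summable (wt p b) \<longrightarrow> summable (wt p (conv c b)))"

lemma sum_shift_interval:
  fixes f :: "nat \<Rightarrow> real"
  shows "sum f {N..<N + L} = (\<Sum>k<L. f (k + N))"
  using sum.shift_bounds_nat_ivl[of f 0 N L] by (simp add: lessThan_atLeast0 add.commute)

text \<open>A gliding hump argument replaces the closed graph theorem.  The scaled shift is isometric and
  commutes with the convolution, so witnesses of unboundedness can be moved into disjoint windows.\<close>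

lemma unbounded_conv_witness:
  assumes p: "p > 0" and nb: "\<not> bounded_conv p c"
  shows "\<exists>b L. 0 < L \<and> (\<forall>k\<ge>L. b k = 0) \<and> (\<Sum>k<L. wt p b k) \<le> (1/2)^j \<and> real j + 1 \<le> (\<Sum>k<L. wt p (conv c b) k)"
proof -
  \<comment> \<open>With a ratio this large the input can be scaled down to total weight 2^-j while
    the output keeps weight at least j + 1.\<close>
  define C where "C = (real j + 1) * 2^j"
  have C: "C \<ge> 0" by (simp add: C_def)
  then obtain a L where aL: "(\<Sum>k<L. wt p (conv c a) k) > C * (\<Sum>k<L. wt p a k)"
    using nb unfolding bounded_conv_def wt_def by (meson not_le)
  define S where "S = (\<Sum>k<L. wt p a k)"
  have S: "S > 0"
  proof (rule ccontr)
    assume "\<not> S > 0"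
    moreover have "S \<ge> 0" unfolding S_def by (intro sum_nonneg) simp
    ultimately have "S = 0" by simp
    hence "\<forall>k<L. wt p a k = 0" unfolding S_def by (subst (asm) sum_nonneg_eq_0_iff) auto
    hence "\<forall>k<L. a k = 0" by (simp add: wt_def)
    hence "\<forall>k<L. conv c a k = 0" by (auto simp: conv_def intro!: sum.neutral)
    hence "(\<Sum>k<L. wt p (conv c a) k) = 0" using p by (simp add: wt_def)
    thus False using aL \<open>S = 0\<close> by (simp add: S_def)
  qed
  define x :: complex where "x = of_real (((1/2)^j / S) powr (1 / p))"
  have x: "cmod x powr p = (1/2)^j / S" using p S by (simp add: x_def powr_powr)
  define b where "b = (\<lambda>k. if k < L then x * a k else 0)"
  have wb: "wt p b k = (1/2)^j / S * wt p a k" if "k < L" for k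
    using that wt_cmult[of p x a k] by (simp add: wt_def b_def x)
  have cb: "wt p (conv c b) k = (1/2)^j / S * wt p (conv c a) k" if "k < L" for k
  proof -
    have "conv c b k = conv c (\<lambda>k. x * a k) k" using that by (intro conv_cong) (simp add: b_def)
    hence "wt p (conv c b) k = wt p (\<lambda>k. x * conv c a k) k" by (simp add: conv_cmult wt_def)
    thus ?thesis by (simp add: wt_cmult x)
  qed
  have "(\<Sum>k<L. wt p b k) = (\<Sum>k<L. (1/2)^j / S * wt p a k)" by (simp add: wb)
  also have "\<dots> = (1/2)^j / S * S" by (simp only: S_def sum_distrib_left)
  finally have 1: "(\<Sum>k<L. wt p b k) = (1/2)^j" using S by simp
  have "real j + 1 = (1/2)^j / S * (C * S)" using S by (simp add: C_def power_one_over)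
  also have "\<dots> \<le> (1/2)^j / S * (\<Sum>k<L. wt p (conv c a) k)"
    using aL S by (intro mult_left_mono) (auto simp: S_def)
  also have "\<dots> = (\<Sum>k<L. wt p (conv c b) k)" by (simp add: cb sum_distrib_left)
  finally have 2: "real j + 1 \<le> (\<Sum>k<L. wt p (conv c b) k)" .
  moreover have "L \<noteq> 0" using S by (cases L) (auto simp: S_def)
  ultimately show ?thesis using 1 by (intro exI[of _ b] exI[of _ L]) (auto simp: b_def)
qed

lemma summable_tail_le:
  fixes f :: "nat \<Rightarrow> real"
  assumes "summable f" "\<And>k. 0 \<le> f k"
  shows "\<exists>N0. \<forall>N\<ge>N0. \<forall>M. sum f {N..<M} \<le> 1"
proof -
  obtain N0 where "\<And>m n. m \<ge> N0 \<Longrightarrow> norm (sum f {m..<n}) < 1"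
    using assms(1) unfolding summable_Cauchy by (meson zero_less_one)
  thus ?thesis by (intro exI[of _ N0]) (auto intro: less_imp_le dest: order_le_less_trans[OF abs_ge_self])
qed

lemma lp_mult_imp_bounded_conv:
  assumes p: "p > 0" and c: "lp_mult p c"
  shows "bounded_conv p c"
proof (rule ccontr)
  assume "\<not> bounded_conv p c"
  hence "\<forall>j. \<exists>b L. 0 < L \<and> (\<forall>k\<ge>L. b k = 0) \<and> (\<Sum>k<L. wt p b k) \<le> (1/2)^j \<and> real j + 1 \<le> (\<Sum>k<L. wt p (conv c b) k)"
    using unbounded_conv_witness[OF p] by blast
  then obtain B :: "nat \<Rightarrow> nat \<Rightarrow> complex" and L where L: "\<And>j. 0 < L j" and B: "\<And>j k. k \<ge> L j \<Longrightarrow> B j k = 0"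
    and small: "\<And>j. (\<Sum>k<L j. wt p (B j) k) \<le> (1/2)^j"
    and large: "\<And>j. real j + 1 \<le> (\<Sum>k<L j. wt p (conv c (B j)) k)"
    unfolding choice_iff by blast
  \<comment> \<open>A state consists of the sequence built so far and the first free position; step
    j adds hump j there.\<close>
  define Q where "Q = (\<lambda>(j::nat) (s::(nat \<Rightarrow> complex) \<times> nat) (s'::(nat \<Rightarrow> complex) \<times> nat).
     (\<forall>k. fst s' k = fst s k + scaled_shift p (snd s) (B j) k) \<and> snd s + L j \<le> snd s')"
  \<comment> \<open>The last clause is the decisive one: beyond the free position the image of the
    part already built is small, so it cannot cancel the image of the next hump.\<close>
  define P where "P = (\<lambda>(j::nat) (s::(nat \<Rightarrow> complex) \<times> nat). (\<forall>k\<ge>snd s. fst s k = 0) \<and> 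
     (\<Sum>k<snd s. wt p (fst s) k) \<le> (\<Sum>i<j. (1/2)^i) \<and>
     (\<forall>M. sum (wt p (conv c (fst s))) {snd s..<M} \<le> 1))"
  have "\<exists>f. \<forall>n. P n (f n) \<and> Q n (f n) (f (Suc n))"
  proof (rule dependent_nat_choice)
    have "conv c (\<lambda>_. 0) = (\<lambda>_. 0)" by (auto simp: conv_def)
    thus "\<exists>s. P 0 s" using p by (intro exI[of _ "((\<lambda>_. 0), 0)"]) (simp add: P_def wt_def)
  next
    fix s j assume Ps: "P j s"
    define u N where "u = fst s" and "N = snd s"
    define u' where "u' = (\<lambda>k. u k + scaled_shift p N (B j) k)"
    have u: "u k = 0" if "k \<ge> N" for k using Ps that by (simp add: P_def u_def N_def)
    have u'0: "u' k = 0" if "k \<ge> N + L j" for k using that u B[of j "k - N"] by (simp add: u'_def scaled_shift_def)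
    have "summable (wt p u')"
      by (rule summable_finite[of "{..<N + L j}"]) (use u'0 p in \<open>auto simp: wt_def not_less\<close>)
    hence "summable (wt p (conv c u'))" using c by (simp add: lp_mult_def)
    \<comment> \<open>The mapping property, applied to the finitely supported sequence reached so
      far, tells how far to move before placing the next hump.\<close>
    then obtain N0 where N0: "\<And>N M. N \<ge> N0 \<Longrightarrow> sum (wt p (conv c u')) {N..<M} \<le> 1"
      using summable_tail_le[of "wt p (conv c u')"] by auto
    define N' where "N' = max N0 (N + L j)"
    have N': "N + L j \<le> N'" "N0 \<le> N'" by (auto simp: N'_def)
    have "(\<Sum>k<N'. wt p u' k) = (\<Sum>k<N + L j. wt p u' k)"
      by (rule sum.mono_neutral_right) (use N' u'0 p in \<open>auto simp: wt_def not_less\<close>)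
    also have "\<dots> = (\<Sum>k<N. wt p u' k) + (\<Sum>k=N..<N + L j. wt p u' k)"
      using sum.atLeastLessThan_concat[of 0 N "N + L j" "wt p u'"] by (simp add: lessThan_atLeast0)
    also have "(\<Sum>k<N. wt p u' k) = (\<Sum>k<N. wt p u k)"
      by (intro sum.cong) (auto simp: wt_def u'_def scaled_shift_def)
    also have "(\<Sum>k=N..<N + L j. wt p u' k) = (\<Sum>k<L j. wt p (B j) k)"
      unfolding sum_shift_interval
    proof (rule sum.cong)
      fix k
      have "wt p u' (k + N) = wt p (scaled_shift p N (B j)) (k + N)" using u by (simp add: wt_def u'_def)
      thus "wt p u' (k + N) = wt p (B j) k" by (simp add: wt_scaled_shift[OF p])
    qed simp
    also have "(\<Sum>k<N. wt p u k) + (\<Sum>k<L j. wt p (B j) k) \<le> (\<Sum>i<j. (1/2)^i) + (1/2)^j"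
      using Ps small[of j] by (intro add_mono) (auto simp: P_def u_def N_def)
    finally have "(\<Sum>k<N'. wt p u' k) \<le> (\<Sum>i<Suc j. (1/2)^i)" by simp
    hence "P (Suc j) (u', N') \<and> Q j s (u', N')"
      using N' N0 u'0 by (auto simp: P_def Q_def u'_def N_def u_def)
    thus "\<exists>s'. P (Suc j) s' \<and> Q j s s'" by blast
  qed
  then obtain f where f: "\<And>n. P n (f n)" "\<And>n. Q n (f n) (f (Suc n))" by blast
  define u N where "u = (\<lambda>n. fst (f n))" and "N = (\<lambda>n. snd (f n))"
  have u_Suc: "u (Suc n) k = u n k + scaled_shift p (N n) (B n) k" for n k
    using f(2)[of n] by (simp add: Q_def u_def N_def)
  have N_Suc: "N n + L n \<le> N (Suc n)" for n using f(2)[of n] by (simp add: Q_def N_def)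
  have N_mono: "N m \<le> N n" if "m \<le> n" for m n
  proof (rule lift_Suc_mono_le[of N, OF _ that])
    show "N n \<le> N (Suc n)" for n using N_Suc[of n] by linarith
  qed
  have N_ge: "n \<le> N n" for n
  proof (induction n)
    case (Suc n) thus ?case using N_Suc[of n] L[of n] by linarith
  qed simp
  have stable: "u n k = u m k" if "m \<le> n" "k < N m" for m n k
    using that(1)
  proof (induction n rule: dec_induct)
    case (step n)
    have "k < N n" using N_mono[OF step(1)] that by linarith
    thus ?case using step u_Suc[of n k] by (simp add: scaled_shift_def)
  qed simp
  define b where "b = (\<lambda>k. u (Suc k) k)"
  have b: "b k = u m k" if "k < N m" for m k
  proof -
    have "k < N (Suc k)" using N_ge[of "Suc k"] by linarith
    thus ?thesis using stable[of m "Suc k" k] stable[of "Suc k" m k] that unfolding b_def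
      by (metis nat_le_linear)
  qed
  have "summable (wt p b)"
  proof (rule summableI_nonneg_bounded[where x=2])
    fix n
    have "(\<Sum>k<n. wt p b k) \<le> (\<Sum>k<N n. wt p b k)" using N_ge[of n] by (intro sum_mono2) auto
    also have "\<dots> = (\<Sum>k<N n. wt p (u n) k)" by (intro sum.cong) (auto simp: wt_def b)
    also have "\<dots> \<le> (\<Sum>i<n. (1/2)^i)" using f(1)[of n] by (simp add: P_def u_def N_def)
    also have "\<dots> = 2 * (1 - (1/2)^n)" by (subst sum_gp_strict) (simp add: field_simps)
    also have "\<dots> \<le> 2" by simp
    finally show "(\<Sum>k<n. wt p b k) \<le> 2" .
  qed simp
  hence sc: "summable (wt p (conv c b))" using c by (simp add: lp_mult_def)
  define D where "D = suminf (wt p (conv c b))"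
  \<comment> \<open>By causality the image of b on window j is that of hump j plus that of the
    earlier part; later humps begin beyond the window. Hence the image of the hump, of weight at
    least j + 1, is bounded independently of j.\<close>
  have bound: "real j + 1 \<le> 2 powr p * (D + 1)" for j
  proof -
    have "real j + 1 \<le> (\<Sum>k<L j. wt p (conv c (B j)) k)" by (rule large)
    also have "\<dots> = (\<Sum>k=N j..<N j + L j. wt p (conv c (scaled_shift p (N j) (B j))) k)"
      unfolding sum_shift_interval
    proof (rule sum.cong)
      fix k
      have "wt p (conv c (scaled_shift p (N j) (B j))) (k + N j) = wt p (scaled_shift p (N j) (conv c (B j))) (k + N j)"
        unfolding wt_def conv_scaled_shift by (simp add: scaled_shift_def)
      thus "wt p (conv c (B j)) k = wt p (conv c (scaled_shift p (N j) (B j))) (k + N j)"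
        by (simp add: wt_scaled_shift[OF p])
    qed simp
    also have "\<dots> \<le> (\<Sum>k=N j..<N j + L j. 2 powr p * (wt p (conv c b) k + wt p (conv c (u j)) k))"
    proof (rule sum_mono)
      fix k assume "k \<in> {N j..<N j + L j}"
      hence "k < N (Suc j)" using N_Suc[of j] by simp
      hence "conv c b k = conv c (u (Suc j)) k"
        by (intro conv_cong b) auto
      also have "\<dots> = conv c (u j) k + conv c (scaled_shift p (N j) (B j)) k"
        unfolding conv_add[symmetric] by (intro conv_cong) (simp add: u_Suc)
      finally have "conv c (scaled_shift p (N j) (B j)) k = conv c b k + (- 1) * conv c (u j) k" by simp
      hence "wt p (conv c (scaled_shift p (N j) (B j))) k = wt p (\<lambda>k. conv c b k + (-1) * conv c (u j) k) k"
        by (simp add: wt_def)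
      also have "\<dots> \<le> 2 powr p * (wt p (conv c b) k + wt p (\<lambda>k. (-1) * conv c (u j) k) k)"
        using p by (intro wt_add_le) simp
      finally show "wt p (conv c (scaled_shift p (N j) (B j))) k \<le> 2 powr p * (wt p (conv c b) k + wt p (conv c (u j)) k)"
        unfolding wt_cmult by simp
    qed
    also have "\<dots> = 2 powr p * ((\<Sum>k=N j..<N j + L j. wt p (conv c b) k) + (\<Sum>k=N j..<N j + L j. wt p (conv c (u j)) k))"
      by (simp only: sum_distrib_left[symmetric] sum.distrib)
    also have "\<dots> \<le> 2 powr p * (D + 1)"
    proof (intro mult_left_mono add_mono)
      show "(\<Sum>k=N j..<N j + L j. wt p (conv c b) k) \<le> D"
        unfolding D_def by (rule sum_le_suminf[OF sc]) auto
      show "(\<Sum>k=N j..<N j + L j. wt p (conv c (u j)) k) \<le> 1"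
        using f(1)[of j] by (simp add: P_def u_def N_def)
    qed simp
    finally show ?thesis .
  qed
  obtain j :: nat where "2 powr p * (D + 1) < real j" using reals_Archimedean2 by blast
  thus False using bound[of j] by linarith
qed

section \<open>Power series\<close>

abbreviation unit_seq :: "nat \<Rightarrow> complex" where
  "unit_seq k \<equiv> (if k = 0 then 1 else 0)"

lemma powser_coeffs_unique:
  fixes a b :: "nat \<Rightarrow> complex"
  assumes r: "r > 0"
    and a: "\<And>z. norm z < r \<Longrightarrow> (\<lambda>k. a k * z^k) sums u z"
    and b: "\<And>z. norm z < r \<Longrightarrow> (\<lambda>k. b k * z^k) sums u z"
  shows "a = b"
proof -
  have rad: "conv_radius c \<ge> r" if "\<And>z. norm z < r \<Longrightarrow> (\<lambda>k. c k * z^k) sums u z" for c :: "nat \<Rightarrow> complex"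
  proof (rule conv_radius_geI_ex)
    fix s :: real assume "s > 0" "ereal s < ereal r"
    thus "\<exists>z. norm z = s \<and> summable (\<lambda>k. c k * z^k)"
      using that[of "of_real s"] by (intro exI[of _ "of_real s"]) (auto simp: sums_iff)
  qed
  have eval: "eval_fps (Abs_fps c) z = u z" if "\<And>z. norm z < r \<Longrightarrow> (\<lambda>k. c k * z^k) sums u z" "norm z < r"
    for c :: "nat \<Rightarrow> complex" and z
    using that(1)[OF that(2)] by (simp add: eval_fps_def sums_iff)
  have "Abs_fps a = Abs_fps b"
  proof (rule eval_fps_eqD)
    show "fps_conv_radius (Abs_fps a) > 0" "fps_conv_radius (Abs_fps b) > 0"
      using rad[of a, OF a] rad[of b, OF b] r unfolding fps_conv_radius_def
      by (auto intro: less_le_trans[of 0 "ereal r"])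
    have "eventually (\<lambda>z. z \<in> ball 0 r) (nhds (0::complex))"
      using r by (intro eventually_nhds_in_open) auto
    thus "eventually (\<lambda>z. eval_fps (Abs_fps a) z = eval_fps (Abs_fps b) z) (nhds 0)"
      by eventually_elim (use eval[of a, OF a] eval[of b, OF b] in auto)
  qed
  thus ?thesis by (auto simp: fps_eq_iff)
qed

lemma wt_powr: "p > 0 \<Longrightarrow> (cmod (a k) * (2 powr (-1 / p)) ^ k) powr p = wt p a k"
proof -
  assume p: "p > 0"
  have "((2 powr (-1 / p)) ^ k) powr p = ((2 powr (-1 / p)) powr p) ^ k"
    by (simp add: powr_powr mult_ac flip: powr_realpow)
  also have "(2 powr (-1 / p)) powr p = 2 powr (-1)" unfolding powr_powr using p by simp
  also have "2 powr (-1) = (1 / 2 :: real)" by (simp add: powr_minus_divide)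
  finally show ?thesis by (simp add: powr_mult wt_def power_one_over)
qed

lemma Ap_plus_iff:
  assumes "p > 0"
  shows "u \<in> Ap_plus p (2 powr (-1 / p)) \<longleftrightarrow>
    (\<exists>a. (\<forall>z. cmod z < 2 powr (-1 / p) \<longrightarrow> (\<lambda>k. a k * z^k) sums u z) \<and> summable (wt p a))"
  unfolding Ap_plus_def wt_powr[OF assms] by (auto simp: ball_def)

text \<open>Boundedness of |a_k| R^k at R = 2^(-1/p) gives comparison with a geometric series at
  some radius between |z| and R.\<close>

lemma summable_norm_powser:
  assumes p: "p > 0" and a: "summable (wt p a)" and z: "cmod z < 2 powr (-1 / p)"
  shows "summable (\<lambda>k. norm (a k * z^k))"
proof -
  define R :: real where "R = 2 powr (-1 / p)"
  have R: "R > 0" by (simp add: R_def)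
  have "Bseq (wt p a)"
    using a summable_LIMSEQ_zero convergent_imp_Bseq convergentI by blast
  then obtain M where M: "M > 0" "\<And>k. wt p a k \<le> M" unfolding Bseq_def by auto
  obtain y where y: "cmod z < y" "y < R" using z dense unfolding R_def by blast
  hence y0: "0 < y" using norm_ge_zero[of z] by linarith
  have "summable (\<lambda>k. norm (a k * (of_real y)^k))"
  proof (rule summable_comparison_test)
    show "\<exists>N. \<forall>n\<ge>N. norm (norm (a n * of_real y^n)) \<le> M powr (1 / p) * (y / R)^n"
    proof (intro exI[of _ 0] allI impI)
      fix k
      have "(cmod (a k) * R^k) powr p \<le> M" using wt_powr[OF p, of a k] M by (simp add: R_def)
      hence "((cmod (a k) * R^k) powr p) powr (1 / p) \<le> M powr (1 / p)" using p by (intro powr_mono2) auto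
      hence "cmod (a k) * R^k \<le> M powr (1 / p)" using p R by (simp add: powr_powr)
      hence "cmod (a k) * R^k * (y / R)^k \<le> M powr (1 / p) * (y / R)^k"
        using R y y0 by (intro mult_right_mono) auto
      thus "norm (norm (a k * of_real y^k)) \<le> M powr (1 / p) * (y / R)^k"
        using R y y0 by (simp add: norm_mult norm_power power_divide abs_mult flip: of_real_power)
    qed
    show "summable (\<lambda>n. M powr (1 / p) * (y / R)^n)"
      using R y y0 by (intro summable_mult summable_geometric) auto
  qed
  hence "summable (\<lambda>k. a k * (of_real y)^k)" by (rule summable_norm_cancel)
  moreover have "cmod z < norm (of_real y :: complex)" using y y0 by simp
  ultimately show ?thesis by (rule powser_insidea)
qed

lemma powser_conv_sums:
  assumes "p > 0" "summable (wt p a)" "summable (wt p b)" "cmod z < 2 powr (-1 / p)"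
    and "(\<lambda>k. a k * z^k) sums u" "(\<lambda>k. b k * z^k) sums v"
  shows "(\<lambda>k. conv a b k * z^k) sums (u * v)"
proof -
  have "(\<lambda>k. \<Sum>i\<le>k. (a i * z^i) * (b (k - i) * z^(k - i))) sums ((\<Sum>k. a k * z^k) * (\<Sum>k. b k * z^k))"
    using assms by (intro Cauchy_product_sums summable_norm_powser[of p])
  moreover have "(\<Sum>i\<le>k. (a i * z^i) * (b (k - i) * z^(k - i))) = conv a b k * z^k" for k
    unfolding conv_def sum_distrib_right
  proof (rule sum.cong)
    fix i assume "i \<in> {..k}"
    hence "z^k = z^i * z^(k - i)" by (simp flip: power_add)
    thus "(a i * z^i) * (b (k - i) * z^(k - i)) = a i * b (k - i) * z^k" by (simp add: mult_ac)
  qed simp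
  ultimately show ?thesis using assms by (simp add: sums_iff)
qed

lemma unit_seq_sums: "(\<lambda>k. unit_seq k * z^k) sums (1::complex)"
  using sums_If_finite_set[of "{0}" "\<lambda>k. z^k"] by (simp add: if_distrib[of "\<lambda>x. x * _"] cong: if_cong)

lemma wt_unit_summable:
  assumes "p > 0"
  shows "summable (wt p (\<lambda>k. unit_seq k))"
  by (rule summable_finite[of "{0}"]) (use assms in \<open>auto simp: wt_def\<close>)

text \<open>Every weighted summable b is the coefficient sequence of a test function v; uniqueness
  of coefficients identifies those of the product with the Cauchy product.\<close>

lemma Mp_plus_coeffs:
  assumes p: "p > 0" and M: "u \<in> Mp_plus p (2 powr (-1 / p))"
  shows "\<exists>a. (\<forall>z. cmod z < 2 powr (-1 / p) \<longrightarrow> (\<lambda>k. a k * z^k) sums u z) \<and> summable (wt p a) \<and> lp_mult p a"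
proof -
  let ?R = "2 powr (-1 / p)"
  have "u \<in> Ap_plus p ?R" using M by (simp add: Mp_plus_def)
  then obtain a where a: "\<And>z. cmod z < ?R \<Longrightarrow> (\<lambda>k. a k * z^k) sums u z" "summable (wt p a)"
    unfolding Ap_plus_iff[OF p] by blast
  have "summable (wt p (conv a b))" if b: "summable (wt p b)" for b
  proof -
    define v where "v = (\<lambda>z. \<Sum>k. b k * z^k)"
    have v: "(\<lambda>k. b k * z^k) sums v z" if "cmod z < ?R" for z
      using summable_norm_cancel[OF summable_norm_powser[OF p b that]] by (simp add: v_def sums_iff)
    have "v \<in> Ap_plus p ?R" using v b unfolding Ap_plus_iff[OF p] by blast
    hence "(\<lambda>z. u z * v z) \<in> Ap_plus p ?R" using M by (simp add: Mp_plus_def)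
    then obtain d where d: "\<And>z. cmod z < ?R \<Longrightarrow> (\<lambda>k. d k * z^k) sums (u z * v z)" "summable (wt p d)"
      unfolding Ap_plus_iff[OF p] by blast
    have "conv a b = d"
      by (rule powser_coeffs_unique[of ?R _ "\<lambda>z. u z * v z"]) (use a v b d p in \<open>auto intro!: powser_conv_sums\<close>)
    thus ?thesis using d by simp
  qed
  thus ?thesis using a by (auto simp: lp_mult_def)
qed

lemma Mp_plusI:
  assumes p: "p > 0" and a: "\<And>z. cmod z < 2 powr (-1 / p) \<Longrightarrow> (\<lambda>k. a k * z^k) sums u z"
    and "summable (wt p a)" "lp_mult p a"
  shows "u \<in> Mp_plus p (2 powr (-1 / p))"
  unfolding Mp_plus_def
proof (intro CollectI conjI ballI)
  show "u \<in> Ap_plus p (2 powr (-1 / p))" using assms unfolding Ap_plus_iff[OF p] by blast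
  fix v assume "v \<in> Ap_plus p (2 powr (-1 / p))"
  then obtain b where "\<And>z. cmod z < 2 powr (-1 / p) \<Longrightarrow> (\<lambda>k. b k * z^k) sums v z" "summable (wt p b)"
    unfolding Ap_plus_iff[OF p] by blast
  thus "(\<lambda>z. u z * v z) \<in> Ap_plus p (2 powr (-1 / p))"
    unfolding Ap_plus_iff[OF p] using assms
    by (intro exI[of _ "conv a b"] conjI allI impI powser_conv_sums) (auto simp: lp_mult_def)
qed

text \<open>The growth hypothesis rules out that \<open>symbol c\<close> is the junk value of a divergent
  \<open>suminf\<close> arbitrarily close to \<open>0\<close>.\<close>

lemma symbol_condition_iff:
  assumes p: "p \<ge> 2" and growth: "\<And>k. cmod (c k) \<le> D * 2^k"
  shows "((\<forall>z\<in>ball 0 (2 powr (-1 / p)). symbol c z \<noteq> 0)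
           \<and> symbol c \<in> Mp_plus p (2 powr (-1 / p)) \<and> (\<lambda>z. 1 / symbol c z) \<in> Mp_plus p (2 powr (-1 / p)))
    \<longleftrightarrow> summable (wt p c) \<and> lp_mult p c \<and> (\<exists>e. summable (wt p e) \<and> lp_mult p e \<and> conv c e = (\<lambda>k. unit_seq k))"
    (is "?L \<longleftrightarrow> ?R")
proof
  let ?r = "2 powr (-1 / p)"
  have p0: "p > 0" using p by simp
  assume L: ?L
  from L have nz: "\<And>z. cmod z < ?r \<Longrightarrow> symbol c z \<noteq> 0"
    and M: "symbol c \<in> Mp_plus p ?r" "(\<lambda>z. 1 / symbol c z) \<in> Mp_plus p ?r" by (simp_all add: ball_def)
  obtain a where a: "\<And>z. cmod z < ?r \<Longrightarrow> (\<lambda>k. a k * z^k) sums symbol c z" "summable (wt p a)" "lp_mult p a"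
    using Mp_plus_coeffs[OF p0 M(1)] by auto
  obtain e where e: "\<And>z. cmod z < ?r \<Longrightarrow> (\<lambda>k. e k * z^k) sums (1 / symbol c z)" "summable (wt p e)" "lp_mult p e"
    using Mp_plus_coeffs[OF p0 M(2)] by auto
  \<comment> \<open>Membership provides some coefficients a for the function
    \<open>symbol c\<close>. For |z| < 1/2 the growth hypothesis makes the series of c itself
    converge to that function, and a small disc decides the coefficients.\<close>
  have "a = c"
  proof (rule powser_coeffs_unique[of "min ?r (1/2)" _ "symbol c"])
    fix z :: complex assume z: "cmod z < min ?r (1/2)"
    show "(\<lambda>k. a k * z^k) sums symbol c z" using a z by simp
    have "summable (\<lambda>k. c k * z^k)"
    proof (rule summable_comparison_test)
      show "\<exists>N. \<forall>n\<ge>N. norm (c n * z^n) \<le> D * (2 * cmod z)^n"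
      proof (intro exI[of _ 0] allI impI)
        fix n
        show "norm (c n * z^n) \<le> D * (2 * cmod z)^n"
          using mult_right_mono[OF growth[of n], of "cmod z ^ n"] by (simp add: norm_mult norm_power power_mult_distrib mult.assoc)
      qed
      show "summable (\<lambda>n. D * (2 * cmod z)^n)" using z by (intro summable_mult summable_geometric) auto
    qed
    thus "(\<lambda>k. c k * z^k) sums symbol c z" by (simp add: symbol_def sums_iff)
  qed simp
  moreover have "conv c e = (\<lambda>k. unit_seq k)"
  proof (rule powser_coeffs_unique[of ?r _ "\<lambda>_. 1"])
    fix z :: complex assume z: "cmod z < ?r"
    have "(\<lambda>k. conv c e k * z^k) sums (symbol c z * (1 / symbol c z))"
      using z a e p0 \<open>a = c\<close> by (intro powser_conv_sums) auto
    \<comment> \<open>Nonvanishing enters here: since \<open>1 / 0 = 0\<close>, the product would be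
      0 at a zero of the symbol.\<close>
    moreover have "symbol c z \<noteq> 0" using nz z by simp
    ultimately show "(\<lambda>k. conv c e k * z^k) sums 1" by simp
    show "(\<lambda>k. unit_seq k * z^k) sums 1" by (rule unit_seq_sums)
  qed simp
  ultimately show ?R using a e by blast
next
  let ?r = "2 powr (-1 / p)"
  have p0: "p > 0" using p by simp
  assume ?R
  then obtain e where c: "summable (wt p c)" "lp_mult p c" and e: "summable (wt p e)" "lp_mult p e"
    and ce: "conv c e = (\<lambda>k. unit_seq k)" by blast
  have sc: "(\<lambda>k. c k * z^k) sums symbol c z" if "cmod z < ?r" for z
    using summable_norm_cancel[OF summable_norm_powser[OF p0 c(1) that]] by (simp add: symbol_def sums_iff)
  have se: "(\<lambda>k. e k * z^k) sums (\<Sum>k. e k * z^k)" if "cmod z < ?r" for z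
    using summable_norm_cancel[OF summable_norm_powser[OF p0 e(1) that]] by (simp add: sums_iff)
  have prod: "symbol c z * (\<Sum>k. e k * z^k) = 1" if "cmod z < ?r" for z
    using powser_conv_sums[OF p0 c(1) e(1) that sc[OF that] se[OF that]] unit_seq_sums[of z]
    unfolding ce by (metis sums_unique2)
  have nz: "symbol c z \<noteq> 0" if "cmod z < ?r" for z using prod[OF that] by auto
  have inv: "(\<lambda>k. e k * z^k) sums (1 / symbol c z)" if "cmod z < ?r" for z
  proof -
    have "(\<Sum>k. e k * z^k) = 1 / symbol c z"
      by (rule nonzero_mult_div_cancel_left[OF nz[OF that], THEN subst]) (simp add: prod[OF that])
    thus ?thesis using se[OF that] by simp
  qed
  show ?L
    using nz Mp_plusI[OF p0 sc c] Mp_plusI[OF p0 inv e] by (auto simp: ball_def)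
qed

section \<open>Dyadic cells and Haar functions\<close>

text \<open>The index 2^K + j of the level-K cell containing t. Cells are closed on the right, hence
  a ceiling minus 1 instead of a floor.\<close>

definition node :: "nat \<Rightarrow> real \<Rightarrow> nat" where
  "node K t = nat \<lceil>2^K * (1 + t)\<rceil> - 1"

abbreviation MI :: "real measure" where
  "MI \<equiv> lebesgue_on unitI"

lemma node_eq_iff:
  assumes "t \<in> unitI"
  shows "node K t = n \<longleftrightarrow> real n < 2^K * (1 + t) \<and> 2^K * (1 + t) \<le> real n + 1"
proof -
  have "2^K * (1 + t) > 0" using assms by (simp add: unitI_def)
  hence "\<lceil>2^K * (1 + t)\<rceil> \<ge> 1" by linarith
  hence "node K t = n \<longleftrightarrow> \<lceil>2^K * (1 + t)\<rceil> = int n + 1" unfolding node_def by linarith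
  also have "\<dots> \<longleftrightarrow> real n < 2^K * (1 + t) \<and> 2^K * (1 + t) \<le> real n + 1"
    by (simp add: ceiling_eq_iff)
  finally show ?thesis .
qed

lemma node_bounds:
  assumes "t \<in> unitI"
  shows "real (node K t) < 2^K * (1 + t)" "2^K * (1 + t) \<le> real (node K t) + 1"
  using node_eq_iff[OF assms, of K "node K t"] by auto

lemma node_ge: "t \<in> unitI \<Longrightarrow> 2^K \<le> node K t"
proof -
  assume t: "t \<in> unitI"
  hence "(2::real)^K * 1 < 2^K * (1 + t)" by (intro mult_strict_left_mono) (auto simp: unitI_def)
  hence "(2::real)^K < real (node K t) + 1" using node_bounds(2)[OF t, of K] by linarith
  hence "real (2^K) < real (node K t + 1)" by simp
  hence "2^K < node K t + 1" by (simp only: of_nat_less_iff)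
  thus ?thesis by simp
qed

lemma node_less: "t \<in> unitI \<Longrightarrow> node K t < 2^Suc K"
proof -
  assume t: "t \<in> unitI"
  hence "(2::real)^K * (1 + t) \<le> 2^K * 2" by (intro mult_left_mono) (auto simp: unitI_def)
  hence "real (node K t) < 2^K * 2" using node_bounds(1)[OF t, of K] by linarith
  hence "real (node K t) < real (2^Suc K)" by simp
  thus ?thesis by (simp only: of_nat_less_iff)
qed

lemma node_pos: "t \<in> unitI \<Longrightarrow> 1 \<le> node K t"
  using node_ge[of t K] le_trans one_le_power[of "2::nat" K] by (metis one_le_numeral)

lemma floor_log_level: "2^K \<le> n \<Longrightarrow> n < 2^Suc K \<Longrightarrow> floor_log n = K"
  by (rule floor_log_eqI) (auto intro: less_le_trans[of 0 "2^K"])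

lemma floor_log_node: "t \<in> unitI \<Longrightarrow> floor_log (node K t) = K"
  using node_ge node_less by (intro floor_log_level) auto

lemma level_bounds: "1 \<le> n \<Longrightarrow> 2^floor_log n \<le> n \<and> n < 2^Suc (floor_log n)"
  using floor_log_exp2_le[of n] floor_log_exp2_gt[of n] by auto

lemma node_0 [simp]: "t \<in> unitI \<Longrightarrow> node 0 t = Suc 0"
  using node_ge[of t 0] node_less[of t 0] by simp

lemma node_Suc_cases:
  assumes "t \<in> unitI"
  shows "node (Suc K) t = 2 * node K t \<or> node (Suc K) t = Suc (2 * node K t)"
proof -
  let ?n = "node K t"
  have "2^Suc K * (1 + t) = 2 * (2^K * (1 + t))" by simp
  thus ?thesis using node_bounds[OF assms, of K]
    unfolding node_eq_iff[OF assms] by (cases "2 * (2^K * (1 + t)) \<le> 2 * real ?n + 1") auto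
qed

lemma node_Suc_div: "t \<in> unitI \<Longrightarrow> node (Suc K) t div 2 = node K t"
  using node_Suc_cases[of t K] by auto

lemma node_cond_iff:
  assumes "1 \<le> n" "t \<in> unitI"
  shows "(real (n - 2^floor_log n) / 2^floor_log n < t \<and> t \<le> (real (n - 2^floor_log n) + 1) / 2^floor_log n)
     \<longleftrightarrow> node (floor_log n) t = n"
  using level_bounds[OF assms(1)] unfolding node_eq_iff[OF assms(2)]
  by (auto simp: field_simps of_nat_diff)

lemma dil_node:
  assumes "1 \<le> n" "t \<in> unitI"
  shows "dil f n t = (if node (floor_log n) t = n
    then f (2^floor_log n * t - real (n - 2^floor_log n)) else 0)"
  using node_cond_iff[OF assms] by (simp add: dil_def Let_def)

lemma dil_arg:
  assumes "1 \<le> n" "t \<in> unitI" "node (floor_log n) t = n"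
  shows "2^floor_log n * t - real (n - 2^floor_log n) \<in> unitI"
  using node_eq_iff[OF assms(2), of "floor_log n" n] level_bounds[OF assms(1)] assms(3)
  by (auto simp: unitI_def of_nat_diff field_simps)

lemma haar_node:
  assumes "1 \<le> n" "t \<in> unitI"
  shows "haar n t = (if node (Suc (floor_log n)) t = 2 * n then 1
    else if node (Suc (floor_log n)) t = Suc (2 * n) then -1 else 0)"
proof (cases "node (floor_log n) t = n")
  case True
  let ?k = "floor_log n"
  have "2^?k \<le> n" using level_bounds assms by blast
  hence "2^?k * t - real (n - 2^?k) \<le> 1/2 \<longleftrightarrow> 2^Suc ?k * (1 + t) \<le> real (2 * n) + 1"
    by (auto simp: of_nat_diff field_simps)
  moreover have "real (2 * n) < 2^Suc ?k * (1 + t)"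
    using node_bounds(1)[OF assms(2), of ?k] True by simp
  ultimately have "2^?k * t - real (n - 2^?k) \<le> 1/2 \<longleftrightarrow> node (Suc ?k) t = 2 * n"
    unfolding node_eq_iff[OF assms(2)] by blast
  thus ?thesis using dil_arg[OF assms True] node_Suc_cases[OF assms(2), of ?k] True
    by (auto simp: haar_def dil_node[OF assms] haar0_def unitI_def)
next
  case False
  hence "node (Suc (floor_log n)) t \<noteq> 2 * n" "node (Suc (floor_log n)) t \<noteq> Suc (2 * n)"
    using node_Suc_div[OF assms(2), of "floor_log n"] by auto
  thus ?thesis using False by (simp add: haar_def dil_node[OF assms])
qed

text \<open>Of all Haar functions of level K only the one at \<open>node K t\<close> is nonzero at
  t, and its sign tells which child contains t; this is the recursion of \<open>val\<close>.\<close>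

lemma haar_sum_level:
  assumes "t \<in> unitI"
  shows "(\<Sum>n=1..<2^K. \<xi> n * haar n t) = val \<xi> (node K t)"
proof (induction K)
  case 0
  thus ?case using assms by simp
next
  case (Suc K)
  let ?m = "node K t"
  have "(\<Sum>n=1..<2^Suc K. \<xi> n * haar n t) = (\<Sum>n=1..<2^K. \<xi> n * haar n t) + (\<Sum>n=2^K..<2^Suc K. \<xi> n * haar n t)"
    by (rule sum.atLeastLessThan_concat[symmetric]) auto
  also have "(\<Sum>n=2^K..<2^Suc K. \<xi> n * haar n t) = (\<Sum>n=2^K..<2^Suc K. if n = ?m then \<xi> n * haar n t else 0)"
  proof (rule sum.cong)
    fix n :: nat assume n: "n \<in> {2^K..<2^Suc K}"
    hence "floor_log n = K" "1 \<le> n" using floor_log_level[of K n] le_trans[of 1 "2^K" n] by auto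
    thus "\<xi> n * haar n t = (if n = ?m then \<xi> n * haar n t else 0)"
      using node_Suc_cases[OF assms, of K] haar_node[of n t] assms by auto
  qed simp
  also have "\<dots> = \<xi> ?m * haar ?m t" using node_ge[OF assms] node_less[OF assms] by simp
  finally show ?case
    using node_Suc_cases[OF assms, of K] node_pos[OF assms, of K] haar_node[of ?m t] assms Suc.IH
    by (auto simp: floor_log_node)
qed

lemma haar_sum_finite:
  assumes "finite F" "F \<subseteq> {1..<2^K}" "t \<in> unitI"
  shows "(\<Sum>n\<in>F. a n * haar n t) = val (\<lambda>n. if n \<in> F then a n else 0) (node K t)"
proof -
  have "(\<Sum>n\<in>F. a n * haar n t) = (\<Sum>n\<in>F. (if n \<in> F then a n else 0) * haar n t)" by simp
  also have "\<dots> = (\<Sum>n=1..<2^K. (if n \<in> F then a n else 0) * haar n t)"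
    by (rule sum.mono_neutral_left) (use assms in auto)
  finally show ?thesis unfolding haar_sum_level[OF assms(3)] .
qed

lemma finite_level_bound:
  assumes "finite F" shows "\<exists>K. F \<subseteq> {..<(2::nat)^K}"
proof -
  obtain m where "F \<subseteq> {..<m}" using assms finite_nat_iff_bounded by blast
  moreover have "m < 2^m" by simp
  ultimately show ?thesis by (intro exI[of _ m]) (use less_trans in blast)
qed

section \<open>Measure of cells and integrals of step functions\<close>

lemma unitI_sets [simp]: "unitI \<in> sets lebesgue"
  by (simp add: unitI_def)

lemma space_MI [simp]: "space MI = unitI"
  by simp

lemma finite_measure_MI: "finite_measure MI"
proof (rule finite_measure_lebesgue_on)
  have "emeasure lebesgue unitI = 1" by (simp add: unitI_def)
  thus "unitI \<in> lmeasurable" by (simp add: fmeasurable_def)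
qed

interpretation MI: finite_measure MI
  by (rule finite_measure_MI)

definition level_cell :: "nat \<Rightarrow> nat \<Rightarrow> real set" where
  "level_cell K n = {t \<in> unitI. node K t = n}"

lemma level_cell_Int [simp]: "level_cell K n \<inter> unitI = level_cell K n"
  by (auto simp: level_cell_def)

lemma level_cell_eq:
  assumes "2^K \<le> n" "n < 2^Suc K"
  shows "level_cell K n = {real n / 2^K - 1 <.. (real n + 1) / 2^K - 1}"
proof -
  have n: "real n \<ge> 2^K" "real n + 1 \<le> 2 * 2^K"
  proof -
    have "real (2^K) \<le> real n" using assms by (simp only: of_nat_le_iff)
    thus "real n \<ge> 2^K" by simp
    have "real (n + 1) \<le> real (2^Suc K)" using assms(2) by (simp only: of_nat_le_iff Suc_eq_plus1[symmetric] Suc_le_eq)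
    thus "real n + 1 \<le> 2 * 2^K" by simp
  qed
  have "t \<in> unitI" if "real n / 2^K - 1 < t" "t \<le> (real n + 1) / 2^K - 1" for t
  proof -
    have "real n / 2^K \<ge> 1" "(real n + 1) / 2^K \<le> 2" using n by (auto simp: field_simps)
    hence "0 < t" "t \<le> 1" using that by linarith+
    thus ?thesis by (simp add: unitI_def)
  qed
  moreover have "real n < 2^K * (1 + t) \<and> 2^K * (1 + t) \<le> real n + 1
      \<longleftrightarrow> real n / 2^K - 1 < t \<and> t \<le> (real n + 1) / 2^K - 1" for t
    by (auto simp: field_simps)
  ultimately have "t \<in> unitI \<and> node K t = n \<longleftrightarrow> real n / 2^K - 1 < t \<and> t \<le> (real n + 1) / 2^K - 1" for t
    using node_eq_iff[of t K n] by blast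
  thus ?thesis unfolding level_cell_def by (simp add: set_eq_iff)
qed

lemma level_cell_outside:
  assumes "\<not> (2^K \<le> n \<and> n < 2^Suc K)"
  shows "level_cell K n = {}"
  using assms node_ge node_less by (auto simp: level_cell_def)

lemma level_cell_sets [simp]: "level_cell K n \<in> sets lebesgue"
  by (cases "2^K \<le> n \<and> n < 2^Suc K") (auto simp: level_cell_eq level_cell_outside simp del: power_Suc)

lemma level_cell_sets_MI [simp]: "level_cell K n \<in> sets MI"
  using level_cell_sets by (auto simp: sets_restrict_space_iff level_cell_def)

lemma measure_level_cell:
  assumes "2^K \<le> n" "n < 2^Suc K"
  shows "measure MI (level_cell K n) = 1 / 2^K"
proof -
  have "measure MI (level_cell K n) = measure lebesgue (level_cell K n)"
    by (rule measure_restrict_space) (auto simp: level_cell_def)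
  also have "\<dots> = 1 / 2^K"
    unfolding level_cell_eq[OF assms] by (simp add: field_simps)
  finally show ?thesis .
qed

lemma node_measurable [measurable]: "node K \<in> MI \<rightarrow>\<^sub>M count_space UNIV"
proof (rule measurable_count_space_eq2_countable[THEN iffD2])
  have "node K -` {n} \<inter> space MI = level_cell K n" for n by (auto simp: level_cell_def)
  thus "node K \<in> space MI \<rightarrow> UNIV \<and> (\<forall>a\<in>UNIV. node K -` {a} \<inter> space MI \<in> sets MI)" by simp
qed

lemma node_sum_indicator:
  fixes \<phi> :: "nat \<Rightarrow> 'a::real_vector"
  assumes "t \<in> unitI"
  shows "(\<Sum>n=2^K..<2^Suc K. indicator (level_cell K n) t *\<^sub>R \<phi> n) = \<phi> (node K t)"
proof -
  have "(\<Sum>n=2^K..<2^Suc K. indicator (level_cell K n) t *\<^sub>R \<phi> n) = (\<Sum>n=2^K..<2^Suc K. if n = node K t then \<phi> n else 0)"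
    using assms by (intro sum.cong) (auto simp: level_cell_def indicator_def)
  also have "\<dots> = \<phi> (node K t)" using node_ge[OF assms] node_less[OF assms] by simp
  finally show ?thesis .
qed

lemma integral_step_times:
  fixes x :: "real \<Rightarrow> complex"
  assumes x: "integrable MI x"
  shows "integrable MI (\<lambda>t. \<phi> (node K t) * x t)"
    and "(\<integral>t. \<phi> (node K t) * x t \<partial>MI) = (\<Sum>n=2^K..<2^Suc K. \<phi> n * (LINT t:level_cell K n|MI. x t))"
proof -
  have eq: "\<phi> (node K t) * x t = (\<Sum>n=2^K..<2^Suc K. \<phi> n * (indicator (level_cell K n) t *\<^sub>R x t))"
    if "t \<in> space MI" for t
  proof -
    have "\<phi> (node K t) * x t = (\<Sum>n=2^K..<2^Suc K. indicator (level_cell K n) t *\<^sub>R \<phi> n) * x t"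
      using that by (simp only: node_sum_indicator space_MI)
    also have "\<dots> = (\<Sum>n=2^K..<2^Suc K. \<phi> n * (indicator (level_cell K n) t *\<^sub>R x t))"
      unfolding sum_distrib_right by (intro sum.cong) (auto simp: scaleR_conv_of_real mult_ac)
    finally show ?thesis .
  qed
  have int: "integrable MI (\<lambda>t. \<phi> n * (indicator (level_cell K n) t *\<^sub>R x t))" for n
    by (intro integrable_mult_right integrable_mult_indicator x) simp
  show "integrable MI (\<lambda>t. \<phi> (node K t) * x t)"
    by (subst Bochner_Integration.integrable_cong[OF refl eq]) (assumption, intro Bochner_Integration.integrable_sum int)
  have "(\<integral>t. \<phi> (node K t) * x t \<partial>MI) = (\<integral>t. (\<Sum>n=2^K..<2^Suc K. \<phi> n * (indicator (level_cell K n) t *\<^sub>R x t)) \<partial>MI)"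
    by (rule Bochner_Integration.integral_cong[OF refl eq])
  also have "\<dots> = (\<Sum>n=2^K..<2^Suc K. \<integral>t. \<phi> n * (indicator (level_cell K n) t *\<^sub>R x t) \<partial>MI)"
    by (rule Bochner_Integration.integral_sum) (rule int)
  finally show "(\<integral>t. \<phi> (node K t) * x t \<partial>MI) = (\<Sum>n=2^K..<2^Suc K. \<phi> n * (LINT t:level_cell K n|MI. x t))"
    by (simp only: set_lebesgue_integral_def integral_mult_right_zero)
qed

lemma integral_step:
  fixes \<phi> :: "nat \<Rightarrow> real"
  shows "integrable MI (\<lambda>t. \<phi> (node K t))" and "(\<integral>t. \<phi> (node K t) \<partial>MI) = avg K \<phi>"
proof -
  have eq: "\<phi> (node K t) = (\<Sum>n=2^K..<2^Suc K. indicator (level_cell K n) t *\<^sub>R \<phi> n)"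
    if "t \<in> space MI" for t
    using that by (simp only: node_sum_indicator space_MI)
  have int: "integrable MI (\<lambda>t. indicator (level_cell K n) t *\<^sub>R \<phi> n)" for n
    by (intro integrable_mult_indicator MI.integrable_const) simp
  show "integrable MI (\<lambda>t. \<phi> (node K t))"
    by (subst Bochner_Integration.integrable_cong[OF refl eq]) (assumption, intro Bochner_Integration.integrable_sum int)
  have "(\<integral>t. \<phi> (node K t) \<partial>MI) = (\<integral>t. (\<Sum>n=2^K..<2^Suc K. indicator (level_cell K n) t *\<^sub>R \<phi> n) \<partial>MI)"
    by (rule Bochner_Integration.integral_cong[OF refl eq])
  also have "\<dots> = (\<Sum>n=2^K..<2^Suc K. \<integral>t. indicator (level_cell K n) t *\<^sub>R \<phi> n \<partial>MI)"
    by (rule Bochner_Integration.integral_sum) (rule int)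
  also have "\<dots> = (\<Sum>n=2^K..<2^Suc K. measure MI (level_cell K n) * \<phi> n)"
    by simp
  also have "\<dots> = (\<Sum>n=2^K..<2^Suc K. \<phi> n / 2^K)"
    by (intro sum.cong) (auto simp: measure_level_cell)
  finally show "(\<integral>t. \<phi> (node K t) \<partial>MI) = avg K \<phi>" by (simp add: avg_def sum_divide_distrib)
qed

text \<open>The mean value over the cell of n, the factor being the reciprocal of its length:
  conditional expectation as a function on the tree.\<close>

definition av :: "(real \<Rightarrow> complex) \<Rightarrow> nat \<Rightarrow> complex" where
  "av x n = 2^floor_log n * (LINT t:level_cell (floor_log n) n|MI. x t)"

lemma integral_step_av:
  assumes "integrable MI x"
  shows "(\<integral>t. \<phi> (node K t) * x t \<partial>MI) = (\<Sum>n=2^K..<2^Suc K. \<phi> n * av x n) / 2^K"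
  unfolding integral_step_times(2)[OF assms] sum_divide_distrib
  by (intro sum.cong) (auto simp: av_def floor_log_level)

lemma av_1: "av x (Suc 0) = (\<integral>t. x t \<partial>MI)"
proof -
  have "level_cell 0 (Suc 0) = unitI" by (auto simp: level_cell_def)
  thus ?thesis unfolding av_def set_lebesgue_integral_def
    by (simp, intro Bochner_Integration.integral_cong) auto
qed

lemma av_split:
  assumes x: "integrable MI x" and n: "1 \<le> n"
  shows "av x n = (av x (2 * n) + av x (Suc (2 * n))) / 2"
proof -
  define k where "k = floor_log n"
  have k: "2^k \<le> n" "n < 2^Suc k" using level_bounds[OF n] by (auto simp: k_def)
  have fl: "floor_log (2 * n) = Suc k" "floor_log (Suc (2 * n)) = Suc k"
    using k by (auto intro!: floor_log_level)
  have un: "level_cell k n = level_cell (Suc k) (2 * n) \<union> level_cell (Suc k) (Suc (2 * n))"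
  proof (intro equalityI subsetI)
    fix t assume "t \<in> level_cell k n"
    thus "t \<in> level_cell (Suc k) (2 * n) \<union> level_cell (Suc k) (Suc (2 * n))"
      using node_Suc_cases[of t k] by (auto simp: level_cell_def)
  next
    fix t assume "t \<in> level_cell (Suc k) (2 * n) \<union> level_cell (Suc k) (Suc (2 * n))"
    thus "t \<in> level_cell k n" using node_Suc_div[of t k] by (auto simp: level_cell_def)
  qed
  have int: "set_integrable MI (level_cell j m) x" for j m
    unfolding set_integrable_def by (intro integrable_mult_indicator x) simp
  have "(LINT t:level_cell k n|MI. x t) = (LINT t:level_cell (Suc k) (2 * n)|MI. x t) + (LINT t:level_cell (Suc k) (Suc (2 * n))|MI. x t)"
    unfolding un by (rule set_integral_Un) (auto simp: level_cell_def int[unfolded level_cell_def])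
  thus ?thesis by (simp add: av_def fl flip: k_def) (simp add: algebra_simps)
qed

text \<open>The Haar coefficient: the averages over the two children are the average over the cell
  plus and minus it.\<close>

definition coef :: "(real \<Rightarrow> complex) \<Rightarrow> nat \<Rightarrow> complex" where
  "coef x n = (av x (2 * n) - av x (Suc (2 * n))) / 2"

lemma val_coef:
  assumes x: "integrable MI x" and n: "1 \<le> n"
  shows "val (coef x) n = av x n - av x (Suc 0)"
  using n
proof (induction n rule: less_induct)
  case (less n)
  let ?m = "n div 2"
  show ?case
  proof (cases "n = 1")
    case False
    hence m: "1 \<le> ?m" "?m < n" using less.prems by auto
    have IH: "val (coef x) ?m = av x ?m - av x (Suc 0)" by (rule less.IH) (use m in auto)
    have "n = 2 * ?m \<or> n = Suc (2 * ?m)" by auto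
    thus ?thesis
    proof
      assume "n = 2 * ?m"
      hence "val (coef x) n = val (coef x) ?m + coef x ?m" "av x n = av x (2 * ?m)"
        using val_double[OF m(1), of "coef x"] by auto
      moreover have "av x ?m + coef x ?m = av x (2 * ?m)"
        unfolding coef_def av_split[OF x m(1)] by (simp add: field_simps)
      moreover have "av x ?m - av x (Suc 0) + coef x ?m = (av x ?m + coef x ?m) - av x (Suc 0)" by simp
      ultimately show ?thesis by (simp only: IH)
    next
      assume "n = Suc (2 * ?m)"
      hence "val (coef x) n = val (coef x) ?m - coef x ?m" "av x n = av x (Suc (2 * ?m))"
        using val_double_1[OF m(1), of "coef x"] by auto
      moreover have "av x ?m - coef x ?m = av x (Suc (2 * ?m))"
        unfolding coef_def av_split[OF x m(1)] by (simp add: field_simps)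
      moreover have "av x ?m - av x (Suc 0) - coef x ?m = (av x ?m - coef x ?m) - av x (Suc 0)" by simp
      ultimately show ?thesis by (simp only: IH)
    qed
  qed simp
qed

section \<open>The space \<open>L\<^sup>p\<close>\<close>

text \<open>The p-th power of the norm. Estimates are carried out for it with the factor 2^p in
  place of Minkowski's inequality.\<close>

definition Ip :: "real \<Rightarrow> (real \<Rightarrow> complex) \<Rightarrow> real" where
  "Ip p g = (\<integral>t. cmod (g t) powr p \<partial>MI)"

lemma memLp_iff: "memLp p g \<longleftrightarrow> g \<in> borel_measurable MI \<and> integrable MI (\<lambda>t. cmod (g t) powr p)"
proof -
  have "(\<lambda>t. cmod (g t) powr p) \<in> borel_measurable MI" if "g \<in> borel_measurable MI"
    using that by measurable
  thus ?thesis unfolding memLp_def integrable_iff_bounded by auto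
qed

lemma memLp_measurable: "memLp p g \<Longrightarrow> g \<in> borel_measurable MI"
  by (simp add: memLp_def)

lemma memLp_integrable_powr: "memLp p g \<Longrightarrow> integrable MI (\<lambda>t. cmod (g t) powr p)"
  by (simp add: memLp_iff)

lemma Lp_norm_eq: "memLp p g \<Longrightarrow> Lp_norm p g = Ip p g powr (1 / p)"
  unfolding Lp_norm_def Ip_def
  by (subst nn_integral_eq_integral) (auto dest: memLp_integrable_powr)

lemma Ip_nonneg: "0 \<le> Ip p g"
  by (simp add: Ip_def)

lemma memLp_cong:
  assumes "\<And>t. t \<in> unitI \<Longrightarrow> f t = g t"
  shows "memLp p f \<longleftrightarrow> memLp p g" and "Ip p f = Ip p g"
proof -
  have "f \<in> borel_measurable MI \<longleftrightarrow> g \<in> borel_measurable MI"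
    by (rule measurable_cong) (use assms in auto)
  moreover have "integrable MI (\<lambda>t. cmod (f t) powr p) \<longleftrightarrow> integrable MI (\<lambda>t. cmod (g t) powr p)"
    by (rule Bochner_Integration.integrable_cong) (use assms in auto)
  ultimately show "memLp p f \<longleftrightarrow> memLp p g" by (simp add: memLp_iff)
  show "Ip p f = Ip p g"
    unfolding Ip_def by (rule Bochner_Integration.integral_cong) (use assms in auto)
qed

lemma av_linear:
  assumes "integrable MI f" "integrable MI g"
  shows "av (\<lambda>t. a * f t + b * g t) n = a * av f n + b * av g n"
proof -
  let ?C = "level_cell (floor_log n) n"
  have int: "integrable MI (\<lambda>t. indicator ?C t *\<^sub>R h t)" if "integrable MI h" for h :: "real \<Rightarrow> complex"
    using that by (intro integrable_mult_indicator) simp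
  have "(LINT t:?C|MI. a * f t + b * g t) = (\<integral>t. a * (indicator ?C t *\<^sub>R f t) + b * (indicator ?C t *\<^sub>R g t) \<partial>MI)"
    unfolding set_lebesgue_integral_def by (intro Bochner_Integration.integral_cong) (auto simp: indicator_def)
  also have "\<dots> = a * (LINT t:?C|MI. f t) + b * (LINT t:?C|MI. g t)"
    unfolding set_lebesgue_integral_def
    by (subst Bochner_Integration.integral_add)
      (intro integrable_mult_right int assms, intro integrable_mult_right int assms, simp only: integral_mult_right_zero)
  finally show ?thesis by (simp add: av_def algebra_simps)
qed

lemma av_step:
  assumes "\<And>t. t \<in> unitI \<Longrightarrow> f t = \<phi> (node K t)" "2^K \<le> n" "n < 2^Suc K"
  shows "av f n = \<phi> n"
proof -
  have "(LINT t:level_cell K n|MI. f t) = (\<integral>t. indicator (level_cell K n) t *\<^sub>R \<phi> n \<partial>MI)"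
    unfolding set_lebesgue_integral_def
    by (intro Bochner_Integration.integral_cong) (auto simp: assms indicator_def level_cell_def)
  also have "\<dots> = \<phi> n / 2^K" using measure_level_cell[OF assms(2,3)] by (simp add: scaleR_conv_of_real)
  finally show ?thesis using assms by (simp add: av_def floor_log_level)
qed

lemma memLp_cmult:
  assumes f: "memLp p f"
  shows "memLp p (\<lambda>t. a * f t)" and "Ip p (\<lambda>t. a * f t) = cmod a powr p * Ip p f"
  using f by (auto simp: memLp_iff Ip_def norm_mult powr_mult)

lemma Ip_diff_commute: "Ip p (\<lambda>t. f t - g t) = Ip p (\<lambda>t. g t - f t)"
  by (simp add: Ip_def norm_minus_commute)

lemma memLp_step:
  assumes "\<And>t. t \<in> unitI \<Longrightarrow> f t = \<phi> (node K t)"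
  shows "memLp p f" and "Ip p f = avg K (\<lambda>n. cmod (\<phi> n) powr p)"
proof -
  have "(\<lambda>t. \<phi> (node K t)) \<in> borel_measurable MI"
    by (rule measurable_compose[OF node_measurable]) simp
  hence "memLp p (\<lambda>t. \<phi> (node K t))"
    using integral_step(1)[of "\<lambda>n. cmod (\<phi> n) powr p" K] by (simp add: memLp_iff)
  thus "memLp p f" using memLp_cong(1)[of f "\<lambda>t. \<phi> (node K t)"] assms by blast
  have "Ip p f = Ip p (\<lambda>t. \<phi> (node K t))" by (rule memLp_cong(2)) (rule assms)
  thus "Ip p f = avg K (\<lambda>n. cmod (\<phi> n) powr p)"
    using integral_step(2)[of "\<lambda>n. cmod (\<phi> n) powr p" K] by (simp add: Ip_def)
qed

context
  fixes p :: real
  assumes p: "2 \<le> p"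
begin

lemma memLp_add:
  assumes f: "memLp p f" and g: "memLp p g"
  shows "memLp p (\<lambda>t. f t + g t)" and "Ip p (\<lambda>t. f t + g t) \<le> 2 powr p * (Ip p f + Ip p g)"
proof -
  have [measurable]: "f \<in> borel_measurable MI" "g \<in> borel_measurable MI"
    using f g by (auto dest: memLp_measurable)
  have le: "cmod (f t + g t) powr p \<le> 2 powr p * (cmod (f t) powr p + cmod (g t) powr p)" for t
  proof -
    have "cmod (f t + g t) powr p \<le> (cmod (f t) + cmod (g t)) powr p"
      using p by (intro powr_mono2 norm_triangle_ineq) auto
    thus ?thesis using powr_add_le[of "cmod (f t)" "cmod (g t)" p] p by auto
  qed
  have int: "integrable MI (\<lambda>t. 2 powr p * (cmod (f t) powr p + cmod (g t) powr p))"
    using f g by (intro integrable_mult_right Bochner_Integration.integrable_add memLp_integrable_powr)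
  have int': "integrable MI (\<lambda>t. cmod (f t + g t) powr p)"
    by (rule Bochner_Integration.integrable_bound[OF int]) (use le in \<open>auto intro!: AE_I2 order_trans[OF le]\<close>)
  thus "memLp p (\<lambda>t. f t + g t)" by (simp add: memLp_iff)
  have "Ip p (\<lambda>t. f t + g t) \<le> (\<integral>t. 2 powr p * (cmod (f t) powr p + cmod (g t) powr p) \<partial>MI)"
    unfolding Ip_def by (rule integral_mono[OF int' int le])
  also have "\<dots> = 2 powr p * (Ip p f + Ip p g)"
    unfolding Ip_def by (simp add: memLp_integrable_powr f g)
  finally show "Ip p (\<lambda>t. f t + g t) \<le> 2 powr p * (Ip p f + Ip p g)" .
qed

lemma memLp_diff:
  assumes f: "memLp p f" and g: "memLp p g"
  shows "memLp p (\<lambda>t. f t - g t)" and "Ip p (\<lambda>t. f t - g t) \<le> 2 powr p * (Ip p f + Ip p g)"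
proof -
  have m: "memLp p (\<lambda>t. (-1) * g t)" and e: "Ip p (\<lambda>t. (-1) * g t) = Ip p g"
    using memLp_cmult[OF g, of "-1"] by auto
  have eq: "(\<lambda>t. f t + (-1) * g t) = (\<lambda>t. f t - g t)" by auto
  show "memLp p (\<lambda>t. f t - g t)" "Ip p (\<lambda>t. f t - g t) \<le> 2 powr p * (Ip p f + Ip p g)"
    using memLp_add[OF f m] unfolding eq e by auto
qed

lemma Ip_triangle:
  assumes "memLp p f" "memLp p g" "memLp p h"
  shows "Ip p (\<lambda>t. f t - h t) \<le> 2 powr p * (Ip p (\<lambda>t. f t - g t) + Ip p (\<lambda>t. g t - h t))"
  using memLp_add(2)[OF memLp_diff(1)[OF assms(1,2)] memLp_diff(1)[OF assms(2,3)]] by simp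

lemma memLp_integrable:
  assumes "memLp p f" shows "integrable MI f"
proof (rule Bochner_Integration.integrable_bound)
  show "integrable MI (\<lambda>t. 1 + cmod (f t) powr p)"
    using assms by (intro Bochner_Integration.integrable_add MI.integrable_const memLp_integrable_powr)
  have "cmod z \<le> 1 + cmod z powr p" for z
  proof (cases "cmod z \<le> 1")
    case False
    hence "cmod z powr 1 \<le> cmod z powr p" using p by (intro powr_mono) auto
    thus ?thesis using False by simp
  qed (simp add: add_increasing2)
  thus "AE t in MI. norm (f t) \<le> norm (1 + cmod (f t) powr p)"
    by (intro AE_I2) (simp add: order_trans)
qed (use assms memLp_measurable in auto)

text \<open>Jensen's inequality for conditional expectations: take the tangent of |z|^p at the cell
  average; its linear term integrates to 0 over each cell.\<close>

lemma avg_av_le_Ip: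
  assumes f: "memLp p f"
  shows "avg K (\<lambda>n. cmod (av f n) powr p) \<le> Ip p f"
proof -
  define w where "w = (\<lambda>n. of_real (cmod (av f n) powr (p - 2)) * cnj (av f n))"
  have fi: "integrable MI f" by (rule memLp_integrable[OF f])
  have pt: "cmod (av f (node K t)) powr p + p * Re (w (node K t) * (f t - av f (node K t))) \<le> cmod (f t) powr p" for t
    using cmod_powr_tangent[OF p, of "av f (node K t)" "f t"] by (simp add: w_def mult.assoc)
  have avi: "integrable MI (\<lambda>t. av f (node K t))"
    by (rule memLp_integrable[OF memLp_step(1)]) simp
  have i1: "integrable MI (\<lambda>t. w (node K t) * f t)" "integrable MI (\<lambda>t. w (node K t) * av f (node K t))"
    using integral_step_times(1)[OF fi] integral_step_times(1)[OF avi] by auto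
  have "(\<integral>t. w (node K t) * av f (node K t) \<partial>MI) = (\<integral>t. (\<lambda>n. w n * av f n) (node K t) * 1 \<partial>MI)" by simp
  also have "\<dots> = (\<Sum>n=2^K..<2^Suc K. w n * av f n * av (\<lambda>_. 1) n) / 2^K"
    by (rule integral_step_av) (rule MI.integrable_const)
  also have "\<dots> = (\<Sum>n=2^K..<2^Suc K. w n * av f n) / 2^K"
  proof -
    have "av (\<lambda>_. 1) n = 1" if "n \<in> {2^K..<2^Suc K}" for n
      using that measure_level_cell[of K n] floor_log_level[of K n]
      by (simp add: av_def set_lebesgue_integral_def scaleR_conv_of_real)
    thus ?thesis by simp
  qed
  also have "\<dots> = (\<integral>t. w (node K t) * f t \<partial>MI)" by (rule integral_step_av[OF fi, symmetric])
  finally have "(\<integral>t. w (node K t) * (f t - av f (node K t)) \<partial>MI) = 0"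
    using i1 by (simp add: right_diff_distrib Bochner_Integration.integral_diff)
  moreover have i2: "integrable MI (\<lambda>t. w (node K t) * (f t - av f (node K t)))"
    using i1 by (simp add: right_diff_distrib)
  moreover define Z where "Z = (\<lambda>t. Re (w (node K t) * (f t - av f (node K t))))"
  ultimately have Z: "integrable MI Z" "(\<integral>t. Z t \<partial>MI) = 0"
    unfolding Z_def by (auto simp only: integral_Re zero_complex.sel intro: integrable_Re)
  have "avg K (\<lambda>n. cmod (av f n) powr p) = (\<integral>t. cmod (av f (node K t)) powr p + p * Z t \<partial>MI)"
    using integral_step[of "\<lambda>n. cmod (av f n) powr p" K] Z by simp
  also have "\<dots> \<le> Ip p f"
    unfolding Ip_def using pt
    by (intro integral_mono memLp_integrable_powr[OF f] Bochner_Integration.integrable_add integral_step(1)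
        integrable_mult_right Z) (auto simp only: Z_def)
  finally show ?thesis .
qed

text \<open>A single term of the level average. It makes averages, and with them Haar coefficients,
  continuous functionals on L^p.\<close>

lemma av_bound:
  assumes f: "memLp p f" and n: "1 \<le> n"
  shows "cmod (av f n) powr p \<le> 2^floor_log n * Ip p f"
proof -
  let ?k = "floor_log n"
  have "cmod (av f n) powr p \<le> (\<Sum>n=2^?k..<2^Suc ?k. cmod (av f n) powr p)"
    by (rule member_le_sum) (use level_bounds[OF n] in auto)
  also have "\<dots> = 2^?k * avg ?k (\<lambda>n. cmod (av f n) powr p)" by (simp add: avg_def)
  also have "\<dots> \<le> 2^?k * Ip p f" using avg_av_le_Ip[OF f] by (intro mult_left_mono) auto
  finally show ?thesis .
qed

end

section \<open>Martingale convergence\<close>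

lemma val_linear: "val (\<lambda>n. a * \<xi> n + b * \<zeta> n) N = a * val \<xi> N + b * val \<zeta> N"
proof (induction N rule: less_induct)
  case (less N)
  show ?case
  proof (cases "N \<le> 1")
    case False
    hence "N div 2 < N" by simp
    from less.IH[OF this] False show ?thesis
      by (simp add: val.simps[of _ N] algebra_simps)
  qed (simp add: val.simps)
qed

definition level_cut :: "nat \<Rightarrow> (nat \<Rightarrow> complex) \<Rightarrow> nat \<Rightarrow> complex" where
  "level_cut K \<xi> n = (if n < 2^K then \<xi> n else 0)"

lemma val_level_cut_node:
  assumes "t \<in> unitI" "K \<le> L"
  shows "val (level_cut K \<xi>) (node L t) = val \<xi> (node K t)"
  using assms(2)
proof (induction L rule: dec_induct)
  case base
  show ?case by (rule val_cong) (use node_less[OF assms(1), of K] in \<open>auto simp: level_cut_def\<close>)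
next
  case (step L)
  have "2^K \<le> node L t" using node_ge[OF assms(1), of L] power_increasing[OF step(1), of "2::nat"] by linarith
  hence "level_cut K \<xi> (node L t) = 0" by (simp add: level_cut_def)
  thus ?case using node_Suc_cases[OF assms(1), of L] node_pos[OF assms(1), of L] step by auto
qed

lemma AE_MI_negligible:
  assumes "negligible N"
  shows "AE t in MI. t \<notin> N"
proof -
  have "AE t in lebesgue. t \<notin> N"
    using assms by (simp add: negligible_iff_null_sets AE_not_in)
  hence "AE t in lebesgue. t \<in> unitI \<longrightarrow> t \<notin> N" by eventually_elim simp
  thus ?thesis by (subst AE_restrict_space_iff) auto
qed

lemma cell_point_tendsto:
  assumes "t \<in> unitI"
  shows "(\<lambda>K. (real (node K t) + 1) / 2^K - 1) \<longlonglongrightarrow> t"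
proof (rule real_tendsto_sandwich[where f="\<lambda>_. t" and h="\<lambda>K. t + (1/2)^K"])
  have "t \<le> (real (node K t) + 1) / 2^K - 1" "(real (node K t) + 1) / 2^K - 1 \<le> t + (1/2)^K" for K
  proof -
    have "real (node K t) / 2^K < 1 + t" "1 + t \<le> (real (node K t) + 1) / 2^K"
      using node_bounds[OF assms, of K] by (simp_all add: divide_less_eq le_divide_eq mult.commute)
    thus "t \<le> (real (node K t) + 1) / 2^K - 1" "(real (node K t) + 1) / 2^K - 1 \<le> t + (1/2)^K"
      by (auto simp: add_divide_distrib power_one_over)
  qed
  thus "\<forall>\<^sub>F K in sequentially. t \<le> (real (node K t) + 1) / 2^K - 1"
    "\<forall>\<^sub>F K in sequentially. (real (node K t) + 1) / 2^K - 1 \<le> t + (1/2)^K" by auto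
  have "(\<lambda>K. t + (1/2)^K) \<longlonglongrightarrow> t + 0" by (intro tendsto_intros LIMSEQ_realpow_zero) auto
  thus "(\<lambda>K. t + (1/2)^K) \<longlonglongrightarrow> t" by simp
qed simp

context
  fixes p :: real
  assumes p: "2 \<le> p"
begin

lemma memLp_bounded:
  assumes "f \<in> borel_measurable MI" "\<And>t. t \<in> unitI \<Longrightarrow> cmod (f t) \<le> B"
  shows "memLp p f"
  unfolding memLp_iff
proof
  have "cmod (f t) powr p \<le> B powr p" if "t \<in> unitI" for t
    using p assms(2)[OF that] by (intro powr_mono2) auto
  thus "integrable MI (\<lambda>t. cmod (f t) powr p)"
    using assms(1) by (intro MI.integrable_const_bound[of _ "B powr p"]) (auto intro!: AE_I2)
qed (rule assms)

lemma Ip_dominated: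
  assumes meas: "\<And>i. f i \<in> borel_measurable MI" "g \<in> borel_measurable MI"
    and int: "integrable MI w"
    and lim: "AE t in MI. (\<lambda>i. f i t) \<longlonglongrightarrow> g t"
    and bound: "\<And>i t. t \<in> unitI \<Longrightarrow> cmod (g t - f i t) powr p \<le> w t"
  shows "(\<lambda>i. Ip p (\<lambda>t. g t - f i t)) \<longlonglongrightarrow> 0"
proof -
  have "(\<lambda>i. \<integral>t. cmod (g t - f i t) powr p \<partial>MI) \<longlonglongrightarrow> (\<integral>t. 0 \<partial>MI)"
  proof (rule integral_dominated_convergence[OF _ _ int])
    show "AE t in MI. (\<lambda>i. cmod (g t - f i t) powr p) \<longlonglongrightarrow> 0"
      using lim
    proof eventually_elim
      case (elim t)
      have "(\<lambda>i. cmod (g t - f i t)) \<longlonglongrightarrow> cmod (g t - g t)" using elim by (intro tendsto_intros)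
      hence "(\<lambda>i. cmod (g t - f i t)) \<longlonglongrightarrow> 0" by simp
      hence "(\<lambda>i. cmod (g t - f i t) powr p) \<longlonglongrightarrow> 0 powr p"
        by (rule tendsto_powr2) (use p in auto)
      thus ?case by simp
    qed
    show "AE t in MI. norm (cmod (g t - f i t) powr p) \<le> w t" for i
      using bound by (intro AE_I2) auto
  qed (use meas in measurable)
  thus ?thesis by (simp add: Ip_def)
qed

lemma Ip_lim_ex:
  assumes "(\<lambda>i. Ip p (f i)) \<longlonglongrightarrow> 0" "e > 0"
  shows "\<exists>i. Ip p (f i) < e"
  using order_tendstoD(2)[OF assms] eventually_happens trivial_limit_sequentially by blast

text \<open>Two limits: continuous functions converging to f almost everywhere, then samples of a
  continuous function at the right endpoints of the cells. Both pass to L^p by dominated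
  convergence.\<close>

lemma step_dense_bounded:
  assumes meas: "f \<in> borel_measurable MI" and bd: "\<And>t. t \<in> unitI \<Longrightarrow> cmod (f t) \<le> B" and e: "e > 0"
  shows "\<exists>K \<phi>. Ip p (\<lambda>t. f t - \<phi> (node K t)) < e"
proof -
  define B' where "B' = max B 1"
  have B': "B' > 0" "B \<le> B'" by (auto simp: B'_def)
  \<comment> \<open>The radial retraction onto the disc of radius B'. It is continuous and fixes the
    values of f, so it puts all approximants under a common bound without spoiling convergence; B'
    >= 1 keeps the denominator positive.\<close>
  define clip :: "complex \<Rightarrow> complex" where "clip z = of_real (B' / max B' (cmod z)) * z" for z
  have clip_le: "cmod (clip z) \<le> B'" for z
  proof -
    have "cmod (clip z) = B' * (cmod z / max B' (cmod z))"
      unfolding clip_def norm_mult norm_of_real using B' by (simp add: abs_of_pos max_def)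
    also have "\<dots> \<le> B' * 1" using B' by (intro mult_left_mono) (auto simp: divide_le_eq max_def)
    finally show ?thesis by simp
  qed
  have clip_id: "clip (f t) = f t" if "t \<in> unitI" for t
  proof -
    have "max B' (cmod (f t)) = B'" using bd[OF that] B' by simp
    thus ?thesis using B' by (simp add: clip_def)
  qed
  have clip_cont: "continuous_on UNIV clip"
    unfolding clip_def using B' by (intro continuous_intros) (auto simp: max_def)
  have "f measurable_on unitI"
    using meas by (simp add: measurable_on_iff_borel_measurable)
  then obtain N g where N: "negligible N" and g: "\<And>n. continuous_on UNIV (g n)"
    and lim: "\<And>t. t \<notin> N \<Longrightarrow> (\<lambda>n. g n t) \<longlonglongrightarrow> (if t \<in> unitI then f t else 0)"
    unfolding measurable_on_def by blast
  have gc: "continuous_on UNIV (\<lambda>t. clip (g n t))" for n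
    using continuous_on_compose2[OF clip_cont g] by simp
  have gm: "(\<lambda>t. clip (g n t)) \<in> borel_measurable MI" for n
    by (rule measurable_restrict_space1)
      (use borel_measurable_continuous_onI[OF gc] in \<open>simp add: measurable_completion\<close>)
  have bnd: "cmod (u - v) powr p \<le> (2 * B') powr p" if "cmod u \<le> B'" "cmod v \<le> B'" for u v
    using norm_triangle_ineq4[of u v] that p by (intro powr_mono2) auto
  have "(\<lambda>n. Ip p (\<lambda>t. f t - clip (g n t))) \<longlonglongrightarrow> 0"
  proof (rule Ip_dominated[where w="\<lambda>_. (2 * B') powr p"])
    show "AE t in MI. (\<lambda>n. clip (g n t)) \<longlonglongrightarrow> f t"
      using AE_MI_negligible[OF N] AE_space
    proof eventually_elim
      case (elim t)
      have "isCont clip (f t)" using clip_cont by (simp add: continuous_on_eq_continuous_at)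
      hence "(\<lambda>n. clip (g n t)) \<longlonglongrightarrow> clip (f t)"
        using lim[OF elim(1)] elim(2) by (intro isCont_tendsto_compose[of _ clip]) auto
      thus ?case using clip_id elim(2) by simp
    qed
    show "cmod (f t - clip (g n t)) powr p \<le> (2 * B') powr p" if "t \<in> unitI" for n t
      using bd[OF that] B' clip_le by (intro bnd) auto
  qed (use gm meas in auto)
  then obtain n where n: "Ip p (\<lambda>t. f t - clip (g n t)) < e / (2 * 2 powr p)"
    using Ip_lim_ex[of _ "e / (2 * 2 powr p)"] e by fastforce
  define h where "h = (\<lambda>t. clip (g n t))"
  define r where "r = (\<lambda>K m. h ((real m + 1) / 2^K - 1))"
  have h: "cmod (h t) \<le> B'" for t by (simp add: h_def clip_le)
  have rm: "(\<lambda>t. r K (node K t)) \<in> borel_measurable MI" for K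
    by (rule measurable_compose[OF node_measurable]) simp
  have "(\<lambda>K. Ip p (\<lambda>t. h t - r K (node K t))) \<longlonglongrightarrow> 0"
  proof (rule Ip_dominated[where w="\<lambda>_. (2 * B') powr p"])
    show "AE t in MI. (\<lambda>K. r K (node K t)) \<longlonglongrightarrow> h t"
    proof (rule AE_I2)
      fix t assume "t \<in> space MI"
      moreover have "isCont h t" using gc[of n] by (simp add: h_def continuous_on_eq_continuous_at)
      ultimately show "(\<lambda>K. r K (node K t)) \<longlonglongrightarrow> h t"
        unfolding r_def by (intro isCont_tendsto_compose[of _ h] cell_point_tendsto) auto
    qed
    show "cmod (h t - r K (node K t)) powr p \<le> (2 * B') powr p" for K t
      unfolding r_def by (intro bnd h)
    show "h \<in> borel_measurable MI" using gm[of n] by (simp only: h_def)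
  qed (use rm in auto)
  then obtain K where K: "Ip p (\<lambda>t. h t - r K (node K t)) < e / (2 * 2 powr p)"
    using Ip_lim_ex[of _ "e / (2 * 2 powr p)"] e by fastforce
  have "Ip p (\<lambda>t. f t - r K (node K t)) \<le> 2 powr p * (Ip p (\<lambda>t. f t - h t) + Ip p (\<lambda>t. h t - r K (node K t)))"
    by (rule Ip_triangle[OF p memLp_bounded[OF meas bd] memLp_bounded[of h B'] memLp_step(1)[where K=K]])
      (use gm[of n] h in \<open>auto simp flip: h_def\<close>)
  also have "\<dots> < 2 powr p * (e / (2 * 2 powr p) + e / (2 * 2 powr p))"
    using n K by (intro mult_strict_left_mono add_strict_mono) (auto simp: h_def)
  also have "\<dots> = e" by (simp add: field_simps)
  finally show ?thesis by blast
qed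

lemma step_dense:
  assumes f: "memLp p f" and e: "e > 0"
  shows "\<exists>K \<phi>. Ip p (\<lambda>t. f t - \<phi> (node K t)) < e"
proof -
  have fm [measurable]: "f \<in> borel_measurable MI" using f by (rule memLp_measurable)
  define g where "g = (\<lambda>i t. if cmod (f t) \<le> real i then f t else 0)"
  have gm: "g i \<in> borel_measurable MI" for i unfolding g_def by measurable
  have gb: "cmod (g i t) \<le> real i" for i t by (simp add: g_def)
  have "(\<lambda>i. Ip p (\<lambda>t. f t - g i t)) \<longlonglongrightarrow> 0"
  proof (rule Ip_dominated[where w="\<lambda>t. cmod (f t) powr p"])
    show "AE t in MI. (\<lambda>i. g i t) \<longlonglongrightarrow> f t"
    proof (rule AE_I2)
      fix t
      obtain i0 :: nat where "cmod (f t) \<le> real i0" using real_arch_simple by blast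
      hence "\<forall>i\<ge>i0. g i t = f t" by (auto simp: g_def)
      thus "(\<lambda>i. g i t) \<longlonglongrightarrow> f t" by (intro tendsto_eventually) (auto simp: eventually_sequentially)
    qed
  qed (use gm fm f in \<open>auto simp: g_def intro: memLp_integrable_powr\<close>)
  then obtain i where i: "Ip p (\<lambda>t. f t - g i t) < e / (2 * 2 powr p)"
    using Ip_lim_ex[of _ "e / (2 * 2 powr p)"] e by fastforce
  obtain K \<phi> where K: "Ip p (\<lambda>t. g i t - \<phi> (node K t)) < e / (2 * 2 powr p)"
    using step_dense_bounded[OF gm gb, of "e / (2 * 2 powr p)" i] e by auto
  have "Ip p (\<lambda>t. f t - \<phi> (node K t)) \<le> 2 powr p * (Ip p (\<lambda>t. f t - g i t) + Ip p (\<lambda>t. g i t - \<phi> (node K t)))"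
    by (rule Ip_triangle[OF p f memLp_bounded[OF gm gb] memLp_step(1)[where K=K]]) simp
  also have "\<dots> < 2 powr p * (e / (2 * 2 powr p) + e / (2 * 2 powr p))"
    using i K by (intro mult_strict_left_mono add_strict_mono) auto
  also have "\<dots> = e" by (simp add: field_simps)
  finally show ?thesis by blast
qed

lemma av_node_step:
  assumes "K \<le> L" "t \<in> unitI"
  shows "av (\<lambda>t. \<phi> (node K t)) (node L t) = \<phi> (node K t)"
proof -
  define anc where "anc = (\<lambda>m::nat. m div 2^(L - K))"
  have anc: "node K t = anc (node L t)" if "t \<in> unitI" for t
    unfolding anc_def using assms(1)
  proof (induction L rule: dec_induct)
    case (step L)
    have "node (Suc L) t div 2^(Suc L - K) = node (Suc L) t div 2 div 2^(L - K)"
      using step(1) by (simp add: Suc_diff_le div_mult2_eq)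
    thus ?case using node_Suc_div[OF that, of L] step by simp
  qed simp
  have "av (\<lambda>t. \<phi> (node K t)) (node L t) = \<phi> (anc (node L t))"
    by (rule av_step[where K=L and \<phi>="\<lambda>m. \<phi> (anc m)"])
      (use anc node_ge node_less assms(2) in auto)
  thus ?thesis using anc assms(2) by simp
qed

text \<open>Averaging over level L is a contraction and fixes step functions of coarser levels, so
  density of step functions suffices.\<close>

lemma martingale_tendsto:
  assumes f: "memLp p f"
  shows "(\<lambda>K. Ip p (\<lambda>t. f t - av f (node K t))) \<longlonglongrightarrow> 0"
proof (rule LIMSEQ_I)
  fix e :: real assume e: "0 < e"
  define d where "d = e / (4 powr p * 4)"
  have d: "d > 0" using e by (simp add: d_def)
  obtain K \<phi> where K: "Ip p (\<lambda>t. f t - \<phi> (node K t)) < d" using step_dense[OF f d] by blast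
  define s where "s = (\<lambda>t. \<phi> (node K t))"
  have s: "memLp p s" unfolding s_def by (rule memLp_step(1)[where K=K]) simp
  have fs: "memLp p (\<lambda>t. s t - f t)" by (rule memLp_diff(1)[OF p s f])
  have le: "Ip p (\<lambda>t. f t - av f (node L t)) < e" if L: "K \<le> L" for L
  proof -
    have aL: "memLp p (\<lambda>t. av g (node L t))" for g by (rule memLp_step(1)[where K=L]) simp
    have "Ip p (\<lambda>t. f t - av f (node L t)) \<le> 2 powr p * (Ip p (\<lambda>t. f t - s t) + Ip p (\<lambda>t. s t - av f (node L t)))"
      by (rule Ip_triangle[OF p f s aL])
    also have "Ip p (\<lambda>t. s t - av f (node L t)) = Ip p (\<lambda>t. av (\<lambda>t. s t - f t) (node L t))"
    proof (rule memLp_cong(2))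
      fix t assume "t \<in> unitI"
      hence "s t = av s (node L t)" using av_node_step[OF L, of t \<phi>] by (simp add: s_def)
      thus "s t - av f (node L t) = av (\<lambda>t. s t - f t) (node L t)"
        using av_linear[of s f 1 "-1"] memLp_integrable[OF p] s f by simp
    qed
    also have "\<dots> = avg L (\<lambda>n. cmod (av (\<lambda>t. s t - f t) n) powr p)"
      by (rule memLp_step(2)) simp
    also have "\<dots> \<le> Ip p (\<lambda>t. s t - f t)" by (rule avg_av_le_Ip[OF p fs])
    also have "\<dots> = Ip p (\<lambda>t. f t - s t)" by (rule Ip_diff_commute)
    finally have "Ip p (\<lambda>t. f t - av f (node L t)) \<le> 2 powr p * (2 * Ip p (\<lambda>t. f t - s t))" by simp
    also have "\<dots> < 2 powr p * (2 * d)" using K by (simp add: s_def)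
    also have "\<dots> \<le> 4 powr p * (2 * d)" using d p by (intro mult_right_mono powr_mono2) auto
    also have "\<dots> < e" using e by (simp add: d_def)
    finally show ?thesis .
  qed
  thus "\<exists>no. \<forall>n\<ge>no. norm (Ip p (\<lambda>t. f t - av f (node n t)) - 0) < e"
    by (intro exI[of _ K]) (simp add: Ip_nonneg)
qed

lemma fatou_Ip:
  assumes f: "\<And>i. memLp p (f i)" and g: "g \<in> borel_measurable MI"
    and lim: "AE t in MI. (\<lambda>i. f i t) \<longlonglongrightarrow> g t" and C: "\<forall>\<^sub>F i in sequentially. Ip p (f i) \<le> C"
  shows "memLp p g" and "Ip p g \<le> C"
proof -
  have [measurable]: "f i \<in> borel_measurable MI" for i using f by (rule memLp_measurable)
  have C0: "0 \<le> C"
  proof -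
    obtain i where "Ip p (f i) \<le> C" using C eventually_happens trivial_limit_sequentially by blast
    thus ?thesis using Ip_nonneg[of p "f i"] by linarith
  qed
  have nn: "(\<integral>\<^sup>+t. ennreal (cmod (f i t) powr p) \<partial>MI) = ennreal (Ip p (f i))" for i
    unfolding Ip_def by (rule nn_integral_eq_integral) (auto intro: memLp_integrable_powr[OF f])
  have "(\<integral>\<^sup>+t. ennreal (cmod (g t) powr p) \<partial>MI) = (\<integral>\<^sup>+t. liminf (\<lambda>i. ennreal (cmod (f i t) powr p)) \<partial>MI)"
  proof (rule nn_integral_cong_AE, use lim in eventually_elim)
    case (elim t)
    have "(\<lambda>i. cmod (f i t)) \<longlonglongrightarrow> cmod (g t)" using elim by (intro tendsto_intros)
    hence "(\<lambda>i. cmod (f i t) powr p) \<longlonglongrightarrow> cmod (g t) powr p"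
      by (rule tendsto_powr2) (use p in auto)
    hence "(\<lambda>i. ennreal (cmod (f i t) powr p)) \<longlonglongrightarrow> ennreal (cmod (g t) powr p)"
      by (rule tendsto_ennrealI)
    thus ?case by (rule lim_imp_Liminf[OF trivial_limit_sequentially, symmetric])
  qed
  also have "\<dots> \<le> liminf (\<lambda>i. \<integral>\<^sup>+t. ennreal (cmod (f i t) powr p) \<partial>MI)"
    by (rule nn_integral_liminf) measurable
  also have "\<dots> = liminf (\<lambda>i. ennreal (Ip p (f i)))" by (simp add: nn)
  also have "\<dots> \<le> ennreal C"
  proof (rule Liminf_le)
    show "\<forall>\<^sub>F i in sequentially. ennreal (Ip p (f i)) \<le> ennreal C"
      using C by eventually_elim (rule ennreal_leI)
  qed simp
  finally have le: "(\<integral>\<^sup>+t. ennreal (cmod (g t) powr p) \<partial>MI) \<le> ennreal C" .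
  show m: "memLp p g"
    unfolding memLp_def using g le by (auto intro: le_less_trans)
  have "ennreal (Ip p g) \<le> ennreal C"
    using le unfolding Ip_def
    by (subst (asm) nn_integral_eq_integral) (auto intro: memLp_integrable_powr[OF m])
  thus "Ip p g \<le> C" using C0 by simp
qed

end

section \<open>Functions with prescribed Haar coefficients\<close>

lemma integral_node_level:
  assumes "\<And>t. t \<in> unitI \<Longrightarrow> F (node K t) = G (node L t)"
  shows "avg K F = avg L G"
proof -
  have "avg K F = (\<integral>t. F (node K t) \<partial>MI)" by (simp add: integral_step(2))
  also have "\<dots> = (\<integral>t. G (node L t) \<partial>MI)"
    by (rule Bochner_Integration.integral_cong) (use assms in auto)
  also have "\<dots> = avg L G" by (simp add: integral_step(2))
  finally show ?thesis .
qed

lemma coef_linear: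
  assumes "integrable MI f" "integrable MI g"
  shows "coef (\<lambda>t. a * f t + b * g t) n = a * coef f n + b * coef g n"
  unfolding coef_def av_linear[OF assms] by (simp add: field_simps)

lemma coef_of_val:
  assumes "\<And>m. 1 \<le> m \<Longrightarrow> av x m = val \<xi> m" "1 \<le> n"
  shows "coef x n = \<xi> n"
  using assms(2) assms(1)[of "2 * n"] assms(1)[of "Suc (2 * n)"] by (simp add: coef_def)

text \<open>On levels from K on, f is constant on cells; the coarser averages follow upwards in the
  tree by \<open>av_split\<close>. The cut reflects that f contains no coefficients of level K or
  finer.\<close>

lemma av_val:
  assumes int: "integrable MI f" and f: "\<And>t. t \<in> unitI \<Longrightarrow> f t = val \<xi> (node K t)" and n: "1 \<le> n"
  shows "av f n = val (level_cut K \<xi>) n"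
proof -
  have top: "av f m = val (level_cut K \<xi>) m" if "2^L \<le> m" "m < 2^Suc L" "K \<le> L" for L m
    by (rule av_step[where K=L, OF _ that(1,2)]) (use val_level_cut_node[OF _ that(3)] f in simp)
  have "K - i \<le> floor_log m \<Longrightarrow> 1 \<le> m \<Longrightarrow> av f m = val (level_cut K \<xi>) m" for i m
  proof (induction i arbitrary: m)
    case 0
    thus ?case using level_bounds[of m] by (intro top[of "floor_log m"]) auto
  next
    case (Suc i)
    have "floor_log (2 * m) = Suc (floor_log m)" using Suc.prems by simp
    moreover have "floor_log (2 * m) \<le> floor_log (Suc (2 * m))" by (rule floor_log_le_iff) simp
    ultimately have *: "K - i \<le> floor_log (2 * m)" "K - i \<le> floor_log (Suc (2 * m))"
      using Suc.prems by linarith+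
    have "av f (2 * m) = val (level_cut K \<xi>) (2 * m)"
      by (rule Suc.IH[OF *(1)]) (use Suc.prems in simp)
    moreover have "av f (Suc (2 * m)) = val (level_cut K \<xi>) (Suc (2 * m))"
      by (rule Suc.IH[OF *(2)]) simp
    ultimately show ?case using av_split[OF int Suc.prems(2)] Suc.prems(2) by simp
  qed
  from this[of K n] n show ?thesis by simp
qed

context
  fixes p :: real
  assumes p: "2 \<le> p"
begin

lemma avg_val_mono:
  assumes "K \<le> L"
  shows "avg K (\<lambda>n. cmod (val \<xi> n) powr p) \<le> avg L (\<lambda>n. cmod (val \<xi> n) powr p)"
  using assms
proof (induction L rule: dec_induct)
  case (step L)
  have "avg L (\<lambda>n. cmod (val \<xi> n) powr p) \<le> avg (Suc L) (\<lambda>n. cmod (val \<xi> n) powr p)"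
    unfolding avg_Suc
  proof (rule avg_mono)
    fix n :: nat assume "2^L \<le> n"
    moreover have "(1::nat) \<le> 2^L" by simp
    ultimately have "1 \<le> n" by linarith
    thus "cmod (val \<xi> n) powr p \<le> (cmod (val \<xi> (2 * n)) powr p + cmod (val \<xi> (Suc (2 * n))) powr p) / 2"
      using powr_midpoint_cmod[of p "val \<xi> n" "\<xi> n"] p by simp
  qed
  thus ?case using step by linarith
qed simp

text \<open>Clarkson's inequality makes a bounded martingale Cauchy in \<open>L\<^sup>p\<close>.\<close>

lemma martingale_increment_le:
  assumes "K \<le> L"
  shows "Ip p (\<lambda>t. val \<xi> (node L t) - val \<xi> (node K t))
    \<le> 2 powr p * (avg L (\<lambda>n. cmod (val \<xi> n) powr p) - avg K (\<lambda>n. cmod (val \<xi> n) powr p))"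
proof -
  define a where "a = (\<lambda>K. avg K (\<lambda>n. cmod (val \<xi> n) powr p))"
  define v where "v = val (level_cut K \<xi>)"
  \<comment> \<open>The midpoint of the martingale and its copy stopped at level K. It agrees with
    the martingale up to level K, so its average at level L is at least that at level K; Clarkson's
    inequality turns this into smallness of the difference.\<close>
  define \<zeta> where "\<zeta> = (\<lambda>n. (1/2) * \<xi> n + (1/2) * level_cut K \<xi> n)"
  have v: "v (node L t) = val \<xi> (node K t)" if "t \<in> unitI" for t
    using val_level_cut_node[OF that assms] by (simp add: v_def)
  have avg_v: "avg L (\<lambda>n. cmod (v n) powr p) = a K"
    unfolding a_def by (rule integral_node_level[symmetric]) (simp add: v)
  have \<zeta>: "val \<zeta> n = (val \<xi> n + v n) / 2" for n
    unfolding \<zeta>_def v_def val_linear by (simp add: field_simps)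
  have "avg K (\<lambda>n. cmod (val \<zeta> n) powr p) = a K"
    unfolding a_def
  proof (rule avg_cong)
    fix n :: nat assume "n < 2^Suc K"
    hence "val \<zeta> n = val \<xi> n" by (intro val_cong) (auto simp: \<zeta>_def level_cut_def)
    thus "cmod (val \<zeta> n) powr p = cmod (val \<xi> n) powr p" by simp
  qed
  hence "a K \<le> avg L (\<lambda>n. cmod ((val \<xi> n + v n) / 2) powr p)"
    using avg_val_mono[OF assms, of \<zeta>] by (simp add: \<zeta>)
  moreover have "avg L (\<lambda>n. cmod ((val \<xi> n + v n) / 2) powr p + cmod ((val \<xi> n - v n) / 2) powr p)
     \<le> avg L (\<lambda>n. (1/2) * cmod (val \<xi> n) powr p + (1/2) * cmod (v n) powr p)"
  proof (rule avg_mono)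
    fix n
    have "(val \<xi> n + v n) / 2 + (val \<xi> n - v n) / 2 = val \<xi> n" "(val \<xi> n + v n) / 2 - (val \<xi> n - v n) / 2 = v n"
      by (simp_all add: field_simps)
    thus "cmod ((val \<xi> n + v n) / 2) powr p + cmod ((val \<xi> n - v n) / 2) powr p
        \<le> (1/2) * cmod (val \<xi> n) powr p + (1/2) * cmod (v n) powr p"
      using clarkson_cmod[OF p, of "(val \<xi> n + v n) / 2" "(val \<xi> n - v n) / 2"] by simp
  qed
  ultimately have half: "avg L (\<lambda>n. cmod ((val \<xi> n - v n) / 2) powr p) \<le> (a L - a K) / 2"
    unfolding avg_add avg_cmult avg_v by (simp add: a_def)
  have "Ip p (\<lambda>t. val \<xi> (node L t) - val \<xi> (node K t)) = avg L (\<lambda>n. cmod (val \<xi> n - v n) powr p)"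
    by (rule memLp_step(2)) (simp add: v)
  also have "\<dots> = avg L (\<lambda>n. 2 powr p * cmod ((val \<xi> n - v n) / 2) powr p)"
    by (intro avg_cong) (simp add: norm_divide flip: powr_mult)
  also have "\<dots> \<le> 2 powr p * ((a L - a K) / 2)"
    unfolding avg_cmult using half by (intro mult_left_mono) auto
  also have "\<dots> \<le> 2 powr p * (a L - a K)"
    using avg_val_mono[OF assms, of \<xi>] by (intro mult_left_mono) (auto simp: a_def)
  finally show ?thesis by (simp add: a_def)
qed

text \<open>Brings the Cauchy property into the L^1 form from which an almost everywhere convergent
  subsequence is extracted.\<close>

lemma L1_le_Ip:
  assumes f: "memLp p f" and d: "0 < d"
  shows "(\<integral>t. norm (f t) \<partial>MI) \<le> d + d powr (1 - p) * Ip p f"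
proof -
  have pt: "norm z \<le> d + d powr (1 - p) * cmod z powr p" for z
  proof (cases "cmod z \<le> d")
    case True
    thus ?thesis using d by (simp add: add_increasing2)
  next
    case False
    have "cmod z powr (1 - p) * cmod z powr p = cmod z"
      using False d by (simp flip: powr_add)
    moreover have "cmod z powr (1 - p) \<le> d powr (1 - p)"
      using False d p by (intro powr_mono2') auto
    ultimately have "cmod z \<le> d powr (1 - p) * cmod z powr p"
      by (metis mult_right_mono powr_ge_zero)
    thus ?thesis using d by simp
  qed
  have one: "(\<integral>t. d \<partial>MI) = d"
    using integral_step(2)[of "\<lambda>_. d" 0] by simp
  have "(\<integral>t. norm (f t) \<partial>MI) \<le> (\<integral>t. d + d powr (1 - p) * cmod (f t) powr p \<partial>MI)"
    using memLp_integrable[OF p f] memLp_integrable_powr[OF f]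
    by (intro integral_mono pt) auto
  also have "\<dots> = d + d powr (1 - p) * Ip p f"
    unfolding Ip_def using memLp_integrable_powr[OF f]
    by (subst Bochner_Integration.integral_add) (auto simp: one simp del: integral_const lebesgue_integral_const)
  finally show ?thesis .
qed

text \<open>The level averages increase and are bounded, so the partial sums are Cauchy in L^p. A
  subsequence converges almost everywhere, Fatou's lemma makes its limit an L^p limit of the whole
  sequence, and continuity of \<open>av\<close> identifies the coefficients.\<close>

lemma coef_realize:
  assumes B: "\<And>K. avg K (\<lambda>n. cmod (val \<xi> n) powr p) \<le> B"
  shows "\<exists>y. memLp p y \<and> (\<forall>n\<ge>1. av y n = val \<xi> n)"
proof -
  define a where "a = (\<lambda>K. avg K (\<lambda>n. cmod (val \<xi> n) powr p))"
  define S where "S = (\<lambda>K t. val \<xi> (node K t))"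
  have Sm: "memLp p (S K)" for K unfolding S_def by (rule memLp_step(1)) simp
  have inc: "incseq a" unfolding a_def by (intro incseq_def[THEN iffD2] allI impI avg_val_mono)
  have "convergent a"
  proof -
    have "\<forall>i. a i \<le> B" using B by (simp add: a_def)
    thus ?thesis using incseq_convergent[OF inc, of B] unfolding convergent_def by blast
  qed
  hence Ca: "Cauchy a" by (rule convergent_Cauchy)
  have small: "\<exists>N. \<forall>K\<ge>N. \<forall>L\<ge>N. Ip p (\<lambda>t. S L t - S K t) \<le> e" if e: "e > 0" for e
  proof -
    have "e / 2 powr p > 0" using e by simp
    then obtain N where N: "\<And>m n. m \<ge> N \<Longrightarrow> n \<ge> N \<Longrightarrow> norm (a m - a n) < e / 2 powr p"
      using Ca unfolding Cauchy_iff by blast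
    have *: "Ip p (\<lambda>t. S L t - S K t) \<le> e" if "K \<ge> N" "K \<le> L" for K L
    proof -
      have "a L - a K \<le> e / 2 powr p" using N[of L K] that by simp
      hence "2 powr p * (a L - a K) \<le> 2 powr p * (e / 2 powr p)" by (intro mult_left_mono) auto
      thus ?thesis using martingale_increment_le[OF that(2), of \<xi>] by (simp add: a_def S_def)
    qed
    have "Ip p (\<lambda>t. S L t - S K t) \<le> e" if "K \<ge> N" "L \<ge> N" for K L
      using *[of K L] *[of L K] that Ip_diff_commute[of p "S L" "S K"] by (cases "K \<le> L") auto
    thus ?thesis by blast
  qed
  obtain r where r: "strict_mono r" and Cr: "AE t in MI. Cauchy (\<lambda>i. S (r i) t)"
  proof (rule cauchy_L1_AE_cauchy_subseq[of MI S])
    show "integrable MI (S n)" for n by (rule memLp_integrable[OF p Sm])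
    fix e :: real assume e: "e > 0"
    define d where "d = e / 3"
    have d: "d > 0" using e by (simp add: d_def)
    hence "d / d powr (1 - p) > 0" by simp
    from small[OF this] obtain N where N: "\<And>K L. K \<ge> N \<Longrightarrow> L \<ge> N \<Longrightarrow> Ip p (\<lambda>t. S L t - S K t) \<le> d / d powr (1 - p)" by blast
    have "(\<integral>t. norm (S i t - S j t) \<partial>MI) < e" if "i \<ge> N" "j \<ge> N" for i j
    proof -
      have "(\<integral>t. norm (S i t - S j t) \<partial>MI) \<le> d + d powr (1 - p) * Ip p (\<lambda>t. S i t - S j t)"
        by (rule L1_le_Ip[OF memLp_diff(1)[OF p Sm Sm] d])
      also have "\<dots> \<le> d + d powr (1 - p) * (d / d powr (1 - p))"
        using N[OF that(2,1)] by (intro add_left_mono mult_left_mono) auto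
      also have "\<dots> = 2 * d" using d by simp
      also have "\<dots> < e" using e by (simp add: d_def)
      finally show ?thesis .
    qed
    thus "\<exists>N. \<forall>i\<ge>N. \<forall>j\<ge>N. (\<integral>t. norm (S i t - S j t) \<partial>MI) < e" by blast
  qed blast
  define y where "y = (\<lambda>t. lim (\<lambda>i. S (r i) t))"
  have ym: "y \<in> borel_measurable MI"
    unfolding y_def using memLp_measurable[OF Sm] by measurable
  have lim: "AE t in MI. (\<lambda>i. S (r i) t) \<longlonglongrightarrow> y t"
    using Cr by eventually_elim (simp add: y_def Cauchy_convergent_iff convergent_LIMSEQ_iff)
  have close: "\<exists>N. \<forall>K\<ge>N. memLp p (\<lambda>t. y t - S K t) \<and> Ip p (\<lambda>t. y t - S K t) \<le> e" if e: "e > 0" for e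
  proof -
    obtain N where N: "\<And>K L. K \<ge> N \<Longrightarrow> L \<ge> N \<Longrightarrow> Ip p (\<lambda>t. S L t - S K t) \<le> e" using small[OF e] by blast
    have "memLp p (\<lambda>t. y t - S K t) \<and> Ip p (\<lambda>t. y t - S K t) \<le> e" if K: "K \<ge> N" for K
    proof -
      have ev: "\<forall>\<^sub>F i in sequentially. Ip p (\<lambda>t. S (r i) t - S K t) \<le> e"
        unfolding eventually_sequentially using N[OF K] seq_suble[OF r] by (meson le_trans)
      have "AE t in MI. (\<lambda>i. S (r i) t - S K t) \<longlonglongrightarrow> y t - S K t"
        using lim by eventually_elim (intro tendsto_intros)
      from fatou_Ip[OF p memLp_diff(1)[OF p Sm Sm] _ this ev] ym memLp_measurable[OF Sm]
      show ?thesis by auto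
    qed
    thus ?thesis by blast
  qed
  have y: "memLp p y"
  proof -
    obtain K where "memLp p (\<lambda>t. y t - S K t)" using close[of 1] by auto
    from memLp_add(1)[OF p this Sm[of K]] show ?thesis by simp
  qed
  have "av y n = val \<xi> n" if n: "1 \<le> n" for n
  proof -
    have "cmod (av y n - val \<xi> n) powr p \<le> 0 + e" if e: "e > 0" for e :: real
    proof -
      let ?k = "floor_log n"
      obtain N where N: "\<And>K. K \<ge> N \<Longrightarrow> memLp p (\<lambda>t. y t - S K t) \<and> Ip p (\<lambda>t. y t - S K t) \<le> e / 2^?k"
        using close[of "e / 2^?k"] e by auto
      define K where "K = max N (Suc ?k)"
      have K: "K \<ge> N" "Suc ?k \<le> K" by (auto simp: K_def)
      have avS: "av (S K) n = val \<xi> n"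
      proof -
        have "av (S K) n = val (level_cut K \<xi>) n"
          by (rule av_val[OF memLp_integrable[OF p Sm] _ n]) (simp add: S_def)
        also have "val (level_cut K \<xi>) n = val \<xi> n"
        proof (rule val_cong)
          fix i assume "2 * i \<le> n"
          moreover have "n < 2^Suc ?k" using level_bounds[OF n] by blast
          moreover have "(2::nat)^?k \<le> 2^K" using K by (intro power_increasing) auto
          ultimately have "i < 2^K" unfolding power_Suc by linarith
          thus "level_cut K \<xi> i = \<xi> i" by (simp add: level_cut_def)
        qed
        finally show ?thesis by simp
      qed
      have "av y n - val \<xi> n = av (\<lambda>t. y t - S K t) n"
        using av_linear[OF memLp_integrable[OF p y] memLp_integrable[OF p Sm[of K]], of 1 "-1" n] avS by simp
      also have "cmod \<dots> powr p \<le> 2^?k * Ip p (\<lambda>t. y t - S K t)"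
        using N[OF K(1)] by (intro av_bound[OF p] n) auto
      also have "\<dots> \<le> 2^?k * (e / 2^?k)" using N[OF K(1)] by (intro mult_left_mono) auto
      finally show ?thesis by simp
    qed
    hence "cmod (av y n - val \<xi> n) powr p \<le> 0" by (rule field_le_epsilon)
    hence "cmod (av y n - val \<xi> n) powr p = 0" using powr_ge_zero order_antisym by blast
    thus ?thesis by simp
  qed
  thus ?thesis using y by blast
qed

end

section \<open>First-order chaoses\<close>

text \<open>The sequence b placed on n, 2n, 4n, ...; for n >= 1 at most one k satisfies m = n * 2^k,
  and then k <= m. With b = c this is the formal coefficient sequence of f_n.\<close>

definition chain_embed :: "nat \<Rightarrow> (nat \<Rightarrow> complex) \<Rightarrow> nat \<Rightarrow> complex" where
  "chain_embed n b m = (\<Sum>k\<le>m. if m = n * 2^k then b k else 0)"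

lemma chain_embed_on [simp]: "1 \<le> n \<Longrightarrow> chain_embed n b (n * 2^k) = b k"
proof -
  assume n: "1 \<le> n"
  have "k \<le> n * 2^k" using n less_exp[of k] by (metis le_trans less_imp_le mult_le_mono1 nat_mult_1)
  moreover have "n * 2^k = n * 2^j \<longleftrightarrow> j = k" for j using n by auto
  ultimately show ?thesis unfolding chain_embed_def by simp
qed

lemma chain_embed_off: "(\<And>k. m \<noteq> n * 2^k) \<Longrightarrow> chain_embed n b m = 0"
  by (simp add: chain_embed_def)

lemma chain_embed_double:
  fixes n m :: nat
  assumes "1 \<le> n" "1 \<le> m"
  shows "(\<exists>k. 2 * m = n * 2^k) \<longleftrightarrow> (2 * m = n \<or> (\<exists>k. m = n * 2^k))"
proof
  assume "\<exists>k. 2 * m = n * 2^k"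
  then obtain k where k: "2 * m = n * 2^k" by blast
  show "2 * m = n \<or> (\<exists>k. m = n * 2^k)"
  proof (cases k)
    case (Suc j)
    hence "m = n * 2^j" using k by simp
    thus ?thesis by blast
  qed (use k in simp)
next
  assume "2 * m = n \<or> (\<exists>k. m = n * 2^k)"
  thus "\<exists>k. 2 * m = n * 2^k"
  proof
    assume "2 * m = n"
    thus ?thesis by (intro exI[of _ 0]) simp
  next
    assume "\<exists>k. m = n * 2^k"
    then obtain k where "m = n * 2^k" by blast
    thus ?thesis by (intro exI[of _ "Suc k"]) simp
  qed
qed

lemma val_chain_embed_root: "1 \<le> n \<Longrightarrow> val (chain_embed n b) n = 0"
proof -
  assume n: "1 \<le> n"
  have "val (chain_embed n b) n = val (\<lambda>_. 0) n"
  proof (rule val_cong)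
    fix i assume i: "1 \<le> i" "2 * i \<le> n"
    have "n \<le> n * 2^k" for k by simp
    hence "i \<noteq> n * 2^k" for k using i n by (metis le_antisym le_trans mult_le_mono1 nat_mult_1 not_less_eq_eq numeral_2_eq_2 one_le_numeral mult_2 add_le_same_cancel1 not_one_le_zero)
    thus "chain_embed n b i = 0" by (rule chain_embed_off)
  qed
  also have "val (\<lambda>_. 0) n = 0" using val_linear[of 0 "\<lambda>_. 0" 0 "\<lambda>_. 0" n] by simp
  finally show ?thesis .
qed

lemma avg_at_power:
  assumes "\<And>n. 0 \<le> F n"
  shows "F (2^k) / 2^k \<le> avg k F"
  unfolding avg_def by (intro divide_right_mono member_le_sum assms) auto

lemma sum_powers_le_tsum:
  assumes "\<And>n. 0 \<le> F n"
  shows "(\<Sum>k<K. F (2^k) / 2^k) \<le> tsum K F"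
  unfolding tsum_def by (intro sum_mono avg_at_power assms)

text \<open>The chain meets each level from that of n on exactly once. The length of the cell of n
  is dropped from the bound.\<close>

lemma avg_chain_embed_le:
  assumes n: "1 \<le> n"
  shows "avg k (\<lambda>m. cmod (chain_embed n b m) powr p) \<le> (if floor_log n \<le> k then wt p b (k - floor_log n) else 0)"
proof -
  let ?l = "floor_log n"
  have l: "2^?l \<le> n" "n < 2^Suc ?l" using level_bounds[OF n] by auto
  have lev: "?l \<le> k \<and> m = n * 2^(k - ?l)" if m: "m = n * 2^j" "2^k \<le> m" "m < 2^Suc k" for m j
  proof -
    have "2^?l * 2^j \<le> m" unfolding m(1) using l(1) by (intro mult_le_mono1)
    moreover have "m < 2^Suc ?l * 2^j" unfolding m(1) using l(2) by (intro mult_less_mono1) auto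
    ultimately have "floor_log m = ?l + j"
      by (intro floor_log_level) (auto simp: power_add)
    moreover have "floor_log m = k" using m by (intro floor_log_level)
    ultimately show ?thesis using m(1) by auto
  qed
  show ?thesis
  proof (cases "?l \<le> k")
    case True
    let ?m = "n * 2^(k - ?l)"
    have "(\<Sum>m=2^k..<2^Suc k. cmod (chain_embed n b m) powr p)
       \<le> (\<Sum>m=2^k..<2^Suc k. if m = ?m then cmod (b (k - ?l)) powr p else 0)"
    proof (rule sum_mono)
      fix m :: nat assume m: "m \<in> {2^k..<2^Suc k}"
      show "cmod (chain_embed n b m) powr p \<le> (if m = ?m then cmod (b (k - ?l)) powr p else 0)"
      proof (cases "m = ?m")
        case False
        hence "m \<noteq> n * 2^j" for j using lev[of m j] m by auto
        hence "chain_embed n b m = 0" by (rule chain_embed_off)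
        thus ?thesis using False by simp
      qed (use n in simp)
    qed
    also have "\<dots> \<le> cmod (b (k - ?l)) powr p" by (subst sum.delta) auto
    finally have "avg k (\<lambda>m. cmod (chain_embed n b m) powr p) \<le> cmod (b (k - ?l)) powr p / 2^k"
      unfolding avg_def by (intro divide_right_mono) auto
    also have "\<dots> \<le> cmod (b (k - ?l)) powr p / 2^(k - ?l)"
      by (intro divide_left_mono power_increasing) auto
    finally show ?thesis using True by (simp add: wt_def)
  next
    case False
    have "(\<Sum>m=2^k..<2^Suc k. cmod (chain_embed n b m) powr p) = 0"
    proof (rule sum.neutral, rule ballI)
      fix m :: nat assume m: "m \<in> {2^k..<2^Suc k}"
      hence "m \<noteq> n * 2^j" for j using lev[of m j] False by auto
      hence "chain_embed n b m = 0" by (rule chain_embed_off)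
      thus "cmod (chain_embed n b m) powr p = 0" by simp
    qed
    thus ?thesis using False by (simp add: avg_def)
  qed
qed

lemma tsum_chain_embed_le:
  assumes n: "1 \<le> n" and b: "summable (wt p b)"
  shows "tsum K (\<lambda>m. cmod (chain_embed n b m) powr p) \<le> suminf (wt p b)"
proof -
  let ?l = "floor_log n"
  have "tsum K (\<lambda>m. cmod (chain_embed n b m) powr p) \<le> (\<Sum>k<K. if ?l \<le> k then wt p b (k - ?l) else 0)"
    unfolding tsum_def by (intro sum_mono avg_chain_embed_le n)
  also have "\<dots> = (\<Sum>k\<in>{?l..<K}. wt p b (k - ?l))"
    by (intro sum.mono_neutral_cong_right) auto
  also have "\<dots> = (\<Sum>k<K - ?l. wt p b k)"
  proof (cases "?l \<le> K")
    case True
    thus ?thesis using sum_shift_interval[of "\<lambda>k. wt p b (k - ?l)" ?l "K - ?l"] by simp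
  qed simp
  also have "\<dots> \<le> suminf (wt p b)" by (rule sum_le_suminf[OF b]) auto
  finally show ?thesis .
qed

section \<open>Algebra of convolution along chains\<close>

lemma odd_power_decomp:
  assumes "1 \<le> (m::nat)"
  obtains r k where "odd r" "m = r * 2^k"
  using assms
proof (induction m arbitrary: thesis rule: less_induct)
  case (less m)
  show ?case
  proof (cases "odd m")
    case True
    thus ?thesis by (intro less.prems(1)[of m 0]) auto
  next
    case False
    then obtain j where j: "m = 2 * j" by blast
    hence "j < m" "1 \<le> j" using less.prems(2) by auto
    then obtain r k where "odd r" "j = r * 2^k" using less.IH by blast
    thus ?thesis using j by (intro less.prems(1)[of r "Suc k"]) auto
  qed
qed

lemma odd_power_unique:
  assumes "odd r" "odd s" "r * 2^k = s * (2^j :: nat)"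
  shows "r = s \<and> k = j"
proof -
  have "k = j" using multiplicity_odd_times[OF assms(1), of k] multiplicity_odd_times[OF assms(2), of j] assms(3) by simp
  thus ?thesis using assms(3) by simp
qed

text \<open>On coefficients this is the statement that the operator takes h_n to f_n.\<close>

lemma tconv_unit:
  assumes n: "1 \<le> n" and m: "1 \<le> m"
  shows "tconv c (\<lambda>i. if i = n then 1 else 0) m = chain_embed n c m"
proof -
  obtain r k where rk: "odd r" "m = r * 2^k" using odd_power_decomp[OF m] .
  obtain s l where sl: "odd s" "n = s * 2^l" using odd_power_decomp[OF n] .
  have iff: "r * 2^j = n \<longleftrightarrow> r = s \<and> j = l" for j
    using odd_power_unique[OF rk(1) sl(1), of j l] sl by auto
  have "tconv c (\<lambda>i. if i = n then 1 else 0) m = (\<Sum>i\<le>k. c i * (if r = s \<and> k - i = l then 1 else 0))"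
    unfolding rk(2) tconv_chain[OF rk(1)] conv_def iff ..
  also have "\<dots> = chain_embed n c m"
  proof (cases "r = s \<and> l \<le> k")
    case True
    have "(\<Sum>i\<le>k. c i * (if r = s \<and> k - i = l then 1 else 0)) = (\<Sum>i\<le>k. if i = k - l then c i else 0)"
      using True by (intro sum.cong) auto
    also have "\<dots> = c (k - l)" using True by simp
    also have "m = n * 2^(k - l)" using True rk sl by (simp flip: power_add)
    hence "c (k - l) = chain_embed n c m" using n by simp
    finally show ?thesis .
  next
    case False
    have "m \<noteq> n * 2^i" for i
    proof
      assume "m = n * 2^i"
      hence "r * 2^k = s * 2^(l + i)" using rk sl by (simp add: power_add)
      from odd_power_unique[OF rk(1) sl(1) this] False show False by auto
    qed
    hence "chain_embed n c m = 0" by (rule chain_embed_off)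
    moreover have "(\<Sum>i\<le>k. c i * (if r = s \<and> k - i = l then 1 else 0)) = 0"
      using False by (intro sum.neutral) auto
    ultimately show ?thesis by simp
  qed
  finally show ?thesis .
qed

lemma conv_fps: "conv a b k = fps_nth (Abs_fps a * Abs_fps b) k"
  by (simp add: conv_def fps_mult_nth atLeast0AtMost)

text \<open>Convolution is multiplication of formal power series, which is commutative and
  associative, so a right inverse of c works on both sides.\<close>

lemma conv_inverse:
  assumes "conv c e = (\<lambda>k. unit_seq k)"
  shows "conv e (conv c b) = b" "conv c (conv e b) = b"
proof -
  have "Abs_fps c * Abs_fps e = 1"
    by (rule fps_ext) (simp add: assms flip: conv_fps)
  moreover have *: "Abs_fps (conv x b) = Abs_fps x * Abs_fps b" for x b
    by (rule fps_ext) (simp add: conv_fps)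
  ultimately have "Abs_fps e * (Abs_fps c * Abs_fps b) = Abs_fps b" "Abs_fps c * (Abs_fps e * Abs_fps b) = Abs_fps b"
    by (simp_all only: mult.assoc[symmetric] mult.commute[of "Abs_fps e" "Abs_fps c"] mult_1_left)
  hence "Abs_fps (conv e (conv c b)) = Abs_fps b" "Abs_fps (conv c (conv e b)) = Abs_fps b"
    by (simp_all only: *)
  thus "conv e (conv c b) = b" "conv c (conv e b) = b"
    by (simp_all add: fps_eq_iff fun_eq_iff)
qed

lemma tconv_inverse:
  assumes "conv c e = (\<lambda>k. unit_seq k)" "1 \<le> m"
  shows "tconv e (tconv c \<xi>) m = \<xi> m" "tconv c (tconv e \<xi>) m = \<xi> m"
proof -
  obtain r k where rk: "odd r" "m = r * 2^k" using odd_power_decomp[OF assms(2)] .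
  have "tconv x (tconv y \<xi>) m = conv x (conv y (\<lambda>j. \<xi> (r * 2^j))) k" for x y
    unfolding rk(2) tconv_chain[OF rk(1)] ..
  thus "tconv e (tconv c \<xi>) m = \<xi> m" "tconv c (tconv e \<xi>) m = \<xi> m"
    using conv_inverse[OF assms(1)] rk(2) by auto
qed

lemma tconv_linear: "tconv c (\<lambda>n. a * \<xi> n + b * \<zeta> n) m = a * tconv c \<xi> m + b * tconv c \<zeta> m"
  by (simp add: tconv_def sum_distrib_left sum.distrib algebra_simps)

context
  fixes p :: real
  assumes p: "2 \<le> p"
begin

text \<open>The upper half of the norm equivalence on one chain. In the two-point sum only nodes
  with \<eta> nonzero count, and these lie on the chain, where \<open>val\<close> is the sum
  controlled by the Hardy inequality.\<close>

lemma avg_val_chain_embed_bounded: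
  assumes n: "1 \<le> n" and b: "summable (wt p b)"
  shows "\<exists>B. \<forall>K. avg K (\<lambda>m. cmod (val (chain_embed n b) m) powr p) \<le> B"
proof -
  obtain C where C: "C \<ge> 0" and hardy: "\<forall>K (\<beta> :: nat \<Rightarrow> complex) \<eta>. (\<forall>n. odd n \<longrightarrow> \<beta> n = 0)
    \<longrightarrow> (\<forall>n\<ge>1. \<beta> (2 * n) = \<beta> n + \<eta> n)
    \<longrightarrow> tsum K (\<lambda>n. cmod (\<beta> n) powr p) \<le> C * tsum K (\<lambda>n. cmod (\<eta> n) powr p)"
    using tsum_hardy[OF p] by blast
  define \<eta> where "\<eta> = chain_embed n b"
  \<comment> \<open>Off the chain the martingale keeps its last value; setting it to 0 there
    produces the vanishing at odd children on which the contraction rests.\<close>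
  define \<beta> where "\<beta> = (\<lambda>m. if \<exists>k. m = n * 2^k then val \<eta> m else 0)"
  have root: "val \<eta> n = 0" unfolding \<eta>_def by (rule val_chain_embed_root[OF n])
  have odd: "\<beta> m = 0" if "odd m" for m
  proof (cases "\<exists>k. m = n * 2^k")
    case True
    then obtain k where k: "m = n * 2^k" by blast
    hence "k = 0" using that by (cases k) auto
    thus ?thesis using k root by (simp add: \<beta>_def)
  qed (simp add: \<beta>_def)
  have dbl: "\<beta> (2 * m) = \<beta> m + \<eta> m" if "1 \<le> m" for m
  proof (cases "\<exists>k. m = n * 2^k")
    case True
    thus ?thesis using chain_embed_double[OF n that] that by (auto simp: \<beta>_def)
  next
    case False
    hence "\<eta> m = 0" "\<beta> m = 0" unfolding \<eta>_def by (auto simp: \<beta>_def intro!: chain_embed_off)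
    moreover have "\<beta> (2 * m) = 0"
      using chain_embed_double[OF n that] False root by (auto simp: \<beta>_def)
    ultimately show ?thesis by simp
  qed
  define W where "W = suminf (wt p b)"
  have "avg K (\<lambda>m. cmod (val \<eta> m) powr p) \<le> p^2 * (2 powr p * (C * W + W) + W)" for K
  proof -
    have "avg K (\<lambda>m. cmod (val \<eta> m) powr p) \<le> tsum K (\<lambda>m. p^2 * (cmod (val \<eta> m) + cmod (\<eta> m)) powr (p - 2) * (cmod (\<eta> m))^2)"
      by (rule avg_val_le_tsum[OF p])
    also have "\<dots> \<le> tsum K (\<lambda>m. p^2 * (2 powr p * (cmod (\<beta> m) powr p + cmod (\<eta> m) powr p) + cmod (\<eta> m) powr p))"
    proof (rule tsum_mono)
      fix m :: nat assume m: "1 \<le> m"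
      show "p^2 * (cmod (val \<eta> m) + cmod (\<eta> m)) powr (p - 2) * (cmod (\<eta> m))^2
         \<le> p^2 * (2 powr p * (cmod (\<beta> m) powr p + cmod (\<eta> m) powr p) + cmod (\<eta> m) powr p)"
      proof (cases "\<exists>k. m = n * 2^k")
        case True
        hence "val \<eta> m = \<beta> m" by (simp add: \<beta>_def)
        moreover have "(cmod (\<beta> m) + cmod (\<eta> m)) powr (p - 2) * (cmod (\<eta> m))^2
          \<le> (cmod (\<beta> m) + cmod (\<eta> m)) powr p + cmod (\<eta> m) powr p"
          using p by (intro powr_sq_le) auto
        moreover have "(cmod (\<beta> m) + cmod (\<eta> m)) powr p \<le> 2 powr p * (cmod (\<beta> m) powr p + cmod (\<eta> m) powr p)"
          using p by (intro powr_add_le) auto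
        ultimately have "(cmod (val \<eta> m) + cmod (\<eta> m)) powr (p - 2) * (cmod (\<eta> m))^2
          \<le> 2 powr p * (cmod (\<beta> m) powr p + cmod (\<eta> m) powr p) + cmod (\<eta> m) powr p" by simp
        hence "p^2 * ((cmod (val \<eta> m) + cmod (\<eta> m)) powr (p - 2) * (cmod (\<eta> m))^2)
          \<le> p^2 * (2 powr p * (cmod (\<beta> m) powr p + cmod (\<eta> m) powr p) + cmod (\<eta> m) powr p)"
          by (intro mult_left_mono) auto
        thus ?thesis by (simp only: mult.assoc)
      next
        case False
        hence "\<eta> m = 0" unfolding \<eta>_def by (auto intro!: chain_embed_off)
        thus ?thesis by simp
      qed
    qed
    also have "\<dots> = p^2 * (2 powr p * (tsum K (\<lambda>m. cmod (\<beta> m) powr p) + tsum K (\<lambda>m. cmod (\<eta> m) powr p)) + tsum K (\<lambda>m. cmod (\<eta> m) powr p))"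
      by (simp only: tsum_cmult tsum_add)
    also have "\<dots> \<le> p^2 * (2 powr p * (C * W + W) + W)"
    proof -
      have W: "tsum K (\<lambda>m. cmod (\<eta> m) powr p) \<le> W"
        unfolding \<eta>_def W_def by (rule tsum_chain_embed_le[OF n b])
      have "tsum K (\<lambda>m. cmod (\<beta> m) powr p) \<le> C * tsum K (\<lambda>m. cmod (\<eta> m) powr p)"
        using hardy odd dbl by blast
      also have "\<dots> \<le> C * W" using W C by (intro mult_left_mono)
      finally show ?thesis using W by (intro mult_left_mono add_mono) auto
    qed
    finally show ?thesis .
  qed
  thus ?thesis unfolding \<eta>_def by blast
qed

lemma Ip_av_zero:
  assumes x: "memLp p x" and "\<And>n. 1 \<le> n \<Longrightarrow> av x n = 0"
  shows "Ip p x = 0"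
proof -
  have "Ip p (\<lambda>t. x t - av x (node K t)) = Ip p x" for K
    by (rule memLp_cong(2)) (use assms(2) node_pos in simp)
  hence "(\<lambda>K::nat. Ip p x) \<longlonglongrightarrow> 0" using martingale_tendsto[OF p x] by simp
  thus ?thesis by (simp add: LIMSEQ_const_iff)
qed

lemma Ip_av_eq:
  assumes "memLp p x" "memLp p y" "\<And>n. 1 \<le> n \<Longrightarrow> av x n = av y n"
  shows "Ip p (\<lambda>t. x t - y t) = 0"
proof (rule Ip_av_zero)
  show "memLp p (\<lambda>t. x t - y t)" by (rule memLp_diff(1)[OF p assms(1,2)])
  fix n :: nat assume "1 \<le> n"
  thus "av (\<lambda>t. x t - y t) n = 0"
    using av_linear[OF memLp_integrable[OF p assms(1)] memLp_integrable[OF p assms(2)], of 1 "-1" n] assms(3)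
    by simp
qed

lemma av_eq_of_Ip:
  assumes "memLp p x" "memLp p y" "Ip p (\<lambda>t. x t - y t) = 0" "1 \<le> n"
  shows "av x n = av y n"
proof -
  have "cmod (av (\<lambda>t. x t - y t) n) powr p \<le> 0"
    using av_bound[OF p memLp_diff(1)[OF p assms(1,2)] assms(4)] assms(3) by simp
  hence "cmod (av (\<lambda>t. x t - y t) n) powr p = 0" using powr_ge_zero order_antisym by blast
  thus ?thesis
    using av_linear[OF memLp_integrable[OF p assms(1)] memLp_integrable[OF p assms(2)], of 1 "-1" n] by simp
qed

text \<open>Level-wise estimates pass to the functions because averages converge in L^p; the factor
  2^p is that of the triangle inequality for \<open>Ip\<close>.\<close>

lemma Ip_transfer:
  assumes x: "memLp p x" and y: "memLp p y" and C: "0 \<le> C"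
    and le: "\<And>K. avg K (\<lambda>n. cmod (av y n) powr p) \<le> C * avg K (\<lambda>n. cmod (av x n) powr p)"
  shows "Ip p y \<le> 2 powr p * C * Ip p x"
proof -
  have le': "Ip p y \<le> 2 powr p * (Ip p (\<lambda>t. y t - av y (node K t)) + C * Ip p x)" for K
  proof -
    have aK: "memLp p (\<lambda>t. av y (node K t))" by (rule memLp_step(1)[where K=K]) simp
    have "Ip p y = Ip p (\<lambda>t. (y t - av y (node K t)) + av y (node K t))" by simp
    also have "\<dots> \<le> 2 powr p * (Ip p (\<lambda>t. y t - av y (node K t)) + Ip p (\<lambda>t. av y (node K t)))"
      by (rule memLp_add(2)[OF p memLp_diff(1)[OF p y aK] aK])
    also have "Ip p (\<lambda>t. av y (node K t)) = avg K (\<lambda>n. cmod (av y n) powr p)"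
      by (rule memLp_step(2)) simp
    also have "\<dots> \<le> C * Ip p x"
      by (rule order_trans[OF le mult_left_mono[OF avg_av_le_Ip[OF p x] C]])
    finally show ?thesis by simp
  qed
  have lim: "(\<lambda>K. 2 powr p * (Ip p (\<lambda>t. y t - av y (node K t)) + C * Ip p x)) \<longlonglongrightarrow> 2 powr p * (0 + C * Ip p x)"
    by (intro tendsto_intros martingale_tendsto[OF p y])
  have "Ip p y \<le> 2 powr p * (0 + C * Ip p x)"
    by (rule LIMSEQ_le_const[OF lim]) (use le' in blast)
  thus ?thesis by simp
qed

text \<open>Identifies a function given by a pointwise limit with one known through its averages: y
  - av y tends to 0 in L^p and to y - h pointwise, so Fatou's lemma gives y = h almost
  everywhere.\<close>

lemma martingale_pointwise:
  assumes y: "memLp p y" and lim: "\<And>t. t \<in> unitI \<Longrightarrow> (\<lambda>K. av y (node K t)) \<longlonglongrightarrow> h t"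
  shows "memLp p h" and "Ip p (\<lambda>t. y t - h t) = 0"
proof -
  have aK: "memLp p (\<lambda>t. av y (node K t))" for K by (rule memLp_step(1)[where K=K]) simp
  have hm: "h \<in> borel_measurable MI"
    by (rule borel_measurable_LIMSEQ_metric[of "\<lambda>K t. av y (node K t)"])
      (use memLp_measurable[OF aK] lim in auto)
  have "AE t in MI. (\<lambda>K. y t - av y (node K t)) \<longlonglongrightarrow> y t - h t"
    by (intro AE_I2 tendsto_intros lim) simp
  note F = fatou_Ip[OF p memLp_diff(1)[OF p y aK] _ this]
  have dm: "(\<lambda>t. y t - h t) \<in> borel_measurable MI" using hm memLp_measurable[OF y] by measurable
  have ev: "\<forall>\<^sub>F K in sequentially. Ip p (\<lambda>t. y t - av y (node K t)) \<le> e" if "e > 0" for e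
    using order_tendstoD(2)[OF martingale_tendsto[OF p y] that] by eventually_elim simp
  have d: "memLp p (\<lambda>t. y t - h t)" using F(1)[OF dm ev[of 1]] by simp
  have "Ip p (\<lambda>t. y t - h t) \<le> 0 + e" if "e > 0" for e
    using F(2)[OF dm ev[OF that]] by simp
  hence "Ip p (\<lambda>t. y t - h t) \<le> 0" by (rule field_le_epsilon)
  thus "Ip p (\<lambda>t. y t - h t) = 0" using Ip_nonneg[of p "\<lambda>t. y t - h t"] by linarith
  show "memLp p h" using memLp_diff(1)[OF p y d] by simp
qed

end

section \<open>Closed spans of Haar functions\<close>

lemma node_div: "t \<in> unitI \<Longrightarrow> node (l + j) t div 2^j = node l t"
proof (induction j)
  case (Suc j)
  have "node (l + Suc j) t div 2^Suc j = node (Suc (l + j)) t div 2 div 2^j"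
    by (simp add: div_mult2_eq)
  thus ?case using Suc node_Suc_div[of t "l + j"] by simp
qed simp

lemma floor_log_mult_power: "1 \<le> n \<Longrightarrow> floor_log (n * 2^k) = floor_log n + k"
proof -
  assume n: "1 \<le> n"
  have "2^floor_log n * 2^k \<le> n * 2^k" "n * 2^k < 2^Suc (floor_log n) * 2^k"
    using level_bounds[OF n] by (auto intro!: mult_le_mono1 mult_less_mono1 simp del: power_Suc)
  thus ?thesis by (intro floor_log_level) (auto simp: power_add)
qed

text \<open>The subtree below n is a copy of the whole tree. The term 2^K stands on the left to
  avoid truncated subtraction.\<close>

lemma node_scale:
  assumes n: "1 \<le> n" and t: "t \<in> unitI" and nt: "node (floor_log n) t = n"
  defines "s \<equiv> 2^floor_log n * t - real (n - 2^floor_log n)"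
  shows "node (floor_log n + K) t + 2^K = n * 2^K + node K s"
proof -
  let ?l = "floor_log n"
  have s: "s \<in> unitI" unfolding s_def by (rule dil_arg[OF n t nt])
  have ge: "2^K \<le> node K s" by (rule node_ge[OF s])
  have l: "2^?l \<le> n" using level_bounds[OF n] by blast
  have "2^(?l + K) * (1 + t) = 2^K * (1 + s) + 2^K * real n - 2^K"
    using l by (simp add: s_def of_nat_diff power_add algebra_simps)
  moreover have "real (n * 2^K + node K s - 2^K) = real (node K s) + 2^K * real n - 2^K"
    using ge by (simp add: of_nat_diff)
  ultimately have "node (?l + K) t = n * 2^K + node K s - 2^K"
    using node_bounds[OF s, of K] unfolding node_eq_iff[OF t] by simp
  thus ?thesis using ge by simp
qed

text \<open>Self-similarity of the Haar system; it makes f_n the series of c_k times the Haar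
  functions on the chain of n.\<close>

lemma haar_scale:
  assumes n: "1 \<le> n" and t: "t \<in> unitI"
  shows "haar (n * 2^k) t = dil (haar (2^k)) n t"
proof -
  let ?l = "floor_log n"
  have nk: "1 \<le> n * 2^k" using n by simp
  have h: "haar (n * 2^k) t = (if node (?l + Suc k) t = 2 * (n * 2^k) then 1
    else if node (?l + Suc k) t = Suc (2 * (n * 2^k)) then -1 else 0)"
    using haar_node[OF nk t] by (simp add: floor_log_mult_power[OF n])
  show ?thesis
  proof (cases "node ?l t = n")
    case True
    define s where "s = 2^?l * t - real (n - 2^?l)"
    have s: "s \<in> unitI" unfolding s_def by (rule dil_arg[OF n t True])
    have "node (?l + Suc k) t + 2^Suc k = n * 2^Suc k + node (Suc k) s"
      using node_scale[OF n t True, of "Suc k"] by (simp only: s_def)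
    hence "node (?l + Suc k) t = 2 * (n * 2^k) \<longleftrightarrow> node (Suc k) s = 2 * 2^k"
      "node (?l + Suc k) t = Suc (2 * (n * 2^k)) \<longleftrightarrow> node (Suc k) s = Suc (2 * 2^k)" by auto
    moreover have "dil (haar (2^k)) n t = haar (2^k) s"
      using True by (simp add: dil_node[OF n t] s_def)
    moreover have "haar (2^k) s = (if node (Suc k) s = 2 * 2^k then 1 else if node (Suc k) s = Suc (2 * 2^k) then -1 else 0)"
      using haar_node[OF _ s, of "2^k"] by simp
    ultimately show ?thesis using h by simp
  next
    case False
    have "node (?l + Suc k) t div 2^Suc k \<noteq> n" using node_div[OF t, of ?l "Suc k"] False by simp
    moreover have "2 * (n * 2^k) div 2^Suc k = n" by simp
    moreover have "Suc (2 * (n * 2^k)) div 2^Suc k = n"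
      by (simp add: div_mult2_eq)
    ultimately have "haar (n * 2^k) t = 0" unfolding h by auto
    thus ?thesis using False by (simp add: dil_node[OF n t])
  qed
qed

lemma haar_power_eventually_zero:
  assumes s: "s \<in> unitI"
  shows "\<exists>k0. \<forall>k\<ge>k0. haar (2^k) s = 0"
proof -
  obtain k0 where k0: "1 / s < 2^k0" using real_arch_pow[of 2 "1 / s"] by auto
  have "haar (2^k) s = 0" if "k \<ge> k0" for k
  proof -
    have "(2::real)^k0 \<le> 2^k" using that by (intro power_increasing) auto
    hence "2^k0 * s \<le> 2^k * s" using s by (intro mult_right_mono) (auto simp: unitI_def)
    moreover have "1 < 2^k0 * s" using k0 s by (simp add: unitI_def field_simps)
    ultimately have "1 < 2^k * s" by linarith
    hence "real (2^Suc k) + 2 < 2^Suc k * (1 + s)" by (simp add: algebra_simps)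
    hence "real (2^Suc k) + 1 < real (node (Suc k) s)" using node_bounds(2)[OF s, of "Suc k"] by linarith
    hence "real (2^Suc k + 1) < real (node (Suc k) s)" by simp
    hence "2^Suc k + 1 < node (Suc k) s" by (simp only: of_nat_less_iff)
    thus ?thesis using haar_node[OF _ s, of "2^k"] by auto
  qed
  thus ?thesis by blast
qed

lemma val_chain_embed_node:
  assumes n: "1 \<le> n" and t: "t \<in> unitI"
  shows "val (chain_embed n c) (node K t) = (\<Sum>k<K - floor_log n. c k * haar (n * 2^k) t)"
proof -
  let ?l = "floor_log n" and ?g = "\<lambda>k. n * 2^k"
  have inj: "inj_on ?g A" for A using n by (auto simp: inj_on_def)
  have lev: "?g k < 2^K \<longleftrightarrow> k < K - ?l" for k
  proof -
    have "1 \<le> ?g k" using n by simp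
    from level_bounds[OF this] have b: "2^(?l + k) \<le> ?g k" "?g k < 2^Suc (?l + k)"
      by (auto simp: floor_log_mult_power[OF n])
    show ?thesis
    proof
      assume "?g k < 2^K"
      hence "(2::nat)^(?l + k) < 2^K" using b by linarith
      hence "?l + k < K" by simp
      thus "k < K - ?l" by simp
    next
      assume "k < K - ?l"
      hence "(2::nat)^Suc (?l + k) \<le> 2^K" by (intro power_increasing) auto
      thus "?g k < 2^K" using b by linarith
    qed
  qed
  have "val (chain_embed n c) (node K t) = (\<Sum>m=1..<2^K. chain_embed n c m * haar m t)"
    using haar_sum_level[OF t, where \<xi>="chain_embed n c" and K=K] by (rule sym)
  also have "\<dots> = (\<Sum>m\<in>?g ` {..<K - ?l}. chain_embed n c m * haar m t)"
  proof (rule sum.mono_neutral_right)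
    show "?g ` {..<K - ?l} \<subseteq> {1..<2^K}"
    proof (rule image_subsetI)
      fix k assume "k \<in> {..<K - ?l}"
      hence "?g k < 2^K" using lev by blast
      moreover have "1 \<le> ?g k" using n by simp
      ultimately show "?g k \<in> {1..<2^K}" by (simp only: atLeastLessThan_iff)
    qed
    show "\<forall>m\<in>{1..<2^K} - ?g ` {..<K - ?l}. chain_embed n c m * haar m t = 0"
    proof
      fix m assume m: "m \<in> {1..<2^K} - ?g ` {..<K - ?l}"
      have "m \<noteq> n * 2^k" for k
      proof
        assume "m = n * 2^k"
        hence "k \<in> {..<K - ?l}" using m lev[of k] by (simp only: Diff_iff atLeastLessThan_iff lessThan_iff)
        thus False using m \<open>m = n * 2^k\<close> by blast
      qed
      thus "chain_embed n c m * haar m t = 0" using chain_embed_off[of m n c] by simp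
    qed
  qed simp
  also have "\<dots> = (\<Sum>k<K - ?l. chain_embed n c (?g k) * haar (?g k) t)"
    by (subst sum.reindex[OF inj]) simp
  finally show ?thesis using n by simp
qed

text \<open>The sequence is eventually constant, since at each point only finitely many terms of the
  chaos are nonzero.\<close>

lemma dil_chaos_tendsto:
  assumes n: "1 \<le> n" and t: "t \<in> unitI"
  shows "(\<lambda>K. val (chain_embed n c) (node K t)) \<longlonglongrightarrow> dil (chaos1 c) n t"
proof -
  let ?l = "floor_log n"
  have "\<exists>K0. \<forall>K\<ge>K0. val (chain_embed n c) (node K t) = dil (chaos1 c) n t"
  proof (cases "node ?l t = n")
    case True
    define s where "s = 2^?l * t - real (n - 2^?l)"
    have s: "s \<in> unitI" unfolding s_def by (rule dil_arg[OF n t True])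
    obtain k0 where k0: "\<forall>k\<ge>k0. haar (2^k) s = 0" using haar_power_eventually_zero[OF s] by blast
    have D: "dil g n t = g s" for g using True by (simp add: dil_node[OF n t] s_def)
    have "val (chain_embed n c) (node K t) = dil (chaos1 c) n t" if "K \<ge> k0 + ?l" for K
    proof -
      have "dil (chaos1 c) n t = (\<Sum>k<K - ?l. c k * haar (2^k) s)"
        unfolding D chaos1_def by (rule suminf_finite) (use k0 that in auto)
      also have "\<dots> = val (chain_embed n c) (node K t)"
        unfolding val_chain_embed_node[OF n t] haar_scale[OF n t] D ..
      finally show ?thesis by simp
    qed
    thus ?thesis by blast
  next
    case False
    thus ?thesis
      unfolding val_chain_embed_node[OF n t] haar_scale[OF n t] by (simp add: dil_node[OF n t])
  qed
  thus ?thesis by (intro tendsto_eventually) (auto simp: eventually_sequentially)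
qed

lemma dil_1: "t \<in> unitI \<Longrightarrow> dil f (Suc 0) t = f t"
  using dil_node[of "Suc 0" t f] by simp

text \<open>A path outside the leftmost cell has left the chain of 1 for good, so no later term of
  the series contributes.\<close>

lemma chaos1_node:
  assumes t: "t \<in> unitI" and K: "node K t \<noteq> 2^K"
  shows "chaos1 c t = val (chain_embed 1 c) (node K t)"
proof -
  have "val (chain_embed 1 c) (node L t) = val (chain_embed 1 c) (node K t) \<and> node L t \<noteq> 2^L" if "K \<le> L" for L
    using that
  proof (induction L rule: dec_induct)
    case (step L)
    have "node L t \<noteq> 1 * 2^j" for j
    proof
      assume eq: "node L t = 1 * 2^j"
      hence "(2::nat)^L \<le> 2^j" "(2::nat)^j < 2^Suc L" using node_ge[OF t, of L] node_less[OF t, of L] by auto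
      hence "L \<le> j" "j < Suc L"
        using power_le_imp_le_exp[of "2::nat" L j] power_less_imp_less_exp[of "2::nat" j "Suc L"] by simp_all
      hence "j = L" by simp
      thus False using step.IH eq by simp
    qed
    hence z: "chain_embed 1 c (node L t) = 0" by (rule chain_embed_off)
    have "node (Suc L) t \<noteq> 2^Suc L" using node_Suc_div[OF t, of L] step.IH by auto
    moreover have "val (chain_embed 1 c) (node (Suc L) t) = val (chain_embed 1 c) (node L t)"
      using node_Suc_cases[OF t, of L]
    proof
      assume "node (Suc L) t = 2 * node L t"
      thus ?thesis using val_double[OF node_pos[OF t], of "chain_embed 1 c" L] z by simp
    next
      assume "node (Suc L) t = Suc (2 * node L t)"
      thus ?thesis using val_double_1[OF node_pos[OF t], of "chain_embed 1 c" L] z by simp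
    qed
    ultimately show ?case using step.IH by simp
  qed (use K in simp)
  hence "(\<lambda>L. val (chain_embed 1 c) (node L t)) \<longlonglongrightarrow> val (chain_embed 1 c) (node K t)"
    by (intro tendsto_eventually eventually_sequentiallyI[of K]) blast
  moreover have "(\<lambda>L. val (chain_embed 1 c) (node L t)) \<longlonglongrightarrow> chaos1 c t"
    using dil_chaos_tendsto[of 1 t c] t by (simp add: dil_1)
  ultimately show ?thesis using LIMSEQ_unique by blast
qed

text \<open>A pointwise convergent chaos need not have mean zero: \<open>c\<^sub>0 = 1\<close>, \<open>c\<^sub>k = 2\<^sup>k\<^sup>-\<^sup>1\<close> gives minus the
  indicator of \<open>(1/2, 1]\<close>.  The mean is the only obstruction to \<open>c\<close> being the sequence of Haar
  coefficients.\<close>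

lemma av_chaos1:
  assumes f: "integrable MI (chaos1 c)"
  shows "2^K < n \<Longrightarrow> n < 2^Suc K \<Longrightarrow> av (chaos1 c) n = val (chain_embed 1 c) n"
    and "av (chaos1 c) (2^k) = val (chain_embed 1 c) (2^k) + 2^k * av (chaos1 c) (Suc 0)"
proof -
  have off: "av (chaos1 c) n = val (chain_embed 1 c) n" if n: "2^K < n" "n < 2^Suc K" for n K
  proof -
    have "(LINT t:level_cell K n|MI. chaos1 c t) = (LINT t:level_cell K n|MI. val (chain_embed 1 c) (node K t))"
      unfolding set_lebesgue_integral_def
    proof (intro Bochner_Integration.integral_cong refl)
      fix t
      show "indicator (level_cell K n) t *\<^sub>R chaos1 c t = indicator (level_cell K n) t *\<^sub>R val (chain_embed 1 c) (node K t)"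
        using chaos1_node[of t K c] n by (auto simp: indicator_def level_cell_def)
    qed
    moreover have "floor_log n = K" using n by (intro floor_log_level) auto
    ultimately have "av (chaos1 c) n = av (\<lambda>t. val (chain_embed 1 c) (node K t)) n"
      by (simp add: av_def)
    also have "\<dots> = val (chain_embed 1 c) n"
      by (rule av_step[where K=K and \<phi>="val (chain_embed 1 c)"]) (use n in auto)
    finally show ?thesis .
  qed
  show "2^K < n \<Longrightarrow> n < 2^Suc K \<Longrightarrow> av (chaos1 c) n = val (chain_embed 1 c) n" by (rule off)
  show "av (chaos1 c) (2^k) = val (chain_embed 1 c) (2^k) + 2^k * av (chaos1 c) (Suc 0)"
  proof (induction k)
    case (Suc k)
    let ?m = "2^k :: nat" and ?f = "chaos1 c" and ?v = "val (chain_embed 1 c)"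
    \<comment> \<open>The odd child of 2^k lies off the leftmost path, so its average is already
      known. Splitting the parent then shows that the deviation on the leftmost path doubles from
      level to level.\<close>
    have "av ?f (Suc (2 * ?m)) = ?v (Suc (2 * ?m))"
    proof (rule off[of "Suc k"])
      have "(1::nat) \<le> 2^k" by simp
      thus "Suc (2 * ?m) < 2^Suc (Suc k)" unfolding power_Suc by linarith
    qed simp
    moreover have "?v (2 * ?m) + ?v (Suc (2 * ?m)) = 2 * ?v ?m" by simp
    moreover have "av ?f (2 * ?m) + av ?f (Suc (2 * ?m)) = 2 * av ?f ?m"
      using av_split[OF f, of ?m] by (simp add: mult.commute)
    moreover have "u2 = 2 * u - (2 * w - w2)" if "u1 = w1" "w2 + w1 = 2 * w" "u2 + u1 = 2 * u"
      for u u1 u2 w w1 w2 :: complex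
    proof -
      have "u2 = 2 * u - u1" "2 * w - w2 = w1"
        unfolding that(2)[symmetric] that(3)[symmetric] by simp_all
      thus ?thesis using that(1) by simp
    qed
    ultimately have "av ?f (2 * ?m) = 2 * av ?f ?m - (2 * ?v ?m - ?v (2 * ?m))" by blast
    thus ?case using Suc.IH by simp
  qed simp
qed

lemma av_chaos1_mean_zero:
  assumes "integrable MI (chaos1 c)" "av (chaos1 c) (Suc 0) = 0" "1 \<le> n"
  shows "av (chaos1 c) n = val (chain_embed 1 c) n"
proof (cases "n = 2^floor_log n")
  case True
  thus ?thesis using av_chaos1(2)[OF assms(1), of "floor_log n"] assms(2) by simp
next
  case False
  thus ?thesis using av_chaos1(1)[OF assms(1), of "floor_log n" n] level_bounds[OF assms(3)] by auto
qed

lemma zero_of_small_powr: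
  assumes "\<And>e. e > 0 \<Longrightarrow> cmod z powr p \<le> c * e" "c > 0"
  shows "z = 0"
proof -
  have "cmod z powr p \<le> 0 + e" if "e > 0" for e
    using assms(1)[of "e / c"] assms(2) that by simp
  hence "cmod z powr p \<le> 0" by (rule field_le_epsilon)
  hence "cmod z powr p = 0" using powr_ge_zero order_antisym by blast
  thus ?thesis by simp
qed

context
  fixes p :: real
  assumes p: "2 \<le> p"
begin

lemma haar_poly:
  assumes F: "finite F" "F \<subseteq> {1..}"
  shows "memLp p (\<lambda>t. \<Sum>n\<in>F. a n * haar n t)"
    and "1 \<le> m \<Longrightarrow> av (\<lambda>t. \<Sum>n\<in>F. a n * haar n t) m = val (\<lambda>n. if n \<in> F then a n else 0) m"
proof -
  obtain K where "F \<subseteq> {..<2^K}" using finite_level_bound[OF F(1)] by blast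
  hence K: "F \<subseteq> {1..<2^K}" using F by auto
  let ?\<xi> = "\<lambda>n. if n \<in> F then a n else 0"
  have eq: "(\<Sum>n\<in>F. a n * haar n t) = val ?\<xi> (node K t)" if "t \<in> unitI" for t
    by (rule haar_sum_finite[OF F(1) K that])
  show m: "memLp p (\<lambda>t. \<Sum>n\<in>F. a n * haar n t)" by (rule memLp_step(1)) (rule eq)
  have "level_cut K ?\<xi> = ?\<xi>" using K by (auto simp: level_cut_def fun_eq_iff)
  thus "av (\<lambda>t. \<Sum>n\<in>F. a n * haar n t) m = val ?\<xi> m" if "1 \<le> m"
    using av_val[where \<xi>="?\<xi>" and K=K, OF memLp_integrable[OF p m] _ that] eq by simp
qed

lemma coef_bound:
  assumes f: "memLp p f" and n: "1 \<le> n"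
  shows "cmod (coef f n) powr p \<le> 2^Suc (floor_log n) * Ip p f"
proof -
  have fl: "floor_log (2 * n) = Suc (floor_log n)" "floor_log (Suc (2 * n)) = Suc (floor_log n)"
    using n level_bounds[OF n] by (auto intro!: floor_log_level)
  have "cmod (coef f n) \<le> (cmod (av f (2 * n)) + cmod (av f (Suc (2 * n)))) / 2"
    using norm_triangle_ineq4[of "av f (2 * n)" "av f (Suc (2 * n))"] by (simp add: coef_def norm_divide)
  hence "cmod (coef f n) powr p \<le> ((cmod (av f (2 * n)) + cmod (av f (Suc (2 * n)))) / 2) powr p"
    using p by (intro powr_mono2) auto
  also have "\<dots> \<le> (cmod (av f (2 * n)) powr p + cmod (av f (Suc (2 * n))) powr p) / 2"
    using p by (intro powr_midpoint) auto
  also have "\<dots> \<le> 2^Suc (floor_log n) * Ip p f"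
    using av_bound[OF p f, of "2 * n"] av_bound[OF p f, of "Suc (2 * n)"] n by (simp add: fl)
  finally show ?thesis .
qed

text \<open>Mean and Haar coefficients are continuous and vanish off N on the approximating sums.
  Conversely the level averages of g are finite Haar sums supported in N and converge to g.\<close>

lemma cspan_haar_iff:
  assumes N: "N \<subseteq> {1..}"
  shows "g \<in> cspan p haar N \<longleftrightarrow> memLp p g \<and> av g (Suc 0) = 0 \<and> (\<forall>n\<ge>1. n \<notin> N \<longrightarrow> coef g n = 0)"
    (is "?L \<longleftrightarrow> ?R")
proof
  assume L: ?L
  hence g: "memLp p g" by (simp add: cspan_def)
  have approx: "\<exists>F a. finite F \<and> F \<subseteq> N \<and> Ip p (\<lambda>t. g t - (\<Sum>n\<in>F. a n * haar n t)) \<le> e" if e: "e > 0" for e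
  proof -
    have "e powr (1 / p) > 0" using e by simp
    then obtain F a where F: "finite F" "F \<subseteq> N" "Lp_norm p (\<lambda>t. g t - (\<Sum>n\<in>F. a n * haar n t)) < e powr (1 / p)"
      using L unfolding cspan_def by blast
    define d where "d = (\<lambda>t. g t - (\<Sum>n\<in>F. a n * haar n t))"
    have "memLp p d"
      unfolding d_def using F N by (intro memLp_diff(1)[OF p g] haar_poly(1)) auto
    hence "Ip p d powr (1 / p) < e powr (1 / p)" using F(3) by (simp add: Lp_norm_eq d_def)
    moreover have "e powr (1 / p) \<le> Ip p d powr (1 / p)" if "e \<le> Ip p d"
      using that e p by (intro powr_mono2) auto
    ultimately have "Ip p d \<le> e" by force
    thus ?thesis using F by (auto simp: d_def)
  qed
  have "av g (Suc 0) = 0"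
  proof (rule zero_of_small_powr)
    fix e :: real assume "e > 0"
    then obtain F a where F: "finite F" "F \<subseteq> N" "Ip p (\<lambda>t. g t - (\<Sum>n\<in>F. a n * haar n t)) \<le> e" using approx by blast
    have h: "memLp p (\<lambda>t. \<Sum>n\<in>F. a n * haar n t)" "av (\<lambda>t. \<Sum>n\<in>F. a n * haar n t) (Suc 0) = 0"
      using haar_poly(1)[of F a] haar_poly(2)[where F=F and m="Suc 0" and a=a] F N by auto
    have "av g (Suc 0) = av (\<lambda>t. g t - (\<Sum>n\<in>F. a n * haar n t)) (Suc 0)"
      using av_linear[OF memLp_integrable[OF p g] memLp_integrable[OF p h(1)], of 1 "-1"] h by simp
    thus "cmod (av g (Suc 0)) powr p \<le> 1 * e"
      using av_bound[OF p memLp_diff(1)[OF p g h(1)], of "Suc 0"] F by simp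
  qed simp
  moreover have "coef g n = 0" if n: "1 \<le> n" "n \<notin> N" for n
  proof (rule zero_of_small_powr)
    fix e :: real assume "e > 0"
    then obtain F a where F: "finite F" "F \<subseteq> N" "Ip p (\<lambda>t. g t - (\<Sum>n\<in>F. a n * haar n t)) \<le> e" using approx by blast
    have h: "memLp p (\<lambda>t. \<Sum>n\<in>F. a n * haar n t)" using haar_poly(1)[of F a] F N by auto
    have "coef (\<lambda>t. \<Sum>n\<in>F. a n * haar n t) n = (if n \<in> F then a n else 0)"
      by (rule coef_of_val[OF haar_poly(2) n(1)]) (use F N in auto)
    hence "coef g n = coef (\<lambda>t. g t - (\<Sum>n\<in>F. a n * haar n t)) n"
      using coef_linear[OF memLp_integrable[OF p g] memLp_integrable[OF p h], of 1 "-1" n] n F by auto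
    hence "cmod (coef g n) powr p \<le> 2^Suc (floor_log n) * Ip p (\<lambda>t. g t - (\<Sum>n\<in>F. a n * haar n t))"
      using coef_bound[OF memLp_diff(1)[OF p g h] n(1)] by simp
    also have "\<dots> \<le> 2^Suc (floor_log n) * e" using F by (intro mult_left_mono) auto
    finally show "cmod (coef g n) powr p \<le> 2^Suc (floor_log n) * e" .
  qed simp
  ultimately show ?R using g by blast
next
  assume R: ?R
  hence g: "memLp p g" by simp
  show ?L
    unfolding cspan_def
  proof (intro CollectI conjI allI impI g)
    fix e :: real assume e: "e > 0"
    obtain K where K: "Ip p (\<lambda>t. g t - av g (node K t)) < e powr p"
      using order_tendstoD(2)[OF martingale_tendsto[OF p g], of "e powr p"] e eventually_happens trivial_limit_sequentially
      by fastforce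
    define F where "F = {1..<2^K} \<inter> N"
    have eq: "(\<Sum>n\<in>F. coef g n * haar n t) = av g (node K t)" if t: "t \<in> unitI" for t
    proof -
      have "(\<Sum>n\<in>F. coef g n * haar n t) = (\<Sum>n=1..<2^K. coef g n * haar n t)"
        unfolding F_def by (rule sum.mono_neutral_left) (use R in auto)
      also have "\<dots> = val (coef g) (node K t)" by (rule haar_sum_level[OF t])
      also have "\<dots> = av g (node K t)"
        using val_coef[OF memLp_integrable[OF p g] node_pos[OF t]] R by simp
      finally show ?thesis .
    qed
    have F: "finite F" "F \<subseteq> {1..}" "F \<subseteq> N" by (auto simp: F_def)
    have "Ip p (\<lambda>t. g t - (\<Sum>n\<in>F. coef g n * haar n t)) = Ip p (\<lambda>t. g t - av g (node K t))"
      by (rule memLp_cong(2)) (simp add: eq)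
    hence "Lp_norm p (\<lambda>t. g t - (\<Sum>n\<in>F. coef g n * haar n t)) = Ip p (\<lambda>t. g t - av g (node K t)) powr (1 / p)"
      using Lp_norm_eq[OF memLp_diff(1)[OF p g haar_poly(1)[OF F(1,2), of "coef g"]]] by simp
    also have "\<dots> < (e powr p) powr (1 / p)"
      using K p Ip_nonneg by (intro powr_less_mono2) auto
    also have "\<dots> = e" using e p by (simp add: powr_powr)
    finally show "\<exists>F a. finite F \<and> F \<subseteq> N \<and> Lp_norm p (\<lambda>t. g t - (\<Sum>n\<in>F. a n * haar n t)) < e"
      using F by blast
  qed
qed

lemma Lp0_eq_cspan: "Lp0 p = cspan p haar {1..}"
  by (auto simp: cspan_haar_iff Lp0_def av_1)

lemma val_coef_cspan:
  assumes "N \<subseteq> {1..}" "x \<in> cspan p haar N" "1 \<le> n"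
  shows "av x n = val (coef x) n"
  using assms(2) val_coef[OF memLp_integrable[OF p] assms(3), of x] by (simp add: cspan_haar_iff[OF assms(1)])

text \<open>The lower half of the norm equivalence on the chain of 1: in the sum of p-th powers of
  the differences only the nodes 2^k are kept.\<close>

lemma summable_chain_coef:
  assumes "N \<subseteq> {1..}" "x \<in> cspan p haar N"
  shows "summable (wt p (\<lambda>k. coef x (2^k)))"
proof (rule summableI_nonneg_bounded)
  fix K
  have x: "memLp p x" using assms by (simp add: cspan_haar_iff)
  have "(\<Sum>k<K. wt p (\<lambda>k. coef x (2^k)) k) \<le> tsum K (\<lambda>n. cmod (coef x n) powr p)"
    unfolding wt_def using sum_powers_le_tsum[of "\<lambda>n. cmod (coef x n) powr p" K] by simp
  also have "\<dots> \<le> avg K (\<lambda>n. cmod (val (coef x) n) powr p)" by (rule tsum_powr_le_avg_val[OF p])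
  also have "\<dots> = avg K (\<lambda>n. cmod (av x n) powr p)"
  proof (rule avg_cong)
    fix n :: nat assume "2^K \<le> n"
    moreover have "(1::nat) \<le> 2^K" by simp
    ultimately have "1 \<le> n" by linarith
    thus "cmod (val (coef x) n) powr p = cmod (av x n) powr p" using val_coef_cspan[OF assms] by simp
  qed
  also have "\<dots> \<le> Ip p x" by (rule avg_av_le_Ip[OF p x])
  finally show "(\<Sum>k<K. wt p (\<lambda>k. coef x (2^k)) k) \<le> Ip p x" .
qed simp

end

text \<open>Unions of whole chains. Stability under doubling keeps the image of the operator in the
  span of N; stability under halving keeps each chain intact back to its root.\<close>

definition chain_closed :: "nat set \<Rightarrow> bool" where
  "chain_closed N \<longleftrightarrow> N \<subseteq> {1..} \<and> (\<forall>n\<ge>1. 2 * n \<in> N \<longleftrightarrow> n \<in> N)"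

lemma chain_closed_power:
  assumes "chain_closed N" "1 \<le> n"
  shows "n * 2^k \<in> N \<longleftrightarrow> n \<in> N"
proof (induction k)
  case (Suc k)
  have "n * 2^Suc k = 2 * (n * 2^k)" "1 \<le> n * 2^k" using assms(2) by auto
  thus ?case using Suc assms(1) by (simp only: chain_closed_def)
qed simp

lemma tconv_cong:
  assumes "\<And>i. 1 \<le> i \<Longrightarrow> \<xi> i = \<zeta> i" "1 \<le> n"
  shows "tconv c \<xi> n = tconv c \<zeta> n"
proof -
  obtain r k where rk: "odd r" "n = r * 2^k" using odd_power_decomp[OF assms(2)] .
  have "1 \<le> r" using rk(1) by (cases r) auto
  hence "1 \<le> r * 2^j" for j by simp
  hence "(\<lambda>j. \<xi> (r * 2^j)) = (\<lambda>j. \<zeta> (r * 2^j))" using assms(1) by blast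
  thus ?thesis unfolding rk(2) tconv_chain[OF rk(1)] by simp
qed

lemma tconv_support:
  assumes N: "chain_closed N" and \<xi>: "\<And>n. 1 \<le> n \<Longrightarrow> n \<notin> N \<Longrightarrow> \<xi> n = 0" and n: "1 \<le> n" "n \<notin> N"
  shows "tconv c \<xi> n = 0"
proof -
  obtain r k where rk: "odd r" "n = r * 2^k" using odd_power_decomp[OF n(1)] .
  have r: "1 \<le> r" using rk(1) by (cases r) auto
  hence "r \<notin> N" using chain_closed_power[OF N r, of k] n(2) rk(2) by simp
  hence "\<xi> (r * 2^j) = 0" for j using chain_closed_power[OF N r, of j] r by (intro \<xi>) auto
  thus ?thesis unfolding rk(2) tconv_chain[OF rk(1)] by (simp add: conv_def)
qed

lemma val_coef_diff: "1 \<le> n \<Longrightarrow> (val \<xi> (2 * n) - val \<xi> (Suc (2 * n))) / 2 = \<xi> n"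
  by simp

context
  fixes p :: real
  assumes p: "2 \<le> p"
begin

lemma Lp_norm_zero_iff: "memLp p g \<Longrightarrow> Lp_norm p g = 0 \<longleftrightarrow> Ip p g = 0"
  using p by (simp add: Lp_norm_eq)

lemma Lp_norm_le_iff:
  assumes "memLp p f" "memLp p g" "0 \<le> C"
  shows "Lp_norm p f \<le> C * Lp_norm p g \<longleftrightarrow> Ip p f \<le> C powr p * Ip p g"
proof -
  have C: "C = (C powr p) powr (1 / p)" using p assms(3) by (simp add: powr_powr)
  have "Lp_norm p f \<le> C * Lp_norm p g \<longleftrightarrow> Ip p f powr (1 / p) \<le> (C powr p * Ip p g) powr (1 / p)"
    by (subst C) (simp add: Lp_norm_eq assms powr_mult)
  also have "\<dots> \<longleftrightarrow> Ip p f \<le> C powr p * Ip p g"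
  proof
    assume h: "Ip p f powr (1 / p) \<le> (C powr p * Ip p g) powr (1 / p)"
    have "(Ip p f powr (1 / p)) powr p \<le> ((C powr p * Ip p g) powr (1 / p)) powr p"
      by (rule powr_mono2[OF _ _ h]) (use p in auto)
    thus "Ip p f \<le> C powr p * Ip p g" using p by (simp add: powr_powr Ip_nonneg)
  next
    assume "Ip p f \<le> C powr p * Ip p g"
    thus "Ip p f powr (1 / p) \<le> (C powr p * Ip p g) powr (1 / p)"
      using p by (intro powr_mono2) (auto simp: Ip_nonneg)
  qed
  finally show ?thesis .
qed

lemma cspan_linear:
  assumes N: "N \<subseteq> {1..}" and x: "x \<in> cspan p haar N" and y: "y \<in> cspan p haar N"
  shows "(\<lambda>t. a * x t + b * y t) \<in> cspan p haar N"
proof -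
  have m: "memLp p x" "memLp p y" using x y by (auto simp: cspan_haar_iff[OF p N])
  note i = memLp_integrable[OF p m(1)] memLp_integrable[OF p m(2)]
  show ?thesis
    using x y memLp_add(1)[OF p memLp_cmult(1)[OF m(1)] memLp_cmult(1)[OF m(2)], of a b]
    unfolding cspan_haar_iff[OF p N] coef_linear[OF i] av_linear[OF i] by simp
qed

lemma haar_poly_mem_cspan:
  assumes N: "N \<subseteq> {1..}" and F: "finite F" "F \<subseteq> N"
  shows "(\<lambda>t. \<Sum>n\<in>F. a n * haar n t) \<in> cspan p haar N"
    and "1 \<le> m \<Longrightarrow> coef (\<lambda>t. \<Sum>n\<in>F. a n * haar n t) m = (if m \<in> F then a m else 0)"
proof -
  have F1: "F \<subseteq> {1..}" using F N by blast
  show c: "coef (\<lambda>t. \<Sum>n\<in>F. a n * haar n t) m = (if m \<in> F then a m else 0)" if "1 \<le> m" for m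
    by (rule coef_of_val[OF haar_poly(2)[OF p F(1) F1] that])
  show "(\<lambda>t. \<Sum>n\<in>F. a n * haar n t) \<in> cspan p haar N"
    unfolding cspan_haar_iff[OF p N]
  proof (intro conjI allI impI)
    show "memLp p (\<lambda>t. \<Sum>n\<in>F. a n * haar n t)" by (rule haar_poly(1)[OF p F(1) F1])
    show "av (\<lambda>t. \<Sum>n\<in>F. a n * haar n t) (Suc 0) = 0"
      using haar_poly(2)[OF p F(1) F1, of "Suc 0" a] by simp
    show "coef (\<lambda>t. \<Sum>n\<in>F. a n * haar n t) n = 0" if "1 \<le> n" "n \<notin> N" for n
      using c[OF that(1)] that F by auto
  qed
qed

lemma haar_mem_cspan:
  assumes N: "N \<subseteq> {1..}" and n: "n \<in> N"
  shows "haar n \<in> cspan p haar N" and "1 \<le> m \<Longrightarrow> coef (haar n) m = (if m = n then 1 else 0)"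
proof -
  have eq: "(\<lambda>t. \<Sum>k\<in>{n}. 1 * haar k t) = haar n" by simp
  show "haar n \<in> cspan p haar N"
    using haar_poly_mem_cspan(1)[OF N, of "{n}" "\<lambda>_. 1"] n unfolding eq by simp
  show "coef (haar n) m = (if m = n then 1 else 0)" if "1 \<le> m"
    using haar_poly_mem_cspan(2)[OF N, of "{n}" m "\<lambda>_. 1"] n that unfolding eq by simp
qed

lemma cspan_partial_sum:
  assumes N: "N \<subseteq> {1..}" and x: "x \<in> cspan p haar N" and t: "t \<in> unitI"
  shows "(\<Sum>n\<in>{1..<2^K} \<inter> N. coef x n * haar n t) = av x (node K t)"
proof -
  have "(\<Sum>n\<in>{1..<2^K} \<inter> N. coef x n * haar n t) = (\<Sum>n=1..<2^K. coef x n * haar n t)"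
    by (rule sum.mono_neutral_left) (use x in \<open>auto simp: cspan_haar_iff[OF p N]\<close>)
  also have "\<dots> = val (coef x) (node K t)" by (rule haar_sum_level[OF t])
  also have "\<dots> = av x (node K t)" using val_coef_cspan[OF p N x node_pos[OF t]] by simp
  finally show ?thesis .
qed

lemma realize_in_cspan:
  assumes N: "N \<subseteq> {1..}" and B: "\<And>K. avg K (\<lambda>n. cmod (val \<xi> n) powr p) \<le> B"
    and \<xi>: "\<And>n. 1 \<le> n \<Longrightarrow> n \<notin> N \<Longrightarrow> \<xi> n = 0"
  shows "\<exists>y\<in>cspan p haar N. \<forall>n\<ge>1. av y n = val \<xi> n"
proof -
  obtain y where y: "memLp p y" "\<forall>n\<ge>1. av y n = val \<xi> n" using coef_realize[OF p B] by blast
  have "coef y n = \<xi> n" if "1 \<le> n" for n by (rule coef_of_val) (use y that in auto)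
  hence "y \<in> cspan p haar N" unfolding cspan_haar_iff[OF p N] using y \<xi> by simp
  thus ?thesis using y by blast
qed

text \<open>The coefficients c on the chain of n are realised by an L^p function whose partial sums
  tend to f_n at every point; the two therefore agree almost everywhere.\<close>

lemma av_dil_chaos:
  assumes c: "summable (wt p c)" and n: "1 \<le> n"
  shows "memLp p (dil (chaos1 c) n)" and "1 \<le> m \<Longrightarrow> av (dil (chaos1 c) n) m = val (chain_embed n c) m"
proof -
  obtain B where B: "\<And>K. avg K (\<lambda>m. cmod (val (chain_embed n c) m) powr p) \<le> B"
    using avg_val_chain_embed_bounded[OF p n c] by blast
  obtain y where y: "memLp p y" "\<forall>m\<ge>1. av y m = val (chain_embed n c) m" using coef_realize[OF p B] by blast
  have lim: "(\<lambda>K. av y (node K t)) \<longlonglongrightarrow> dil (chaos1 c) n t" if "t \<in> unitI" for t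
    using dil_chaos_tendsto[OF n that] y(2) node_pos[OF that] by simp
  note M = martingale_pointwise[OF p y(1) lim]
  show d: "memLp p (dil (chaos1 c) n)" by (rule M(1))
  show "av (dil (chaos1 c) n) m = val (chain_embed n c) m" if "1 \<le> m"
    using av_eq_of_Ip[OF p y(1) d M(2) that] y(2) that by simp
qed

text \<open>Supplies the test vectors from which c is recovered: every weighted summable sequence
  occurs along the chain of 1.\<close>

lemma chain_in_cspan:
  assumes N: "chain_closed N" "1 \<in> N" and b: "summable (wt p b)"
  shows "\<exists>x\<in>cspan p haar N. \<forall>k. coef x (2^k) = b k"
proof -
  have N1: "N \<subseteq> {1..}" using N by (simp add: chain_closed_def)
  obtain B where B: "\<And>K. avg K (\<lambda>m. cmod (val (chain_embed 1 b) m) powr p) \<le> B"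
    using avg_val_chain_embed_bounded[OF p _ b, of 1] by blast
  have "\<exists>x\<in>cspan p haar N. \<forall>n\<ge>1. av x n = val (chain_embed 1 b) n"
  proof (rule realize_in_cspan[OF N1 B])
    fix n assume "1 \<le> n" "n \<notin> N"
    hence "n \<noteq> 1 * 2^k" for k using chain_closed_power[OF N(1), of 1 k] N(2) by auto
    thus "chain_embed 1 b n = 0" by (rule chain_embed_off)
  qed
  then obtain x where x: "x \<in> cspan p haar N" "\<forall>n\<ge>1. av x n = val (chain_embed 1 b) n" by blast
  have "coef x (2^k) = b k" for k
  proof -
    have "coef x (2^k) = chain_embed 1 b (2^k)" by (rule coef_of_val) (use x in auto)
    thus ?thesis using chain_embed_on[of 1 b k] by simp
  qed
  thus ?thesis using x by blast
qed

text \<open>The coefficients are the increments of \<open>val\<close> along the leftmost path. There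
  \<open>val\<close> differs from the averages of f, which grow at most like 2^k, by 2^k times the
  mean; so a nonzero mean does no harm.\<close>

lemma chaos1_growth:
  assumes f: "memLp p (chaos1 c)"
  shows "\<exists>D. \<forall>k. cmod (c k) \<le> D * 2^k"
proof -
  let ?f = "chaos1 c" and ?v = "val (chain_embed 1 c)"
  define M where "M = 1 + Ip p ?f + cmod (av ?f (Suc 0))"
  have v: "cmod (?v (2^k)) \<le> 2^k * M" for k
  proof -
    have "cmod (av ?f (2^k)) \<le> 1 + cmod (av ?f (2^k)) powr p"
    proof (cases "cmod (av ?f (2^k)) \<le> 1")
      case False
      hence "cmod (av ?f (2^k)) powr 1 \<le> cmod (av ?f (2^k)) powr p" using p by (intro powr_mono) auto
      thus ?thesis using False by simp
    qed (simp add: add_increasing2)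
    also have "\<dots> \<le> 2^k * 1 + 2^k * Ip p ?f"
      using av_bound[OF p f, of "2^k"] by (intro add_mono) auto
    finally have "cmod (av ?f (2^k)) \<le> 2^k * (1 + Ip p ?f)" by (simp add: distrib_left)
    moreover have "?v (2^k) = av ?f (2^k) - 2^k * av ?f (Suc 0)"
      using av_chaos1(2)[OF memLp_integrable[OF p f], of k] by simp
    hence "cmod (?v (2^k)) \<le> cmod (av ?f (2^k)) + 2^k * cmod (av ?f (Suc 0))"
      using norm_triangle_ineq4[of "av ?f (2^k)" "2^k * av ?f (Suc 0)"] by (simp add: norm_mult norm_power)
    ultimately show ?thesis by (simp add: M_def distrib_left)
  qed
  have "cmod (c k) \<le> 3 * M * 2^k" for k
  proof -
    have "?v (2^Suc k) = ?v (2^k) + c k"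
      using val_double[of "2^k" "chain_embed 1 c"] chain_embed_on[of 1 c k] by simp
    hence "c k = ?v (2^Suc k) - ?v (2^k)" by simp
    hence "cmod (c k) \<le> cmod (?v (2^Suc k)) + cmod (?v (2^k))" using norm_triangle_ineq4 by metis
    also have "\<dots> \<le> 2^Suc k * M + 2^k * M" by (intro add_mono v)
    finally show ?thesis by (simp add: algebra_simps)
  qed
  thus ?thesis by blast
qed

end

section \<open>The equivalence\<close>

lemma cspan_val:
  assumes "2 \<le> p" "N \<subseteq> {1..}" "x \<in> cspan p haar N"
  shows "memLp p x" "integrable MI x" "\<And>n. 1 \<le> n \<Longrightarrow> av x n = val (coef x) n"
    "\<And>n. 1 \<le> n \<Longrightarrow> n \<notin> N \<Longrightarrow> coef x n = 0"
  using assms memLp_integrable[OF assms(1)] val_coef_cspan[OF assms]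
  by (auto simp: cspan_haar_iff[OF assms(1,2)])

context
  fixes p :: real
  assumes p: "2 \<le> p"
begin

text \<open>The image y is realised from its coefficients, instead of as a limit of images of finite
  sums; the bound on level averages serves both for its existence and for its norm.\<close>

lemma multiplier_operator:
  assumes c: "lp_mult p c" and N: "chain_closed N"
  shows "\<exists>C\<ge>0. \<forall>x\<in>cspan p haar N. \<exists>y\<in>cspan p haar N.
    (\<forall>n\<ge>1. av y n = val (tconv c (coef x)) n) \<and> Ip p y \<le> C * Ip p x"
proof -
  have N1: "N \<subseteq> {1..}" using N by (simp add: chain_closed_def)
  have "bounded_conv p c" using lp_mult_imp_bounded_conv[OF _ c] p by simp
  then obtain C where C: "C \<ge> 0" and bound: "\<forall>\<xi> K. avg K (\<lambda>n. cmod (val (tconv c \<xi>) n) powr p) \<le> C * avg K (\<lambda>n. cmod (val \<xi> n) powr p)"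
    using avg_val_tconv_le[OF p] by blast
  show ?thesis
  proof (intro exI[of _ "2 powr p * C"] conjI ballI)
    fix x assume x: "x \<in> cspan p haar N"
    note X = cspan_val[OF p N1 x]
    have lev: "1 \<le> n" if "2^K \<le> n" for n K :: nat
      using that one_le_power[of "2::nat" K] by linarith
    have b: "avg K (\<lambda>n. cmod (val (tconv c (coef x)) n) powr p) \<le> C * avg K (\<lambda>n. cmod (av x n) powr p)" for K
    proof -
      have "avg K (\<lambda>n. cmod (val (coef x) n) powr p) = avg K (\<lambda>n. cmod (av x n) powr p)"
        by (rule avg_cong) (simp add: X(3)[OF lev])
      thus ?thesis using bound[rule_format, of K "coef x"] by simp
    qed
    have "\<exists>y\<in>cspan p haar N. \<forall>n\<ge>1. av y n = val (tconv c (coef x)) n"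
    proof (rule realize_in_cspan[OF p N1])
      show "avg K (\<lambda>n. cmod (val (tconv c (coef x)) n) powr p) \<le> C * Ip p x" for K
        by (rule order_trans[OF b mult_left_mono[OF avg_av_le_Ip[OF p X(1)] C]])
      show "tconv c (coef x) n = 0" if "1 \<le> n" "n \<notin> N" for n
        by (rule tconv_support[OF N X(4) that])
    qed
    then obtain y where y: "y \<in> cspan p haar N" "\<forall>n\<ge>1. av y n = val (tconv c (coef x)) n" by blast
    have "Ip p y \<le> 2 powr p * C * Ip p x"
    proof (rule Ip_transfer[OF p X(1) cspan_val(1)[OF p N1 y(1)] C])
      fix K
      have "avg K (\<lambda>n. cmod (av y n) powr p) = avg K (\<lambda>n. cmod (val (tconv c (coef x)) n) powr p)"
        by (rule avg_cong) (simp add: y(2) lev)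
      thus "avg K (\<lambda>n. cmod (av y n) powr p) \<le> C * avg K (\<lambda>n. cmod (av x n) powr p)" using b[of K] by simp
    qed
    thus "\<exists>y\<in>cspan p haar N. (\<forall>n\<ge>1. av y n = val (tconv c (coef x)) n) \<and> Ip p y \<le> 2 powr p * C * Ip p x"
      using y by blast
  qed (use C in simp)
qed

text \<open>On coefficients the operators of c and e are inverse to each other, so the operator of e
  supplies both the lower norm bound and surjectivity.\<close>

lemma multiplier_imp_basis:
  assumes N: "chain_closed N" and c: "summable (wt p c)" "lp_mult p c"
    and e: "lp_mult p e" and ce: "conv c e = (\<lambda>k. unit_seq k)"
  shows "equiv_haar_basis p (dil (chaos1 c)) N (cspan p haar N)"
proof -
  let ?X = "cspan p haar N"
  have N1: "N \<subseteq> {1..}" using N by (simp add: chain_closed_def)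
  note X = cspan_val[OF p N1]
  obtain C1 where C1: "C1 \<ge> 0" and ex: "\<forall>x\<in>?X. \<exists>y\<in>?X. (\<forall>n\<ge>1. av y n = val (tconv c (coef x)) n) \<and> Ip p y \<le> C1 * Ip p x"
    using multiplier_operator[OF c(2) N] by blast
  have "\<exists>T. \<forall>x\<in>?X. T x \<in> ?X \<and> (\<forall>n\<ge>1. av (T x) n = val (tconv c (coef x)) n) \<and> Ip p (T x) \<le> C1 * Ip p x"
    by (rule bchoice) (use ex in blast)
  then obtain T where T: "\<And>x. x \<in> ?X \<Longrightarrow> T x \<in> ?X"
    and avT: "\<And>x n. x \<in> ?X \<Longrightarrow> 1 \<le> n \<Longrightarrow> av (T x) n = val (tconv c (coef x)) n"
    and IT: "\<And>x. x \<in> ?X \<Longrightarrow> Ip p (T x) \<le> C1 * Ip p x"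
    by blast
  have coefT: "coef (T x) n = tconv c (coef x) n" if "x \<in> ?X" "1 \<le> n" for x n
    by (rule coef_of_val[OF avT[OF that(1)] that(2)])
  obtain C2 where C2: "C2 \<ge> 0" and E: "\<forall>x\<in>?X. \<exists>y\<in>?X. (\<forall>n\<ge>1. av y n = val (tconv e (coef x)) n) \<and> Ip p y \<le> C2 * Ip p x"
    using multiplier_operator[OF e N] by blast
  have lower: "Ip p x \<le> 2 powr p * C2 * Ip p (T x)" if x: "x \<in> ?X" for x
  proof -
    obtain z where z: "z \<in> ?X" "\<forall>n\<ge>1. av z n = val (tconv e (coef (T x))) n" "Ip p z \<le> C2 * Ip p (T x)"
      using E T[OF x] by blast
    have "av z n = av x n" if "1 \<le> n" for n
    proof -
      have "val (tconv e (coef (T x))) n = val (coef x) n"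
      proof (rule val_cong)
        fix i :: nat assume i: "1 \<le> i"
        have "tconv e (coef (T x)) i = tconv e (tconv c (coef x)) i"
          by (rule tconv_cong[OF coefT[OF x] i])
        thus "tconv e (coef (T x)) i = coef x i" using tconv_inverse(1)[OF ce i] by simp
      qed
      thus ?thesis using z(2) X(3)[OF x] that by simp
    qed
    \<comment> \<open>The functions x and z have equal averages, so \<open>Ip_transfer\<close>
      applies with constant 1.\<close>
    hence "Ip p x \<le> 2 powr p * 1 * Ip p z"
      by (intro Ip_transfer[OF p X(1)[OF z(1)] X(1)[OF x]]) (auto intro!: avg_mono simp: le_trans[OF one_le_power])
    also have "\<dots> \<le> 2 powr p * 1 * (C2 * Ip p (T x))" using z(3) by (intro mult_left_mono) auto
    finally show ?thesis by (simp add: mult.assoc)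
  qed
  define D where "D = C1 + 2 powr p * C2 + 1"
  define C where "C = D powr (1 / p)"
  have D: "D > 0" "C1 \<le> D" "2 powr p * C2 \<le> D" using C1 C2 by (auto simp: D_def add_nonneg_pos)
  have C: "C > 0" "C powr p = D" using D p by (auto simp: C_def powr_powr)
  show ?thesis
    unfolding equiv_haar_basis_def
  proof (intro exI[of _ T] exI[of _ C] conjI ballI allI)
    show "C > 0" by (rule C)
    fix x assume x: "x \<in> ?X"
    show "T x \<in> ?X" by (rule T[OF x])
    have "Ip p (T x) \<le> D * Ip p x"
      using IT[OF x] mult_right_mono[OF D(2) Ip_nonneg[of p x]] by linarith
    thus "Lp_norm p (T x) \<le> C * Lp_norm p x"
      using Lp_norm_le_iff[OF p X(1)[OF T[OF x]] X(1)[OF x], of C] C by simp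
    have "Ip p x \<le> D * Ip p (T x)"
      using lower[OF x] mult_right_mono[OF D(3) Ip_nonneg[of p "T x"]] by linarith
    thus "Lp_norm p x \<le> C * Lp_norm p (T x)"
      using Lp_norm_le_iff[OF p X(1)[OF x] X(1)[OF T[OF x]], of C] C by simp
  next
    fix x y a b assume x: "x \<in> ?X" and y: "y \<in> ?X"
    let ?z = "\<lambda>s. a * x s + b * y s" and ?w = "\<lambda>t. a * T x t + b * T y t"
    have z: "?z \<in> ?X" by (rule cspan_linear[OF p N1 x y])
    have w: "?w \<in> ?X" by (rule cspan_linear[OF p N1 T[OF x] T[OF y]])
    have "Ip p (\<lambda>t. T ?z t - ?w t) = 0"
    proof (rule Ip_av_eq[OF p X(1)[OF T[OF z]] X(1)[OF w]])
      fix n :: nat assume n: "1 \<le> n"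
      have "av (T ?z) n = val (tconv c (coef ?z)) n" by (rule avT[OF z n])
      also have "\<dots> = val (\<lambda>m. a * tconv c (coef x) m + b * tconv c (coef y) m) n"
      proof (rule val_cong)
        fix i :: nat assume i: "1 \<le> i"
        have "tconv c (coef ?z) i = tconv c (\<lambda>m. a * coef x m + b * coef y m) i"
          by (rule tconv_cong[OF _ i]) (rule coef_linear[OF X(2)[OF x] X(2)[OF y]])
        thus "tconv c (coef ?z) i = a * tconv c (coef x) i + b * tconv c (coef y) i"
          by (simp only: tconv_linear)
      qed
      also have "\<dots> = a * av (T x) n + b * av (T y) n"
        unfolding val_linear avT[OF x n] avT[OF y n] ..
      also have "\<dots> = av ?w n" by (rule av_linear[OF X(2)[OF T[OF x]] X(2)[OF T[OF y]], symmetric])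
      finally show "av (T ?z) n = av ?w n" .
    qed
    thus "Lp_norm p (\<lambda>t. T ?z t - (a * T x t + b * T y t)) = 0"
      using Lp_norm_zero_iff[OF p memLp_diff(1)[OF p X(1)[OF T[OF z]] X(1)[OF w]]] by simp
  next
    fix y assume y: "y \<in> ?X"
    obtain x where x: "x \<in> ?X" "\<forall>n\<ge>1. av x n = val (tconv e (coef y)) n" using E y by blast
    have "Ip p (\<lambda>t. T x t - y t) = 0"
    proof (rule Ip_av_eq[OF p X(1)[OF T[OF x(1)]] X(1)[OF y]])
      fix n :: nat assume n: "1 \<le> n"
      have "val (tconv c (coef x)) n = val (coef y) n"
      proof (rule val_cong)
        fix i :: nat assume i: "1 \<le> i"
        have "coef x m = tconv e (coef y) m" if "1 \<le> m" for m
          by (rule coef_of_val[OF _ that]) (use x in auto)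
        hence "tconv c (coef x) i = tconv c (tconv e (coef y)) i" by (rule tconv_cong[OF _ i])
        thus "tconv c (coef x) i = coef y i" using tconv_inverse(2)[OF ce i] by simp
      qed
      thus "av (T x) n = av y n" using avT[OF x(1) n] X(3)[OF y n] by simp
    qed
    hence "Lp_norm p (\<lambda>t. T x t - y t) = 0"
      using Lp_norm_zero_iff[OF p memLp_diff(1)[OF p X(1)[OF T[OF x(1)]] X(1)[OF y]]] by simp
    thus "\<exists>x\<in>?X. Lp_norm p (\<lambda>t. T x t - y t) = 0" using x by blast
  next
    fix n assume n: "n \<in> N"
    hence n1: "1 \<le> n" using N1 by auto
    have h: "haar n \<in> ?X" by (rule haar_mem_cspan(1)[OF p N1 n])
    note d = av_dil_chaos[OF p c(1) n1]
    have "Ip p (\<lambda>t. T (haar n) t - dil (chaos1 c) n t) = 0"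
    proof (rule Ip_av_eq[OF p X(1)[OF T[OF h]] d(1)])
      fix m :: nat assume m: "1 \<le> m"
      have "val (tconv c (coef (haar n))) m = val (chain_embed n c) m"
      proof (rule val_cong)
        fix i :: nat assume i: "1 \<le> i"
        have "tconv c (coef (haar n)) i = tconv c (\<lambda>i. if i = n then 1 else 0) i"
          by (rule tconv_cong[OF _ i]) (rule haar_mem_cspan(2)[OF p N1 n])
        thus "tconv c (coef (haar n)) i = chain_embed n c i" using tconv_unit[OF n1 i] by simp
      qed
      thus "av (T (haar n)) m = av (dil (chaos1 c) n) m" using avT[OF h m] d(2)[OF m] by simp
    qed
    thus "Lp_norm p (\<lambda>t. T (haar n) t - dil (chaos1 c) n t) = 0"
      using Lp_norm_zero_iff[OF p memLp_diff(1)[OF p X(1)[OF T[OF h]] d(1)]] by simp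
  qed
qed

text \<open>The image of h_1 lies in the span, hence has mean zero, and equals f almost everywhere.
  So the mean of f vanishes and c is the sequence of its Haar coefficients.\<close>

lemma basis_imp_summable:
  assumes f: "memLp p (chaos1 c)" and N: "N \<subseteq> {1..}" "1 \<in> N"
    and B: "equiv_haar_basis p (dil (chaos1 c)) N (cspan p haar N)"
  shows "summable (wt p c)"
proof -
  let ?X = "cspan p haar N" and ?f = "chaos1 c"
  obtain T where T: "\<And>x. x \<in> ?X \<Longrightarrow> T x \<in> ?X" and base: "\<And>n. n \<in> N \<Longrightarrow> Lp_norm p (\<lambda>t. T (haar n) t - dil ?f n t) = 0"
    using B unfolding equiv_haar_basis_def by blast
  have h: "T (haar 1) \<in> ?X" by (rule T[OF haar_mem_cspan(1)[OF p N]])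
  note mh = cspan_val(1)[OF p N(1) h]
  have d: "memLp p (dil ?f 1)" using memLp_cong(1)[of "dil ?f 1" ?f p] dil_1 f by simp
  have "Ip p (\<lambda>t. T (haar 1) t - dil ?f 1 t) = 0"
    using base[OF N(2)] Lp_norm_zero_iff[OF p memLp_diff(1)[OF p mh d]] by simp
  hence "Ip p (\<lambda>t. T (haar 1) t - ?f t) = 0"
    using memLp_cong(2)[of "\<lambda>t. T (haar 1) t - dil ?f 1 t" "\<lambda>t. T (haar 1) t - ?f t" p] dil_1 by simp
  hence "av (T (haar 1)) (Suc 0) = av ?f (Suc 0)" by (intro av_eq_of_Ip[OF p mh f]) auto
  hence mean: "av ?f (Suc 0) = 0" using h by (simp add: cspan_haar_iff[OF p N(1)])
  have cf: "coef ?f n = chain_embed 1 c n" if "1 \<le> n" for n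
    by (rule coef_of_val[OF av_chaos1_mean_zero[OF memLp_integrable[OF p f] mean] that])
  have "?f \<in> cspan p haar {1..}" using f mean by (simp add: cspan_haar_iff[OF p])
  hence "summable (wt p (\<lambda>k. coef ?f (2^k)))" by (rule summable_chain_coef[OF p order_refl])
  moreover have "coef ?f (2^k) = c k" for k using cf[of "2^k"] chain_embed_on[of 1 c k] by simp
  ultimately show ?thesis by simp
qed

text \<open>On the chain of 1 the isomorphism acts as convolution by c. That it maps into the span
  makes c a multiplier, and surjectivity lets the convolution equation be solved for every
  right-hand side.\<close>

lemma basis_imp_multiplier:
  assumes f: "memLp p (chaos1 c)" and N: "chain_closed N" "1 \<in> N"
    and B: "equiv_haar_basis p (dil (chaos1 c)) N (cspan p haar N)"
  shows "summable (wt p c) \<and> lp_mult p c \<and> (\<exists>e. summable (wt p e) \<and> lp_mult p e \<and> conv c e = (\<lambda>k. unit_seq k))"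
proof -
  let ?X = "cspan p haar N" and ?f = "chaos1 c"
  have N1: "N \<subseteq> {1..}" using N by (simp add: chain_closed_def)
  note X = cspan_val[OF p N1]
  have c: "summable (wt p c)" by (rule basis_imp_summable[OF f N1 N(2) B])
  obtain T C where C: "C > 0" and T: "\<And>x. x \<in> ?X \<Longrightarrow> T x \<in> ?X"
    and bd: "\<And>x. x \<in> ?X \<Longrightarrow> Lp_norm p (T x) \<le> C * Lp_norm p x"
    and lin: "\<And>x y a b. x \<in> ?X \<Longrightarrow> y \<in> ?X \<Longrightarrow> Lp_norm p (\<lambda>t. T (\<lambda>s. a * x s + b * y s) t - (a * T x t + b * T y t)) = 0"
    and surj: "\<And>y. y \<in> ?X \<Longrightarrow> \<exists>x\<in>?X. Lp_norm p (\<lambda>t. T x t - y t) = 0"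
    and base: "\<And>n. n \<in> N \<Longrightarrow> Lp_norm p (\<lambda>t. T (haar n) t - dil ?f n t) = 0"
    using B unfolding equiv_haar_basis_def by blast
  have IT: "Ip p (T x) \<le> C powr p * Ip p x" if "x \<in> ?X" for x
    using bd[OF that] Lp_norm_le_iff[OF p X(1)[OF T[OF that]] X(1)[OF that], of C] C by simp
  have avlin: "av (T (\<lambda>s. a * x s + b * y s)) m = a * av (T x) m + b * av (T y) m"
    if x: "x \<in> ?X" and y: "y \<in> ?X" and m: "1 \<le> m" for x y a b m
  proof -
    note z = X(1)[OF T[OF cspan_linear[OF p N1 x y, of a b]]]
    note w = X(1)[OF cspan_linear[OF p N1 T[OF x] T[OF y], of a b]]
    have "Ip p (\<lambda>t. T (\<lambda>s. a * x s + b * y s) t - (a * T x t + b * T y t)) = 0"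
      using lin[OF x y] Lp_norm_zero_iff[OF p memLp_diff(1)[OF p z w]] by simp
    hence "av (T (\<lambda>s. a * x s + b * y s)) m = av (\<lambda>t. a * T x t + b * T y t) m"
      by (rule av_eq_of_Ip[OF p z w _ m])
    thus ?thesis using av_linear[OF X(2)[OF T[OF x]] X(2)[OF T[OF y]]] by simp
  qed
  have av_haar: "av (T (haar n)) m = val (chain_embed n c) m" if n: "n \<in> N" and m: "1 \<le> m" for n m
  proof -
    have n1: "1 \<le> n" using n N1 by auto
    note d = av_dil_chaos[OF p c n1]
    note h = X(1)[OF T[OF haar_mem_cspan(1)[OF p N1 n]]]
    have "Ip p (\<lambda>t. T (haar n) t - dil ?f n t) = 0"
      using base[OF n] Lp_norm_zero_iff[OF p memLp_diff(1)[OF p h d(1)]] by simp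
    from av_eq_of_Ip[OF p h d(1) this m] show ?thesis using d(2)[OF m] by simp
  qed
  have av_sum: "av (T (\<lambda>t. \<Sum>n\<in>F. a n * haar n t)) m = (\<Sum>n\<in>F. a n * val (chain_embed n c) m)"
    if "finite F" "F \<subseteq> N" "1 \<le> m" for F a m
    using that(1,2)
  proof (induction F)
    case empty
    have z: "(\<lambda>t. 0) \<in> ?X" using haar_poly_mem_cspan(1)[OF p N1, of "{}"] by simp
    have "av (T (\<lambda>s. 0 * 0 + 0 * 0)) m = 0 * av (T (\<lambda>t. 0)) m + 0 * av (T (\<lambda>t. 0)) m"
      by (rule avlin[OF z z that(3)])
    thus ?case by simp
  next
    case (insert k F)
    have k: "haar k \<in> ?X" using insert by (intro haar_mem_cspan(1)[OF p N1]) auto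
    have F: "(\<lambda>t. \<Sum>n\<in>F. a n * haar n t) \<in> ?X" using insert by (intro haar_poly_mem_cspan(1)[OF p N1]) auto
    have "(\<lambda>t. \<Sum>n\<in>insert k F. a n * haar n t) = (\<lambda>t. a k * haar k t + 1 * (\<Sum>n\<in>F. a n * haar n t))"
      using insert by simp
    thus ?case using avlin[OF k F that(3), of "a k" 1] insert av_haar[of k m] that(3) by simp
  qed
  \<comment> \<open>For finite Haar sums this is linearity; for general x both sides are compared
    with a level-K partial sum, K > k, using continuity of T and of the coefficient.\<close>
  have coefT: "coef (T x) (2^k) = conv c (\<lambda>j. coef x (2^j)) k" if x: "x \<in> ?X" for x k
  proof -
    define S where "S = (\<lambda>K t. \<Sum>n\<in>{1..<2^K} \<inter> N. coef x n * haar n t)"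
    have S: "S K \<in> ?X" for K unfolding S_def by (rule haar_poly_mem_cspan(1)[OF p N1]) auto
    have coefS: "coef (T (S K)) (2^k) = conv c (\<lambda>j. coef x (2^j)) k" if K: "k < K" for K
    proof -
      let ?F = "{1..<2^K} \<inter> N"
      have k1: "1 \<le> (2::nat)^k" by simp
      have "coef (T (S K)) (2^k) = (\<Sum>n\<in>?F. coef x n * ((val (chain_embed n c) (2 * 2^k) - val (chain_embed n c) (Suc (2 * 2^k))) / 2))"
      proof -
        have avS: "av (T (S K)) m = (\<Sum>n\<in>?F. coef x n * val (chain_embed n c) m)" if "1 \<le> m" for m
          unfolding S_def by (rule av_sum) (use that in auto)
        have m: "1 \<le> 2 * (2::nat)^k" "1 \<le> Suc (2 * 2^k)" by auto
        show ?thesis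
          unfolding coef_def[of "T (S K)"] avS[OF m(1)] avS[OF m(2)]
          by (simp only: sum_subtractf[symmetric] sum_divide_distrib right_diff_distrib times_divide_eq_right)
      qed
      also have "\<dots> = (\<Sum>n\<in>?F. coef x n * chain_embed n c (2^k))"
        unfolding val_coef_diff[OF k1] ..
      also have "\<dots> = (\<Sum>n\<in>(\<lambda>i. 2^i) ` {..k}. coef x n * chain_embed n c (2^k))"
      proof (rule sum.mono_neutral_right)
        show "(\<lambda>i. 2^i) ` {..k} \<subseteq> ?F"
        proof (rule image_subsetI)
          fix i assume "i \<in> {..k}"
          hence "(2::nat)^i < 2^K" using K by (intro power_strict_increasing) auto
          moreover have "2^i \<in> N" using chain_closed_power[OF N(1), of 1 i] N(2) by simp
          ultimately show "2^i \<in> ?F" by simp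
        qed
        show "\<forall>n\<in>?F - (\<lambda>i. 2^i) ` {..k}. coef x n * chain_embed n c (2^k) = 0"
        proof
          fix n assume n: "n \<in> ?F - (\<lambda>i. 2^i) ` {..k}"
          have "2^k \<noteq> n * 2^j" for j
          proof
            assume eq: "2^k = n * 2^j"
            have "(2::nat)^j \<le> 2^k" unfolding eq using n by simp
            hence j: "j \<le> k" using power_le_imp_le_exp[of "2::nat" j k] by simp
            hence "n * 2^j = 2^(k - j) * 2^j" using eq by (simp flip: power_add)
            hence "n = 2^(k - j)" by simp
            thus False using n by auto
          qed
          hence "chain_embed n c (2^k) = 0" by (rule chain_embed_off)
          thus "coef x n * chain_embed n c (2^k) = 0" by simp
        qed
      qed simp
      also have "\<dots> = (\<Sum>i\<le>k. coef x (2^i) * chain_embed (2^i) c (2^k))"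
        by (subst sum.reindex) (auto simp: inj_on_def)
      also have "\<dots> = (\<Sum>i\<le>k. coef x (2^i) * c (k - i))"
      proof (rule sum.cong)
        fix i assume "i \<in> {..k}"
        hence "(2::nat)^k = 2^i * 2^(k - i)" by (simp flip: power_add)
        thus "coef x (2^i) * chain_embed (2^i) c (2^k) = coef x (2^i) * c (k - i)"
          using chain_embed_on[of "2^i" c "k - i"] by simp
      qed simp
      also have "\<dots> = (\<Sum>i\<le>k. c i * coef x (2^(k - i)))"
        by (rule sum.reindex_bij_witness[where i="\<lambda>i. k - i" and j="\<lambda>i. k - i"]) auto
      finally show ?thesis by (simp add: conv_def)
    qed
    have "coef (T x) (2^k) - conv c (\<lambda>j. coef x (2^j)) k = 0"
    proof (rule zero_of_small_powr)
      fix e :: real assume "e > 0"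
      from order_tendstoD(2)[OF martingale_tendsto[OF p X(1)[OF x]] this]
      obtain K0 where "\<And>K. K \<ge> K0 \<Longrightarrow> Ip p (\<lambda>t. x t - av x (node K t)) < e"
        by (auto simp: eventually_sequentially)
      moreover define K where "K = max K0 (Suc k)"
      ultimately have K: "k < K" "Ip p (\<lambda>t. x t - av x (node K t)) < e" by auto
      have D: "(\<lambda>s. 1 * x s + (-1) * S K s) \<in> ?X" by (rule cspan_linear[OF p N1 x S])
      have "Ip p (\<lambda>s. 1 * x s + (-1) * S K s) = Ip p (\<lambda>t. x t - av x (node K t))"
        by (rule memLp_cong(2)) (use cspan_partial_sum[OF p N1 x] in \<open>simp add: S_def\<close>)
      hence IE: "Ip p (T (\<lambda>s. 1 * x s + (-1) * S K s)) \<le> C powr p * e"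
        using order_trans[OF IT[OF D] mult_left_mono[of _ e "C powr p"]] K by simp
      have CE: "coef (T (\<lambda>s. 1 * x s + (-1) * S K s)) (2^k) = coef (T x) (2^k) - coef (T (S K)) (2^k)"
        unfolding coef_def by (subst (1 2) avlin[OF x S]) (auto simp: field_simps)
      have "cmod (coef (T x) (2^k) - coef (T (S K)) (2^k)) powr p
          \<le> 2^Suc k * Ip p (T (\<lambda>s. 1 * x s + (-1) * S K s))"
        using coef_bound[OF p X(1)[OF T[OF D]], of "2^k"] unfolding CE by simp
      also have "\<dots> \<le> 2^Suc k * (C powr p * e)" by (rule mult_left_mono[OF IE]) simp
      finally have "cmod (coef (T x) (2^k) - coef (T (S K)) (2^k)) powr p \<le> 2^Suc k * (C powr p * e)" .
      thus "cmod (coef (T x) (2^k) - conv c (\<lambda>j. coef x (2^j)) k) powr p \<le> (2^Suc k * C powr p) * e"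
        unfolding coefS[OF K(1)] by (simp only: mult.assoc)
    qed (use C in simp)
    thus ?thesis by simp
  qed
  have mult: "lp_mult p c"
    unfolding lp_mult_def
  proof (intro allI impI)
    fix b assume "summable (wt p b)"
    then obtain x where x: "x \<in> ?X" "\<forall>k. coef x (2^k) = b k" using chain_in_cspan[OF p N] by blast
    have "(\<lambda>k. coef (T x) (2^k)) = conv c b" using coefT[OF x(1)] x(2) by auto
    thus "summable (wt p (conv c b))" using summable_chain_coef[OF p N1 T[OF x(1)]] by simp
  qed
  have solve: "\<exists>a. summable (wt p a) \<and> conv c a = b" if sb: "summable (wt p b)" for b
  proof -
    obtain y where y: "y \<in> ?X" "\<forall>k. coef y (2^k) = b k" using chain_in_cspan[OF p N sb] by blast
    obtain x where x: "x \<in> ?X" "Lp_norm p (\<lambda>t. T x t - y t) = 0" using surj[OF y(1)] by blast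
    note m = X(1)[OF T[OF x(1)]] X(1)[OF y(1)]
    have "Ip p (\<lambda>t. T x t - y t) = 0" using x(2) Lp_norm_zero_iff[OF p memLp_diff(1)[OF p m]] by simp
    hence "av (T x) n = av y n" if "1 \<le> n" for n by (rule av_eq_of_Ip[OF p m _ that])
    hence "coef (T x) n = coef y n" if "1 \<le> n" for n using that by (simp add: coef_def)
    hence "conv c (\<lambda>j. coef x (2^j)) k = b k" for k using coefT[OF x(1), of k] y(2) by simp
    thus ?thesis using summable_chain_coef[OF p N1 x(1)] by blast
  qed
  have p0: "p > 0" using p by simp
  obtain e where e: "summable (wt p e)" "conv c e = (\<lambda>k. unit_seq k)"
    using solve[OF wt_unit_summable[OF p0]] by blast
  \<comment> \<open>The solution a of conv c a = b is conv e b, so summability of solutions makes e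
    a multiplier.\<close>
  have "lp_mult p e"
    unfolding lp_mult_def
  proof (intro allI impI)
    fix b assume "summable (wt p b)"
    then obtain a where a: "summable (wt p a)" "conv c a = b" using solve by blast
    thus "summable (wt p (conv e b))" using conv_inverse(1)[OF e(2), of a] by simp
  qed
  thus ?thesis using c mult e by blast
qed

end

lemma chain_closed_all: "chain_closed {1..}"
  by (auto simp: chain_closed_def)

text \<open>Doubling shifts the binary digits and keeps their number of ones.\<close>

lemma chain_closed_Nd: "chain_closed (Nd d)"
  unfolding chain_closed_def
proof (intro conjI allI impI)
  show "Nd d \<subseteq> {1..}" by (auto simp: Nd_def)
  fix n :: nat assume n: "1 \<le> n"
  have "{i. bit (2 * n) i} = Suc ` {i. bit n i}"
  proof (intro set_eqI iffI)
    fix i assume "i \<in> {i. bit (2 * n) i}"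
    thus "i \<in> Suc ` {i. bit n i}" by (cases i) (auto simp: bit_double_iff bit_0)
  qed (auto simp: bit_double_iff)
  hence "card {i. bit (2 * n) i} = card {i. bit n i}" by (simp add: card_image)
  thus "2 * n \<in> Nd d \<longleftrightarrow> n \<in> Nd d" using n by (simp add: Nd_def)
qed

lemma Nd_1: "Nd 1 = range (\<lambda>k. 2 ^ k)"
proof (intro set_eqI iffI)
  fix n assume "n \<in> Nd 1"
  then obtain k where "{i. bit n i} = {k}" by (auto simp: Nd_def card_1_singleton_iff)
  hence "bit n i \<longleftrightarrow> bit (2^k :: nat) i" for i by (auto simp: bit_exp_iff)
  hence "n = 2^k" by (rule bit_eqI)
  thus "n \<in> range (\<lambda>k. 2 ^ k)" by blast
next
  fix n assume "n \<in> range (\<lambda>k. 2 ^ k :: nat)"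
  then obtain k where k: "n = 2^k" by blast
  hence "{i. bit n i} = {k}" by (auto simp: bit_exp_iff)
  thus "n \<in> Nd 1" using k by (simp add: Nd_def)
qed

theorem theorem1:
  fixes p :: real and c :: "nat \<Rightarrow> complex"
  assumes "2 \<le> p"
    and "memLp p (chaos1 c)"
  shows "(equiv_haar_basis p (dil (chaos1 c)) {1..} (Lp0 p)
          \<longleftrightarrow> (\<forall>d\<ge>1. equiv_haar_basis p (dil (chaos1 c)) (Nd d) (cspan p haar (Nd d))))
       \<and> ((\<forall>d\<ge>1. equiv_haar_basis p (dil (chaos1 c)) (Nd d) (cspan p haar (Nd d)))
          \<longleftrightarrow> equiv_haar_basis p (dil (chaos1 c)) (range (\<lambda>k. 2 ^ k)) (cspan p haar (Nd 1)))
       \<and> (equiv_haar_basis p (dil (chaos1 c)) (range (\<lambda>k. 2 ^ k)) (cspan p haar (Nd 1))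
          \<longleftrightarrow> ((\<forall>z\<in>ball 0 (2 powr (-1 / p)). symbol c z \<noteq> 0)
               \<and> symbol c \<in> Mp_plus p (2 powr (-1 / p))
               \<and> (\<lambda>z. 1 / symbol c z) \<in> Mp_plus p (2 powr (-1 / p))))"
proof -
  define basis where "basis N \<longleftrightarrow> equiv_haar_basis p (dil (chaos1 c)) N (cspan p haar N)" for N
  \<comment> \<open>The condition on coefficients with which every condition of the theorem is
    compared.\<close>
  define mult where "mult \<longleftrightarrow> summable (wt p c) \<and> lp_mult p c \<and>
    (\<exists>e. summable (wt p e) \<and> lp_mult p e \<and> conv c e = (\<lambda>k. unit_seq k))"
  have A: "mult" if "basis N" "chain_closed N" "1 \<in> N" for N
    using basis_imp_multiplier[OF assms that(2,3)] that(1) unfolding basis_def mult_def by blast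
  have B: "basis N" if mult "chain_closed N" for N
    using multiplier_imp_basis[OF assms(1) that(2)] that(1) unfolding basis_def mult_def by blast
  have "(1::nat) \<in> Nd 1" unfolding Nd_1 by (rule range_eqI[of _ _ 0]) simp
  \<comment> \<open>Recovering \<open>mult\<close> takes an index set that contains 1, so in the
    third equivalence it comes from d = 1; the other N_d are reached from
    \<open>mult\<close>.\<close>
  hence eqs: "basis {1..} \<longleftrightarrow> mult" "basis (Nd 1) \<longleftrightarrow> mult" "(\<forall>d\<ge>1. basis (Nd d)) \<longleftrightarrow> mult"
    using A[OF _ chain_closed_all] A[OF _ chain_closed_Nd] B[OF _ chain_closed_all] B[OF _ chain_closed_Nd]
    by (blast, blast, blast)
  obtain D where growth: "\<And>k. cmod (c k) \<le> D * 2^k" using chaos1_growth[OF assms] by blast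
  show ?thesis
    unfolding Lp0_eq_cspan[OF assms(1)] Nd_1[symmetric] symbol_condition_iff[OF assms(1) growth]
      mult_def[symmetric] basis_def[symmetric] eqs by blast
qed

end
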